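(* Let $\xi,\eta\in(0,1)$, $\rho>0$, $T>0$, $\lambda>0$, let $a:[0,1]\to\mathbb{R}$ be continuous almost everywhere with $a(x)\neq 0$, and let $q:[0,T]\to\mathbb{R}$ be a given function. Let $n,m\to\infty$ in such a way that $$\frac{\alpha_n}{\beta_m}\to\nu$$ for some real number $\nu\neq 0$. With $N=(n+1)m$ and $$A_N=\begin{bmatrix} U_n\otimes I_m+I_n\otimes\frac{\alpha_n}{\beta_m}G_m & -\alpha_n\,\mathbf{q}\otimes I_m\\ \mathbf{e}_n^T\otimes I_m & \frac{\lambda}{\beta_m}G_m\end{bmatrix}\in\mathbb{C}^{N\times N},$$ it holds $$\{A_N\}_N\sim_{\mathrm{GLT}}\kappa\quad\text{and}\quad\{A_N\}_N\sim_\sigma\kappa,\qquad \kappa = h_\xi(\theta_1)+\nu\,a(x)\,g_\eta(\theta_2),\quad (\theta_1,\theta_2)\in[-\pi,\pi]^2,\ x\in[0,1],$$ where $g_\eta$ and $h_\xi$ are the continuous $2\pi$-periodic functions with $\{B_m\}_m\sim_{\mathrm{GLT}}g_\eta(\theta)$ and $\{U_n\}_n\sim_{\mathrm{GLT}}h_\xi(\theta)$ (these exist, and are uniquely determined since GLT symbols are unique a.e.). Here $\{A_N\}_N$ is regarded as a two-level matrix sequence with multi-index $(n+1,m)$, and the variable $x$ is the second space variable $x_2$ of the symbol (which is constant in $x_1$).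
   Context: Discretization matrices. For positive integers $n,m$: $\Delta t=T/n$, $t_j=j\Delta t$, $\alpha_n=(T/n)^{\xi}\,\Gamma(2-\xi)$, $\beta_m=(m+1)^{-\eta}\,\Gamma(2-\eta)$. Let $\gamma_0=1$, $\gamma_l=(l+1)^{1-\xi}-2l^{1-\xi}+(l-1)^{1-\xi}$ for $l\ge1$, and $\delta_0=1$, $\delta_k=(k+1)^{1-\eta}-2k^{1-\eta}+(k-1)^{1-\eta}$ for $k\ge1$. $U_n$ is the $n\times n$ lower triangular Toeplitz matrix with $(i,j)$ entry $\gamma_{i-j}e^{-\rho(i-j)\Delta t}$ for $i\ge j$ and $0$ otherwise. $B_m$ is the $m\times m$ lower triangular Toeplitz matrix with $(i,j)$ entry $\delta_{i-j}$ for $i\ge j$ and $0$ otherwise. $D_m(a)=\mathrm{diag}_{i=1,\dots,m}\,a(i/m)$, and $G_m=D_m(a)B_m$. $I_m$ is the identity of size $m$, $\mathbf{e}_n=(0,\dots,0,1)^T\in\mathbb{R}^n$, $\mathbf{q}=(q(t_1),\dots,q(t_n))^T\in\mathbb{R}^n$, and $\otimes$ is the Kronecker product. Singular value distribution. For a matrix sequence $\{A_n\}_n$ with $A_n$ of size $d_n\times d_n$, $d_n\to\infty$, and a measurable $\psi:D\subset\mathbb{R}^t\to\mathbb{C}$ with $0<\mu_t(D)<\infty$ ($\mu_t$ Lebesgue measure), $\{A_n\}_n\sim_\sigma\psi$ means that for every continuous compactly supported $F:\mathbb{R}\to\mathbb{C}$, $\lim_{n\to\infty}\frac1{d_n}\sum_{i=1}^{d_n}F(\sigma_i(A_n))=\frac1{\mu_t(D)}\int_D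 F(|\psi(\mathbf{x})|)\,d\mathbf{x}$, where $\sigma_i(A_n)$ are the singular values of $A_n$. GLT sequences ($d$-level, $d\ge 1$). A $d$-level matrix sequence $\{A_{\mathbf n}\}$ is indexed by a sequence of multi-indices $\mathbf n=(n_1,\dots,n_d)\in\mathbb{N}^d$ with $\min_i n_i\to\infty$, and $A_{\mathbf n}$ has size $N(\mathbf n)=n_1\cdots n_d$; rows and columns are indexed by multi-indices $\mathbf i$ with $1\le i_s\le n_s$ in lexicographic order. For $f\in L^1([-\pi,\pi]^d)$ with Fourier coefficients $\hat f_{\mathbf k}=(2\pi)^{-d}\int f(\boldsymbol\theta)e^{-\mathrm{i}\,\mathbf k\cdot\boldsymbol\theta}d\boldsymbol\theta$, $T_{\mathbf n}(f)=[\hat f_{\mathbf i-\mathbf j}]_{\mathbf i,\mathbf j}$; for $b:[0,1]^d\to\mathbb{C}$, $D_{\mathbf n}(b)=\mathrm{diag}_{\mathbf i}\,b(i_1/n_1,\dots,i_d/n_d)$. A family $\{\{B_{\mathbf n,r}\}_{\mathbf n}\}_{r\in\mathbb{N}}$ is an approximating class of sequences (a.c.s.) for $\{A_{\mathbf n}\}$ if there are $c(r),\omega(r)\to0$ as $r\to\infty$ such that for each $r$ and all sufficiently large $\mathbf n$ one has $A_{\mathbf n}=B_{\mathbf n,r}+R_{\mathbf n,r}+N_{\mathbf n,r}$ with $\mathrm{rank}(R_{\mathbf n,r})\le c(r)N(\mathbf n)$ and $\|N_{\mathbf n,r}\|\le\omega(r)$ (spectral norm). For measurable $\kappa:[0,1]^d\times[-\pi,\pi]^d\to\mathbb{C}$,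 $\{A_{\mathbf n}\}\sim_{\mathrm{GLT}}\kappa$ means: for every $r$ there are finitely many continuous $b_{i,r}:[0,1]^d\to\mathbb{C}$ and trigonometric polynomials $f_{i,r}$ such that $\sum_i b_{i,r}(\mathbf x)f_{i,r}(\boldsymbol\theta)\to\kappa(\mathbf x,\boldsymbol\theta)$ in measure as $r\to\infty$ and $\{\sum_i D_{\mathbf n}(b_{i,r})T_{\mathbf n}(f_{i,r})\}_{\mathbf n}$, $r\in\mathbb{N}$, is an a.c.s. for $\{A_{\mathbf n}\}$. The symbol $\kappa$ is unique up to a.e. equality. Writing $\{A_{\mathbf n}\}\sim_{\mathrm{GLT}}\kappa$ with $\kappa$ depending only on some of the variables means that it is constant in the others. *)

theory Defs
  imports
    "HOL-Analysis.Analysis"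
    "Jordan_Normal_Form.Schur_Decomposition"
    "Jordan_Normal_Form.DL_Rank"
begin

(* The infix "$" is reserved for the components of elements of real^'d. *)
no_notation Matrix.vec_index (infixl \<open>$\<close> 100)
no_notation Matrix.scalar_prod (infix \<open>\<bullet>\<close> 70)

section \<open>Kronecker product, singular values, spectral norm\<close>

definition kronecker :: "complex mat \<Rightarrow> complex mat \<Rightarrow> complex mat" (infixr \<open>\<otimes>\<^sub>K\<close> 75) where
  "X \<otimes>\<^sub>K Y = Matrix.mat (dim_row X * dim_row Y) (dim_col X * dim_col Y)
     (\<lambda>(i, j). X $$ (i div dim_row Y, j div dim_col Y) * Y $$ (i mod dim_row Y, j mod dim_col Y))"

definition singular_values :: "complex mat \<Rightarrow> real multiset" where
  "singular_values A = image_mset (\<lambda>z. sqrt (Re z)) (proots (char_poly (mat_adjoint A * A)))"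

definition vec_l2_norm :: "complex Matrix.vec \<Rightarrow> real" where
  "vec_l2_norm v = L2_set (\<lambda>i. cmod (Matrix.vec_index v i)) {..<dim_vec v}"

definition spectral_norm :: "complex mat \<Rightarrow> real" where
  "spectral_norm A =
     (SUP v \<in> {v \<in> carrier_vec (dim_col A). vec_l2_norm v \<le> 1}. vec_l2_norm (A *\<^sub>v v))"

abbreviation mat_rank :: "complex mat \<Rightarrow> nat" where
  "mat_rank A \<equiv> vec_space.rank (dim_row A) A"

section \<open>Singular value distribution\<close>

definition sv_distribution ::
    "(nat \<Rightarrow> complex mat) \<Rightarrow> 'a::euclidean_space set \<Rightarrow> ('a \<Rightarrow> complex) \<Rightarrow> bool" where
  "sv_distribution A D \<psi> \<longleftrightarrow>
     (\<forall>k. square_mat (A k)) \<and> filterlim (\<lambda>k. dim_row (A k)) at_top sequentially \<and>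
     D \<in> lmeasurable \<and> measure lebesgue D > 0 \<and> \<psi> \<in> borel_measurable (lebesgue_on D) \<and>
     (\<forall>F :: real \<Rightarrow> complex. continuous_on UNIV F \<and> compact (closure {s. F s \<noteq> 0}) \<longrightarrow>
        (\<lambda>k. (\<Sum>s \<in># singular_values (A k). F s) / of_nat (dim_row (A k)))
          \<longlonglongrightarrow> (LINT x|lebesgue_on D. F (cmod (\<psi> x))) / of_real (measure lebesgue D))"

section \<open>Multilevel GLT sequences\<close>

text \<open>The levels are the elements of an ordered finite type \<open>'d\<close>. In the numeral types
  \<open>1\<close> and \<open>2\<close> the elements are \<open>0\<close>, and \<open>0 < 1\<close>, respectively; hence the
  first coordinate of a point \<open>x\<close> of \<open>real^2\<close> is \<open>x $ 0\<close> and the second one is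
  \<open>x $ 1\<close>. (In the type \<open>2\<close>, the literal \<open>2\<close> denotes \<open>0\<close>.)\<close>

definition level_size :: "nat ^ 'd \<Rightarrow> nat" where
  "level_size n = (\<Prod>s\<in>UNIV. n $ s)"

text \<open>The multi-index at position \<open>k < level_size n\<close> of the lexicographic enumeration; both
  positions and multi-indices are counted from \<open>0\<close>.\<close>

definition multi_index :: "nat ^ 'd::{finite,linorder} \<Rightarrow> nat \<Rightarrow> nat ^ 'd::{finite,linorder}" where
  "multi_index n k = (\<chi> s. k div (\<Prod>t\<in>{s<..}. n $ t) mod (n $ s))"

abbreviation unit_cube :: "(real ^ 'd) set" where
  "unit_cube \<equiv> cbox 0 1"

abbreviation pi_cube :: "(real ^ 'd) set" where
  "pi_cube \<equiv> cbox (\<chi> _. - pi) (\<chi> _. pi)"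

definition int_dot :: "int ^ 'd \<Rightarrow> real ^ 'd \<Rightarrow> real" where
  "int_dot k \<theta> = (\<Sum>s\<in>UNIV. of_int (k $ s) * \<theta> $ s)"

definition trig_poly :: "(real ^ 'd \<Rightarrow> complex) \<Rightarrow> bool" where
  "trig_poly f \<longleftrightarrow>
     (\<exists>K c. finite K \<and> f = (\<lambda>\<theta>. \<Sum>k\<in>K. c k * exp (\<i> * of_real (int_dot k \<theta>))))"

definition fourier_coeff :: "(real ^ 'd \<Rightarrow> complex) \<Rightarrow> int ^ 'd \<Rightarrow> complex" where
  "fourier_coeff f k =
     (LINT \<theta>|lebesgue_on pi_cube. f \<theta> * exp (- \<i> * of_real (int_dot k \<theta>)))
       / of_real ((2 * pi) ^ CARD('d))"

definition toeplitz_mat ::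
    "nat ^ 'd::{finite,linorder} \<Rightarrow> (real ^ 'd::{finite,linorder} \<Rightarrow> complex) \<Rightarrow> complex mat" where
  "toeplitz_mat n f = Matrix.mat (level_size n) (level_size n)
     (\<lambda>(i, j). fourier_coeff f (\<chi> s. int (multi_index n i $ s) - int (multi_index n j $ s)))"

definition sampling_mat ::
    "nat ^ 'd::{finite,linorder} \<Rightarrow> (real ^ 'd::{finite,linorder} \<Rightarrow> complex) \<Rightarrow> complex mat" where
  "sampling_mat n b = mat_diag (level_size n)
     (\<lambda>i. b (\<chi> s. real (multi_index n i $ s + 1) / real (n $ s)))"

text \<open>The matrix \<open>D\<^sub>n(b\<^sub>0) T\<^sub>n(f\<^sub>0) + \<dots> + D\<^sub>n(b\<^bsub>M-1\<^esub>) T\<^sub>n(f\<^bsub>M-1\<^esub>)\<close>, summed entrywise because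
  the type of matrices has no zero element independent of the dimensions.\<close>

definition sampling_toeplitz_sum ::
    "nat ^ 'd::{finite,linorder} \<Rightarrow> nat \<Rightarrow> (nat \<Rightarrow> real ^ 'd::{finite,linorder} \<Rightarrow> complex) \<Rightarrow>
     (nat \<Rightarrow> real ^ 'd::{finite,linorder} \<Rightarrow> complex) \<Rightarrow> complex mat" where
  "sampling_toeplitz_sum n M b f = Matrix.mat (level_size n) (level_size n)
     (\<lambda>(i, j). \<Sum>l<M. (sampling_mat n (b l) * toeplitz_mat n (f l)) $$ (i, j))"

definition approx_class ::
    "(nat \<Rightarrow> nat) \<Rightarrow> (nat \<Rightarrow> nat \<Rightarrow> complex mat) \<Rightarrow> (nat \<Rightarrow> complex mat) \<Rightarrow> bool" where
  "approx_class N B A \<longleftrightarrow>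
     (\<exists>c \<omega> :: nat \<Rightarrow> real. c \<longlonglongrightarrow> 0 \<and> \<omega> \<longlonglongrightarrow> 0 \<and>
        (\<forall>r. \<forall>\<^sub>F k in sequentially.
           \<exists>R E. R \<in> carrier_mat (N k) (N k) \<and> E \<in> carrier_mat (N k) (N k) \<and>
             A k = B r k + R + E \<and>
             real (mat_rank R) \<le> c r * real (N k) \<and> spectral_norm E \<le> \<omega> r))"

definition tendsto_in_measure ::
    "'a::euclidean_space set \<Rightarrow> (nat \<Rightarrow> 'a \<Rightarrow> complex) \<Rightarrow> ('a \<Rightarrow> complex) \<Rightarrow> bool" where
  "tendsto_in_measure D \<phi> \<kappa> \<longleftrightarrow>
     (\<forall>\<epsilon>>0. (\<lambda>r. measure lebesgue {p \<in> D. cmod (\<phi> r p - \<kappa> p) > \<epsilon>}) \<longlonglongrightarrow> 0)"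

text \<open>\<open>n\<close> is the sequence of multi-indices, and \<open>A k\<close> is the matrix attached to \<open>n k\<close>.\<close>

definition glt_sequence ::
    "(nat \<Rightarrow> nat ^ 'd::{finite,linorder}) \<Rightarrow> (nat \<Rightarrow> complex mat) \<Rightarrow>
     (real ^ 'd::{finite,linorder} \<Rightarrow> real ^ 'd::{finite,linorder} \<Rightarrow> complex) \<Rightarrow> bool" where
  "glt_sequence n A \<kappa> \<longleftrightarrow>
     (\<forall>s. filterlim (\<lambda>k. n k $ s) at_top sequentially) \<and>
     (\<forall>k. A k \<in> carrier_mat (level_size (n k)) (level_size (n k))) \<and>
     (\<lambda>(x, \<theta>). \<kappa> x \<theta>) \<in> borel_measurable (lebesgue_on (unit_cube \<times> pi_cube)) \<and>
     (\<exists>M b f.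
        (\<forall>r. \<forall>l<M r. continuous_on unit_cube (b r l) \<and> trig_poly (f r l)) \<and>
        tendsto_in_measure (unit_cube \<times> pi_cube)
          (\<lambda>r (x, \<theta>). \<Sum>l<M r. b r l x * f r l \<theta>) (\<lambda>(x, \<theta>). \<kappa> x \<theta>) \<and>
        approx_class (\<lambda>k. level_size (n k))
          (\<lambda>r k. sampling_toeplitz_sum (n k) (M r) (b r) (f r)) A)"

text \<open>\<open>f\<close> is a continuous \<open>2\<pi>\<close>-periodic symbol, depending on \<open>\<theta>\<close> only, of the one-level
  sequence \<open>X\<close>.\<close>

definition periodic_glt_symbol :: "(nat \<Rightarrow> complex mat) \<Rightarrow> (real \<Rightarrow> complex) \<Rightarrow> bool" where
  "periodic_glt_symbol X f \<longleftrightarrow>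
     continuous_on UNIV f \<and> (\<forall>\<theta>. f (\<theta> + 2 * pi) = f \<theta>) \<and>
     glt_sequence (\<lambda>n. \<chi> s::1. n) X (\<lambda>x \<theta>. f (\<theta> $ 0))"

section \<open>The discretization matrices\<close>

definition alpha :: "real \<Rightarrow> real \<Rightarrow> nat \<Rightarrow> real" where
  "alpha \<xi> T n = (T / real n) powr \<xi> * Gamma (2 - \<xi>)"

definition beta :: "real \<Rightarrow> nat \<Rightarrow> real" where
  "beta \<eta> m = (real m + 1) powr (- \<eta>) * Gamma (2 - \<eta>)"

text \<open>Both coefficient sequences are instances: \<open>\<gamma>\<^sub>l = frac_coeff \<xi> l\<close> and
  \<open>\<delta>\<^sub>k = frac_coeff \<eta> k\<close>.\<close>

definition frac_coeff :: "real \<Rightarrow> nat \<Rightarrow> real" where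
  "frac_coeff s l = (if l = 0 then 1 else
     (real l + 1) powr (1 - s) - 2 * real l powr (1 - s) + (real l - 1) powr (1 - s))"

definition lower_toeplitz :: "nat \<Rightarrow> (nat \<Rightarrow> real) \<Rightarrow> complex mat" where
  "lower_toeplitz n c =
     Matrix.mat n n (\<lambda>(i, j). if j \<le> i then complex_of_real (c (i - j)) else 0)"

definition U_mat :: "real \<Rightarrow> real \<Rightarrow> real \<Rightarrow> nat \<Rightarrow> complex mat" where
  "U_mat \<xi> \<rho> T n =
     lower_toeplitz n (\<lambda>l. frac_coeff \<xi> l * exp (- \<rho> * real l * (T / real n)))"

definition B_mat :: "real \<Rightarrow> nat \<Rightarrow> complex mat" where
  "B_mat \<eta> m = lower_toeplitz m (frac_coeff \<eta>)"

definition G_mat :: "real \<Rightarrow> (real \<Rightarrow> real) \<Rightarrow> nat \<Rightarrow> complex mat" where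
  "G_mat \<eta> a m =
     mat_diag m (\<lambda>i. complex_of_real (a (real (i + 1) / real m))) * B_mat \<eta> m"

definition e_row :: "nat \<Rightarrow> complex mat" where
  "e_row n = Matrix.mat 1 n (\<lambda>(_, j). if j + 1 = n then 1 else 0)"

definition q_col :: "real \<Rightarrow> (real \<Rightarrow> real) \<Rightarrow> nat \<Rightarrow> complex mat" where
  "q_col T q n = Matrix.mat n 1 (\<lambda>(i, _). complex_of_real (q (real (i + 1) * (T / real n))))"

definition A_mat ::
    "real \<Rightarrow> real \<Rightarrow> real \<Rightarrow> real \<Rightarrow> real \<Rightarrow> (real \<Rightarrow> real) \<Rightarrow> (real \<Rightarrow> real) \<Rightarrow> nat \<Rightarrow> nat \<Rightarrow> complex mat"
  where
  "A_mat \<xi> \<eta> \<rho> T lam a q n m =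
     four_block_mat
       (U_mat \<xi> \<rho> T n \<otimes>\<^sub>K 1\<^sub>m m
          + 1\<^sub>m n \<otimes>\<^sub>K (complex_of_real (alpha \<xi> T n / beta \<eta> m) \<cdot>\<^sub>m G_mat \<eta> a m))
       (- complex_of_real (alpha \<xi> T n) \<cdot>\<^sub>m (q_col T q n \<otimes>\<^sub>K 1\<^sub>m m))
       (e_row n \<otimes>\<^sub>K 1\<^sub>m m)
       (complex_of_real (lam / beta \<eta> m) \<cdot>\<^sub>m G_mat \<eta> a m)"

end

theory Submission
  imports Defs "HOL-Probability.Weak_Convergence"
begin

text \<open>The symbols of \<open>B\<^sub>m\<close> and \<open>U\<^sub>n\<close> are the Fourier series with coefficients \<open>\<delta>\<^sub>k\<close> and \<open>\<gamma>\<^sub>l\<close>,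
  which converge absolutely because the coefficients are second differences of a concave power.

  For \<open>A\<^sub>N\<close> one approximates \<open>a\<close> within \<open>\<epsilon>\<close> by a continuous function outside a compact set \<open>C\<close>
  of measure at most \<open>\<epsilon>\<close> and truncates both Fourier series. The borders of \<open>A\<^sub>N\<close> and the rows whose
  second grid coordinate lies in \<open>C\<close> form a matrix of rank at most \<open>2\<epsilon>N\<close>; on the other entries the
  error has small row and column sums, hence a small norm by Schur's test.

  That a GLT sequence has the singular value distribution of its symbol rests on moments: sums of
  products \<open>D\<^sub>n(b) T\<^sub>n(f)\<close> have slowly varying diagonals, so that the normalized trace of \<open>(A\<^sup>*A)\<^sup>p\<close>
  tends to the mean of \<open>|\<kappa>|\<^sup>2\<^sup>p\<close>. The limit passes to the sequence itself, since a perturbation of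
  small rank plus small norm hardly changes the counting function of the singular values. Applied to
  the difference of two symbols of one sequence, whose matrices can be taken to be zero, the same fact
  shows that the symbol is unique.\<close>

section \<open>Traces and Hermitian matrices\<close>

text \<open>A perturbation of small rank controls only how many singular values lie below a
  threshold, not where they lie. Two matrices are therefore compared through monotone test
  functions, the steps \<open>cts_step\<close>, whose Lipschitz constant absorbs the part of small
  norm; arbitrary continuous functions of compact support are reached at the very end, by weak
  convergence of probability measures. For \<open>A_mat\<close> the obstacle is that
  \<open>a\<close> may be unbounded near its discontinuities, that \<open>q\<close> is arbitrary,
  and that \<open>lam / beta\<close> tends to infinity. No norm estimate covers such entries, so
  their rows and columns must go into the part of small rank, which requires a count of bad grid
  points. Small measure of a set says nothing about that count, since all grids together form a null
  set. This is why the exceptional set is compact and enclosed in an open set of small measure: for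
  a fine grid, a whole cell next to each bad point then lies in the open set.\<close>

lemma mult_mat_vec_index_sum:
  assumes "A \<in> carrier_mat r c" "v \<in> carrier_vec c" "i < r"
  shows "Matrix.vec_index (A *\<^sub>v v) i = (\<Sum>j<c. A $$ (i, j) * Matrix.vec_index v j)"
  using assms by (auto simp: scalar_prod_def atLeast0LessThan)

lemma mult_mat_index_sum:
  assumes "A \<in> carrier_mat r n" "B \<in> carrier_mat n c" "i < r" "j < c"
  shows "(A * B) $$ (i, j) = (\<Sum>l<n. A $$ (i, l) * B $$ (l, j))"
  using assms by (auto simp: scalar_prod_def atLeast0LessThan)

lemma mat_adjoint_carrier [simp]:
  "A \<in> carrier_mat r c \<Longrightarrow> mat_adjoint A \<in> carrier_mat c r"
  by (auto simp: mat_adjoint_def)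

lemma mat_adjoint_index [simp]:
  assumes "A \<in> carrier_mat r c" "i < c" "j < r"
  shows "mat_adjoint A $$ (i, j) = cnj (A $$ (j, i))"
  using assms by (auto simp: mat_adjoint_def mat_of_rows_index conjugate_vec_def)

definition mat_trace :: "complex mat \<Rightarrow> complex" where
  "mat_trace A = (\<Sum>i<dim_row A. A $$ (i, i))"

lemma trace_mult_commute:
  assumes "A \<in> carrier_mat n m" "B \<in> carrier_mat m n"
  shows "mat_trace (A * B) = mat_trace (B * A)"
proof -
  have "mat_trace (A * B) = (\<Sum>i<n. \<Sum>l<m. A $$ (i, l) * B $$ (l, i))"
    unfolding mat_trace_def using assms by (intro sum.cong) (auto simp: mult_mat_index_sum simp del: index_mult_mat(1))
  also have "\<dots> = (\<Sum>l<m. \<Sum>i<n. B $$ (l, i) * A $$ (i, l))"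
    by (subst sum.swap) (simp add: mult.commute)
  also have "\<dots> = mat_trace (B * A)"
    unfolding mat_trace_def using assms by (intro sum.cong) (auto simp: mult_mat_index_sum simp del: index_mult_mat(1))
  finally show ?thesis .
qed

lemma trace_similar:
  assumes "similar_mat_wit A B P Q"
  shows "mat_trace A = mat_trace B"
proof -
  define n where "n = dim_row A"
  have c: "A \<in> carrier_mat n n" "B \<in> carrier_mat n n" "P \<in> carrier_mat n n" "Q \<in> carrier_mat n n"
    and eq: "Q * P = 1\<^sub>m n" "A = P * B * Q"
    using similar_mat_witD[OF n_def assms] by auto
  have "mat_trace A = mat_trace (P * (B * Q))"
    using eq c by (simp add: assoc_mult_mat)
  also have "\<dots> = mat_trace (B * Q * P)"
    using c by (intro trace_mult_commute) auto
  also have "B * Q * P = B"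
    using eq c by simp
  finally show ?thesis .
qed

text \<open>A Schur form carries the eigenvalues on its diagonal and has the same trace.\<close>

lemma trace_eq_sum_eigenvalues:
  assumes A: "A \<in> carrier_mat n n"
    and "char_poly A = (\<Prod>e\<leftarrow>es. [:- e, 1:])"
  shows "mat_trace A = sum_list es"
proof -
  obtain B P Q where d: "schur_decomposition A es = (B, P, Q)"
    by (cases "schur_decomposition A es") auto
  have B: "similar_mat_wit A B P Q" "diag_mat B = es"
    using schur_decomposition[OF assms d] by auto
  have "mat_trace A = mat_trace B"
    by (rule trace_similar[OF B(1)])
  also have "\<dots> = sum_list (diag_mat B)"
    by (simp add: mat_trace_def diag_mat_def sum_list_distinct_conv_sum_set atLeast0LessThan)
  finally show ?thesis using B by simp
qed

text \<open>Adding \<open>c u\<^sub>l u\<^sub>l\<^sup>*\<close> to \<open>H\<close> moves the known eigenvalues to the real number \<open>c\<close>, and for a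
  suitable \<open>c\<close> the trace shows that another eigenvalue remains; its eigenvector is orthogonal to
  the \<open>u\<^sub>l\<close>.\<close>

lemma hermitian_eigenvector_extension:
  fixes H :: "complex mat"
  assumes H: "H \<in> carrier_mat n n"
    and herm: "\<And>i j. i < n \<Longrightarrow> j < n \<Longrightarrow> H $$ (i, j) = cnj (H $$ (j, i))"
    and k: "k < n"
    and eig: "\<And>l i. l < k \<Longrightarrow> i < n \<Longrightarrow> (\<Sum>j<n. H $$ (i, j) * u l j) = complex_of_real (e l) * u l i"
    and orth: "\<And>l l'. l < k \<Longrightarrow> l' < k \<Longrightarrow> (\<Sum>i<n. u l i * cnj (u l' i)) = (if l = l' then 1 else 0)"
  obtains v \<mu> where "\<And>i. i < n \<Longrightarrow> (\<Sum>j<n. H $$ (i, j) * v j) = complex_of_real \<mu> * v i"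
    "\<And>l. l < k \<Longrightarrow> (\<Sum>i<n. v i * cnj (u l i)) = 0" "(\<Sum>i<n. v i * cnj (v i)) = 1"
proof -
  define S where "S = (\<Sum>i<n. H $$ (i, i)) - (\<Sum>l<k. complex_of_real (e l))"
  \<comment> \<open>If every eigenvalue of the matrix \<open>M\<close> below were equal to
    \<open>c\<close>, comparing traces would give \<open>S = c * (n - k)\<close>; this choice of
    \<open>c\<close> excludes it.\<close>
  obtain c :: real where c: "c * real (n - k) \<noteq> Re S"
  proof -
    have "((Re S + 1) / real (n - k)) * real (n - k) \<noteq> Re S"
      using k by simp
    then show ?thesis using that by blast
  qed
  define M where "M = Matrix.mat n n (\<lambda>(i, j). H $$ (i, j) + (\<Sum>l<k. complex_of_real (c - e l) * u l i * cnj (u l j)))"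
  have M: "M \<in> carrier_mat n n" by (simp add: M_def)
  have Mij: "M $$ (i, j) = H $$ (i, j) + (\<Sum>l<k. complex_of_real (c - e l) * u l i * cnj (u l j))"
    if "i < n" "j < n" for i j
    using that by (simp add: M_def)
  have Mherm: "M $$ (i, j) = cnj (M $$ (j, i))" if "i < n" "j < n" for i j
    using that herm[OF that] by (simp add: Mij ac_simps)
  have Mu: "(\<Sum>j<n. M $$ (i, j) * u l j) = complex_of_real c * u l i" if l: "l < k" and i: "i < n" for l i
  proof -
    have "(\<Sum>j<n. M $$ (i, j) * u l j) = (\<Sum>j<n. H $$ (i, j) * u l j)
        + (\<Sum>j<n. \<Sum>l'<k. complex_of_real (c - e l') * u l' i * (u l j * cnj (u l' j)))"
      using i by (simp add: Mij algebra_simps sum.distrib sum_distrib_left sum_distrib_right)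
    also have "(\<Sum>j<n. \<Sum>l'<k. complex_of_real (c - e l') * u l' i * (u l j * cnj (u l' j)))
        = (\<Sum>l'<k. complex_of_real (c - e l') * u l' i * (\<Sum>j<n. u l j * cnj (u l' j)))"
      by (subst sum.swap) (simp add: sum_distrib_left)
    also have "\<dots> = (\<Sum>l'<k. if l' = l then complex_of_real (c - e l') * u l' i else 0)"
      using l by (intro sum.cong) (auto simp: orth)
    also have "\<dots> = complex_of_real (c - e l) * u l i"
      using l by simp
    finally show ?thesis using eig[OF l i] by (simp add: algebra_simps)
  qed
  obtain es where es: "char_poly M = (\<Prod>a\<leftarrow>es. [:- a, 1:])" "length es = n"
    using char_poly_factorized[OF M] by blast
  have "\<exists>\<mu>\<in>set es. \<mu> \<noteq> complex_of_real c"
  proof (rule ccontr)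
    assume "\<not> ?thesis"
    then have "es = replicate n (complex_of_real c)"
      using es(2) by (auto simp: replicate_eqI)
    then have "mat_trace M = of_nat n * complex_of_real c"
      using trace_eq_sum_eigenvalues[OF M es(1)] by (simp add: sum_list_replicate)
    moreover have "mat_trace M = S + complex_of_real (c * real k)"
    proof -
      have "mat_trace M = (\<Sum>i<n. H $$ (i, i)) + (\<Sum>i<n. \<Sum>l<k. complex_of_real (c - e l) * (u l i * cnj (u l i)))"
        using M by (simp add: mat_trace_def Mij sum.distrib mult.assoc)
      also have "(\<Sum>i<n. \<Sum>l<k. complex_of_real (c - e l) * (u l i * cnj (u l i)))
          = (\<Sum>l<k. complex_of_real (c - e l) * (\<Sum>i<n. u l i * cnj (u l i)))"
        by (subst sum.swap) (simp add: sum_distrib_left)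
      also have "\<dots> = (\<Sum>l<k. complex_of_real (c - e l))"
        by (simp add: orth)
      finally show ?thesis by (simp add: S_def sum_subtractf)
    qed
    ultimately have "S = complex_of_real (c * real (n - k))"
      using k by (simp add: of_nat_diff algebra_simps)
    then show False using c by simp
  qed
  then obtain \<mu> where \<mu>: "\<mu> \<in> set es" "\<mu> \<noteq> complex_of_real c" by blast
  have "poly (char_poly M) \<mu> = 0"
    using es(1) \<mu>(1) by (auto simp: poly_prod_list prod_list_zero_iff)
  then have "eigenvalue M \<mu>"
    using eigenvalue_root_char_poly[OF M] by simp
  then obtain w where w: "w \<in> carrier_vec n" "w \<noteq> 0\<^sub>v n" "M *\<^sub>v w = \<mu> \<cdot>\<^sub>v w"
    using M by (auto simp: eigenvalue_def eigenvector_def)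
  define x where "x = Matrix.vec_index w"
  have Mx: "(\<Sum>j<n. M $$ (i, j) * x j) = \<mu> * x i" if "i < n" for i
    using mult_mat_vec_index_sum[OF M w(1) that] w that by (simp add: x_def)
  define s where "s = (\<Sum>i<n. (cmod (x i))\<^sup>2)"
  have s: "s > 0"
  proof -
    obtain i where "i < n" "x i \<noteq> 0"
      using w(1,2) unfolding x_def by (metis carrier_vecD eq_vecI index_zero_vec(1,2))
    then show ?thesis
      unfolding s_def by (intro sum_pos2[where i = i]) auto
  qed
  have xx: "(\<Sum>i<n. x i * cnj (x i)) = complex_of_real s"
    unfolding s_def by (simp add: complex_norm_square[symmetric] del: of_real_power)
  \<comment> \<open>Self-adjointness of \<open>M\<close> for arbitrary coordinate functions. It
    yields that \<open>\<mu>\<close> is real, and that \<open>x\<close> is orthogonal to every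
    \<open>u l\<close>, whose eigenvalue \<open>c\<close> differs from \<open>\<mu>\<close>.\<close>
  have sym: "(\<Sum>i<n. (\<Sum>j<n. M $$ (i, j) * p j) * cnj (q i)) = (\<Sum>j<n. p j * cnj (\<Sum>i<n. M $$ (j, i) * q i))"
    for p q :: "nat \<Rightarrow> complex"
  proof -
    have "(\<Sum>i<n. (\<Sum>j<n. M $$ (i, j) * p j) * cnj (q i)) = (\<Sum>i<n. \<Sum>j<n. p j * (cnj (M $$ (j, i)) * cnj (q i)))"
      unfolding sum_distrib_right by (intro sum.cong refl) (subst Mherm, auto)
    also have "\<dots> = (\<Sum>j<n. \<Sum>i<n. p j * (cnj (M $$ (j, i)) * cnj (q i)))"
      by (rule sum.swap)
    finally show ?thesis by (simp add: sum_distrib_left)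
  qed
  have "\<mu> * complex_of_real s = cnj \<mu> * complex_of_real s"
  proof -
    have "\<mu> * (\<Sum>i<n. x i * cnj (x i)) = (\<Sum>i<n. (\<Sum>j<n. M $$ (i, j) * x j) * cnj (x i))"
      by (simp add: Mx sum_distrib_left mult.assoc)
    also have "\<dots> = cnj \<mu> * (\<Sum>i<n. x i * cnj (x i))"
      unfolding sym sum_distrib_left by (intro sum.cong refl) (simp add: Mx del: cnj_sum)
    finally show ?thesis by (simp add: xx)
  qed
  then have "\<mu> = cnj \<mu>" using s by simp
  then have re: "\<mu> = complex_of_real (Re \<mu>)" by (simp add: complex_eq_iff)
  have ort: "(\<Sum>i<n. x i * cnj (u l i)) = 0" if l: "l < k" for l
  proof -
    have "\<mu> * (\<Sum>i<n. x i * cnj (u l i)) = (\<Sum>i<n. (\<Sum>j<n. M $$ (i, j) * x j) * cnj (u l i))"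
      by (simp add: Mx sum_distrib_left mult.assoc)
    also have "\<dots> = complex_of_real c * (\<Sum>i<n. x i * cnj (u l i))"
      unfolding sym sum_distrib_left using l by (intro sum.cong refl) (simp add: Mu del: cnj_sum)
    finally show ?thesis using \<mu>(2) by simp
  qed
  \<comment> \<open>On a vector orthogonal to all \<open>u l\<close> the terms added to
    \<open>H\<close> vanish, so this eigenvector of \<open>M\<close> is one of
    \<open>H\<close>.\<close>
  have Hx: "(\<Sum>j<n. H $$ (i, j) * x j) = \<mu> * x i" if i: "i < n" for i
  proof -
    have "\<mu> * x i = (\<Sum>j<n. H $$ (i, j) * x j)
        + (\<Sum>j<n. \<Sum>l'<k. complex_of_real (c - e l') * u l' i * (x j * cnj (u l' j)))"
      unfolding Mx[OF i, symmetric] using i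
      by (simp add: Mij algebra_simps sum.distrib sum_distrib_left sum_distrib_right)
    also have "(\<Sum>j<n. \<Sum>l'<k. complex_of_real (c - e l') * u l' i * (x j * cnj (u l' j)))
        = (\<Sum>l'<k. complex_of_real (c - e l') * u l' i * (\<Sum>j<n. x j * cnj (u l' j)))"
      by (subst sum.swap) (simp add: sum_distrib_left)
    also have "\<dots> = 0" by (simp add: ort)
    finally show ?thesis by simp
  qed
  define v where "v i = x i / complex_of_real (sqrt s)" for i
  show thesis
  proof (rule that[of v "Re \<mu>"])
    fix i assume "i < n"
    then show "(\<Sum>j<n. H $$ (i, j) * v j) = complex_of_real (Re \<mu>) * v i"
      using Hx re by (simp add: v_def sum_divide_distrib[symmetric])
  next
    fix l assume "l < k"
    then show "(\<Sum>i<n. v i * cnj (u l i)) = 0"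
      using ort by (simp add: v_def sum_divide_distrib[symmetric])
  next
    have "v i * cnj (v i) = x i * cnj (x i) / complex_of_real s" for i
      using s by (simp add: v_def of_real_mult[symmetric] del: of_real_mult)
    then have "(\<Sum>i<n. v i * cnj (v i)) = (\<Sum>i<n. x i * cnj (x i)) / complex_of_real s"
      by (simp add: sum_divide_distrib)
    then show "(\<Sum>i<n. v i * cnj (v i)) = 1"
      using s xx by simp
  qed
qed

text \<open>One eigenvector is added at a time by the extension lemma, starting from the empty
  family; the induction carries orthonormality and real eigenvalues along.\<close>

lemma hermitian_orthonormal_eigenbasis:
  fixes H :: "complex mat"
  assumes H: "H \<in> carrier_mat n n"
    and herm: "\<And>i j. i < n \<Longrightarrow> j < n \<Longrightarrow> H $$ (i, j) = cnj (H $$ (j, i))"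
  obtains u :: "nat \<Rightarrow> nat \<Rightarrow> complex" and e :: "nat \<Rightarrow> real"
  where "\<And>l i. l < n \<Longrightarrow> i < n \<Longrightarrow> (\<Sum>j<n. H $$ (i, j) * u l j) = complex_of_real (e l) * u l i"
    and "\<And>l l'. l < n \<Longrightarrow> l' < n \<Longrightarrow> (\<Sum>i<n. u l i * cnj (u l' i)) = (if l = l' then 1 else 0)"
proof -
  have "\<exists>u e. (\<forall>l<k. \<forall>i<n. (\<Sum>j<n. H $$ (i, j) * u l j) = complex_of_real (e l) * u l i) \<and>
      (\<forall>l<k. \<forall>l'<k. (\<Sum>i<n. u l i * cnj (u l' i)) = (if l = l' then 1 else 0))" if "k \<le> n" for k
    using that
  proof (induction k)
    case 0
    then show ?case by simp
  next
    case (Suc k)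
    then obtain u e where ue: "\<And>l i. l < k \<Longrightarrow> i < n \<Longrightarrow> (\<Sum>j<n. H $$ (i, j) * u l j) = complex_of_real (e l) * u l i"
      "\<And>l l'. l < k \<Longrightarrow> l' < k \<Longrightarrow> (\<Sum>i<n. u l i * cnj (u l' i)) = (if l = l' then 1 else 0)"
      using Suc_leD by blast
    obtain v \<mu> where v: "\<And>i. i < n \<Longrightarrow> (\<Sum>j<n. H $$ (i, j) * v j) = complex_of_real \<mu> * v i"
      "\<And>l. l < k \<Longrightarrow> (\<Sum>i<n. v i * cnj (u l i)) = 0" "(\<Sum>i<n. v i * cnj (v i)) = 1"
      by (rule hermitian_eigenvector_extension[OF H herm _ ue]) (use Suc.prems in auto)
    have v': "(\<Sum>i<n. u l i * cnj (v i)) = 0" if "l < k" for l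
    proof -
      have "(\<Sum>i<n. u l i * cnj (v i)) = cnj (\<Sum>i<n. v i * cnj (u l i))"
        by (simp add: mult.commute)
      then show ?thesis using v(2)[OF that] by simp
    qed
    show ?case
      by (rule exI[of _ "u(k := v)"], rule exI[of _ "e(k := \<mu>)"])
        (use ue v v' in \<open>auto simp: less_Suc_eq\<close>)
  qed
  from this[OF order_refl] show ?thesis using that by blast
qed

section \<open>Spectral norm, rank and singular values\<close>

lemma vec_l2_norm_nonneg [simp]: "0 \<le> vec_l2_norm v"
  by (simp add: vec_l2_norm_def)

lemma vec_l2_norm_square:
  "v \<in> carrier_vec n \<Longrightarrow> (vec_l2_norm v)\<^sup>2 = (\<Sum>i<n. (cmod (Matrix.vec_index v i))\<^sup>2)"
  by (auto simp: vec_l2_norm_def L2_set_def sum_nonneg)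

lemma vec_l2_norm_add:
  assumes "v \<in> carrier_vec n" "w \<in> carrier_vec n"
  shows "vec_l2_norm (v + w) \<le> vec_l2_norm v + vec_l2_norm w"
proof -
  have "vec_l2_norm (v + w) \<le> L2_set (\<lambda>i. cmod (Matrix.vec_index v i) + cmod (Matrix.vec_index w i)) {..<n}"
    unfolding vec_l2_norm_def using assms
    by (auto intro!: L2_set_mono norm_triangle_ineq)
  also have "\<dots> \<le> vec_l2_norm v + vec_l2_norm w"
    unfolding vec_l2_norm_def using assms L2_set_triangle_ineq by auto
  finally show ?thesis .
qed

lemma vec_l2_norm_smult: "vec_l2_norm (c \<cdot>\<^sub>v v) = cmod c * vec_l2_norm v"
  unfolding vec_l2_norm_def by (subst L2_set_right_distrib) (auto simp: norm_mult intro!: L2_set_cong)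

lemma vec_l2_norm_eq_0:
  assumes "v \<in> carrier_vec n" "vec_l2_norm v = 0"
  shows "v = 0\<^sub>v n"
  using assms by (intro eq_vecI) (auto simp: vec_l2_norm_def L2_set_eq_0_iff)

text \<open>Schur's test. The modulus of an entry is split into two equal square roots, so that
  Cauchy-Schwarz in each row leaves the row sum as one factor; exchanging the order of summation in
  the other factor produces the column sums.\<close>

lemma vec_l2_norm_mult_le:
  assumes E: "E \<in> carrier_mat n n" and C: "0 \<le> C"
    and row: "\<And>i. i < n \<Longrightarrow> (\<Sum>j<n. cmod (E $$ (i, j))) \<le> C"
    and col: "\<And>j. j < n \<Longrightarrow> (\<Sum>i<n. cmod (E $$ (i, j))) \<le> C"
    and v: "v \<in> carrier_vec n"
  shows "vec_l2_norm (E *\<^sub>v v) \<le> C * vec_l2_norm v"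
proof (rule power2_le_imp_le)
  define x where "x j = cmod (Matrix.vec_index v j)" for j
  have "(vec_l2_norm (E *\<^sub>v v))\<^sup>2 = (\<Sum>i<n. (cmod (\<Sum>j<n. E $$ (i, j) * Matrix.vec_index v j))\<^sup>2)"
    using E v by (subst vec_l2_norm_square[of _ n]) (auto simp del: index_mult_mat_vec simp: mult_mat_vec_index_sum)
  also have "\<dots> \<le> (\<Sum>i<n. C * (\<Sum>j<n. cmod (E $$ (i, j)) * (x j)\<^sup>2))"
  proof (rule sum_mono)
    fix i assume "i \<in> {..<n}"
    then have i: "i < n" by simp
    have "cmod (\<Sum>j<n. E $$ (i, j) * Matrix.vec_index v j) \<le> (\<Sum>j<n. sqrt (cmod (E $$ (i, j))) * (sqrt (cmod (E $$ (i, j))) * x j))"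
      by (rule sum_norm_le) (simp add: norm_mult x_def mult.assoc[symmetric])
    then have "(cmod (\<Sum>j<n. E $$ (i, j) * Matrix.vec_index v j))\<^sup>2
        \<le> (\<Sum>j<n. sqrt (cmod (E $$ (i, j))) * (sqrt (cmod (E $$ (i, j))) * x j))\<^sup>2"
      by (intro power_mono) auto
    also have "\<dots> \<le> (\<Sum>j<n. (sqrt (cmod (E $$ (i, j))))\<^sup>2) * (\<Sum>j<n. (sqrt (cmod (E $$ (i, j))) * x j)\<^sup>2)"
      by (rule Cauchy_Schwarz_ineq_sum)
    also have "\<dots> = (\<Sum>j<n. cmod (E $$ (i, j))) * (\<Sum>j<n. cmod (E $$ (i, j)) * (x j)\<^sup>2)"
      by (simp add: power_mult_distrib)
    also have "\<dots> \<le> C * (\<Sum>j<n. cmod (E $$ (i, j)) * (x j)\<^sup>2)"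
      by (intro mult_right_mono row i sum_nonneg) auto
    finally show "(cmod (\<Sum>j<n. E $$ (i, j) * Matrix.vec_index v j))\<^sup>2 \<le> C * (\<Sum>j<n. cmod (E $$ (i, j)) * (x j)\<^sup>2)" .
  qed
  also have "\<dots> = C * (\<Sum>j<n. (\<Sum>i<n. cmod (E $$ (i, j))) * (x j)\<^sup>2)"
    by (subst sum_distrib_left[symmetric], subst sum.swap) (simp add: sum_distrib_right)
  also have "\<dots> \<le> C * (\<Sum>j<n. C * (x j)\<^sup>2)"
    using C by (intro mult_left_mono sum_mono mult_right_mono col) auto
  also have "\<dots> = (C * vec_l2_norm v)\<^sup>2"
    unfolding power_mult_distrib vec_l2_norm_square[OF v]
    by (simp add: x_def sum_distrib_left power2_eq_square mult.assoc)
  finally show "(vec_l2_norm (E *\<^sub>v v))\<^sup>2 \<le> (C * vec_l2_norm v)\<^sup>2" .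
qed (use C in auto)

lemma spectral_norm_le:
  assumes "E \<in> carrier_mat n n" "0 \<le> C"
    and "\<And>v. v \<in> carrier_vec n \<Longrightarrow> vec_l2_norm (E *\<^sub>v v) \<le> C * vec_l2_norm v"
  shows "spectral_norm E \<le> C"
  unfolding spectral_norm_def
proof (rule cSUP_least)
  have "vec_l2_norm (0\<^sub>v n) \<le> 1"
    by (simp add: vec_l2_norm_def L2_set_def)
  then show "{v \<in> carrier_vec (dim_col E). vec_l2_norm v \<le> 1} \<noteq> {}"
    using assms(1) zero_carrier_vec[of n] by blast
next
  fix v assume "v \<in> {v \<in> carrier_vec (dim_col E). vec_l2_norm v \<le> 1}"
  then have v: "v \<in> carrier_vec n" "vec_l2_norm v \<le> 1" using assms(1) by auto
  then show "vec_l2_norm (E *\<^sub>v v) \<le> C"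
    using assms(3)[OF v(1)] mult_left_mono[OF v(2) assms(2)] by simp
qed

lemma spectral_norm_le_row_col:
  assumes "E \<in> carrier_mat n n" "0 \<le> C"
    and "\<And>i. i < n \<Longrightarrow> (\<Sum>j<n. cmod (E $$ (i, j))) \<le> C"
    and "\<And>j. j < n \<Longrightarrow> (\<Sum>i<n. cmod (E $$ (i, j))) \<le> C"
  shows "spectral_norm E \<le> C"
  using assms by (intro spectral_norm_le vec_l2_norm_mult_le) auto

lemma vec_l2_norm_mult_le_spectral_norm:
  assumes E: "E \<in> carrier_mat n n" and v: "v \<in> carrier_vec n"
  shows "vec_l2_norm (E *\<^sub>v v) \<le> spectral_norm E * vec_l2_norm v"
proof (cases "vec_l2_norm v = 0")
  case True
  then have "v = 0\<^sub>v n" using vec_l2_norm_eq_0[OF v] by simp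
  then have "E *\<^sub>v v = 0\<^sub>v n" using E by auto
  with True \<open>v = 0\<^sub>v n\<close> show ?thesis by simp
next
  case False
  \<comment> \<open>A crude operator bound, by the sum of all moduli. It shows that the supremum in
    \<open>spectral_norm\<close> is taken over a bounded set.\<close>
  define K where "K = (\<Sum>i<n. \<Sum>j<n. cmod (E $$ (i, j)))"
  have K: "vec_l2_norm (E *\<^sub>v w) \<le> K * vec_l2_norm w" if "w \<in> carrier_vec n" for w
  proof (rule vec_l2_norm_mult_le[OF E _ _ _ that])
    show "0 \<le> K" by (auto simp: K_def intro!: sum_nonneg)
  next
    fix i assume "i < n"
    then show "(\<Sum>j<n. cmod (E $$ (i, j))) \<le> K"
      unfolding K_def by (intro member_le_sum[where f = "\<lambda>i. \<Sum>j<n. cmod (E $$ (i, j))"] sum_nonneg) auto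
  next
    fix j assume "j < n"
    then show "(\<Sum>i<n. cmod (E $$ (i, j))) \<le> K"
      unfolding K_def by (intro sum_mono member_le_sum) auto
  qed
  have K0: "0 \<le> K" by (auto simp: K_def intro!: sum_nonneg)
  define w where "w = complex_of_real (1 / vec_l2_norm v) \<cdot>\<^sub>v v"
  have w: "w \<in> carrier_vec n" "vec_l2_norm w \<le> 1"
    using v False by (auto simp: w_def vec_l2_norm_smult norm_divide)
  have "vec_l2_norm (E *\<^sub>v w) \<le> spectral_norm E"
    unfolding spectral_norm_def
  proof (rule cSUP_upper)
    show "bdd_above ((\<lambda>v. vec_l2_norm (E *\<^sub>v v)) ` {v \<in> carrier_vec (dim_col E). vec_l2_norm v \<le> 1})"
    proof (rule bdd_aboveI2[where M = K])
      fix u assume "u \<in> {v \<in> carrier_vec (dim_col E). vec_l2_norm v \<le> 1}"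
      then show "vec_l2_norm (E *\<^sub>v u) \<le> K"
        using K[of u] E mult_left_mono[of "vec_l2_norm u" 1 K] K0 by auto
    qed
  qed (use w E in auto)
  moreover have "E *\<^sub>v w = complex_of_real (1 / vec_l2_norm v) \<cdot>\<^sub>v (E *\<^sub>v v)"
    using E v by (simp add: w_def mult_mat_vec)
  ultimately have "1 / vec_l2_norm v * vec_l2_norm (E *\<^sub>v v) \<le> spectral_norm E"
    by (simp add: vec_l2_norm_smult norm_divide)
  moreover have "vec_l2_norm v > 0" using False by (simp add: less_le)
  ultimately show ?thesis by (simp add: field_simps)
qed

lemma spectral_norm_nonneg:
  assumes "E \<in> carrier_mat n n"
  shows "0 \<le> spectral_norm E"
proof (cases "n = 0")
  case True
  have "{v \<in> carrier_vec (dim_col E). vec_l2_norm v \<le> 1} = {0\<^sub>v 0}"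
    using assms True by (auto simp: vec_l2_norm_def L2_set_def)
  then show ?thesis by (simp add: spectral_norm_def)
next
  case False
  then have n: "0 < n" by simp
  have "vec_l2_norm (unit_vec n 0 :: complex Matrix.vec) > 0"
  proof -
    have "vec_l2_norm (unit_vec n 0 :: complex Matrix.vec) \<noteq> 0"
      using vec_l2_norm_eq_0[of "unit_vec n 0" n] n unit_vec_nonzero by auto
    then show ?thesis by (simp add: less_le)
  qed
  then show ?thesis
    using vec_l2_norm_mult_le_spectral_norm[OF assms unit_vec_carrier, of 0]
    by (smt (verit) vec_l2_norm_nonneg zero_le_mult_iff)
qed

lemma spectral_norm_add:
  assumes "X \<in> carrier_mat n n" "Y \<in> carrier_mat n n"
  shows "spectral_norm (X + Y) \<le> spectral_norm X + spectral_norm Y"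
proof (rule spectral_norm_le)
  fix v :: "complex Matrix.vec" assume v: "v \<in> carrier_vec n"
  have "vec_l2_norm ((X + Y) *\<^sub>v v) \<le> vec_l2_norm (X *\<^sub>v v) + vec_l2_norm (Y *\<^sub>v v)"
    using assms v by (subst add_mult_distrib_mat_vec) (auto intro!: vec_l2_norm_add[of _ n])
  also have "\<dots> \<le> (spectral_norm X + spectral_norm Y) * vec_l2_norm v"
    using vec_l2_norm_mult_le_spectral_norm[OF assms(1) v] vec_l2_norm_mult_le_spectral_norm[OF assms(2) v]
    by (simp add: algebra_simps)
  finally show "vec_l2_norm ((X + Y) *\<^sub>v v) \<le> (spectral_norm X + spectral_norm Y) * vec_l2_norm v" .
qed (use assms spectral_norm_nonneg in auto)

lemma spectral_norm_uminus:
  assumes "X \<in> carrier_mat n n"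
  shows "spectral_norm (- X) \<le> spectral_norm X"
proof (rule spectral_norm_le)
  fix v :: "complex Matrix.vec" assume v: "v \<in> carrier_vec n"
  have "vec_l2_norm ((- X) *\<^sub>v v) = vec_l2_norm (X *\<^sub>v v)"
    using assms v by (simp add: vec_l2_norm_def cong: L2_set_cong_simp)
  then show "vec_l2_norm ((- X) *\<^sub>v v) \<le> spectral_norm X * vec_l2_norm v"
    using vec_l2_norm_mult_le_spectral_norm[OF assms v] by simp
qed (use assms spectral_norm_nonneg in auto)

text \<open>Zero rows complete the coefficients to a square matrix; its row \<open>m\<close>
  vanishes, hence so does its determinant. Together with \<open>mat_rank_kernel\<close> this takes
  the place of dimension formulas for intersections of subspaces.\<close>

lemma homogeneous_system_solution:
  fixes g :: "nat \<Rightarrow> nat \<Rightarrow> complex"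
  assumes "m < n"
  obtains v where "v \<in> carrier_vec n" "v \<noteq> 0\<^sub>v n"
    "\<And>i. i < m \<Longrightarrow> (\<Sum>j<n. g i j * Matrix.vec_index v j) = 0"
proof -
  define M where "M = Matrix.mat n n (\<lambda>(i, j). if i < m then g i j else 0)"
  have M: "M \<in> carrier_mat n n" by (simp add: M_def)
  have "Determinant.det M = 0"
  proof -
    have "M = mat\<^sub>r n n (\<lambda>i. if i = m then 0\<^sub>v n else row M i)"
      using assms by (intro eq_matI) (auto simp: M_def)
    then show ?thesis
      using det_row_0[OF assms, of "row M"] M by (metis (no_types, lifting) row_carrier_vec carrier_matD Pi_I' row_carrier)
  qed
  then obtain v where v: "v \<in> carrier_vec n" "v \<noteq> 0\<^sub>v n" "M *\<^sub>v v = 0\<^sub>v n"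
    using det_0_iff_vec_prod_zero[OF M] by auto
  show thesis
  proof (rule that[OF v(1,2)])
    fix i assume "i < m"
    then show "(\<Sum>j<n. g i j * Matrix.vec_index v j) = 0"
      using mult_mat_vec_index_sum[OF M v(1), of i] v(3) assms
      by (simp add: M_def del: index_mult_mat_vec)
  qed
qed

lemma (in vec_space) column_in_span_maximal:
  assumes "A \<in> carrier_mat n nc" and S: "maximal S (\<lambda>T. T \<subseteq> set (cols A) \<and> lin_indpt T)"
    and c: "c \<in> set (cols A)"
  shows "c \<in> span S"
proof (rule ccontr)
  assume nin: "c \<notin> span S"
  have sub: "S \<subseteq> set (cols A)" and ind: "lin_indpt S" using S by (auto simp: maximal_def)
  have carr: "set (cols A) \<subseteq> carrier_vec n" using assms(1) cols_dim by blast
  have S'': "S \<subseteq> carrier_vec n" using sub carr by auto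
  have "c \<notin> S" using nin span_mem[OF S''] by blast
  then have "lin_indpt (S \<union> {c})"
    using lin_dep_iff_in_span[OF S'' ind _ \<open>c \<notin> S\<close>] nin c carr by auto
  then have "S \<union> {c} = S"
    using S sub c unfolding maximal_def by (metis Un_least Un_upper1 empty_subsetI insert_subset)
  then show False using \<open>c \<notin> S\<close> by blast
qed

text \<open>Each column \<open>j\<close> is a combination of a maximal independent set
  \<open>S\<close> of columns, whose size is the rank, with coefficients \<open>a j s\<close>. Hence
  \<open>R *\<^sub>v v\<close> combines the vectors \<open>s\<close> of \<open>S\<close> with the
  coefficients \<open>\<Sum>j<n. a j s * v j\<close>, and these linear forms in \<open>v\<close>, as
  many as the rank, are the equations \<open>g\<close>.\<close>

lemma mat_rank_kernel:
  assumes R: "R \<in> carrier_mat n n"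
  obtains g :: "nat \<Rightarrow> nat \<Rightarrow> complex" where
    "\<And>v. v \<in> carrier_vec n \<Longrightarrow> (\<forall>i<mat_rank R. (\<Sum>j<n. g i j * Matrix.vec_index v j) = 0) \<Longrightarrow> R *\<^sub>v v = 0\<^sub>v n"
proof -
  interpret vec_space "TYPE(complex)" n .
  have "lin_indpt {}"
    by (metis (no_types) empty_subsetI fin_dim finite_basis_exists subset_li_is_li vec_vs vectorspace.basis_def)
  then obtain S where S: "maximal S (\<lambda>T. T \<subseteq> set (cols R) \<and> lin_indpt T)" "finite S"
    using maximal_exists_superset[of "set (cols R)" "\<lambda>T. T \<subseteq> set (cols R) \<and> lin_indpt T" "{}"]
    by auto
  have rank: "mat_rank R = card S"
    using rank_card_indpt[OF R S(1)] R by simp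
  have sub: "S \<subseteq> set (cols R)" using S(1) by (auto simp: maximal_def)
  have carr: "set (cols R) \<subseteq> carrier_vec n" using R cols_dim by blast
  have "\<exists>a. lincomb a S = col R j" if "j < n" for j
    using finite_in_span[OF S(2), of "col R j"] column_in_span_maximal[OF R S(1), of "col R j"]
      sub carr R that by (metis carrier_matD(2) cols_length cols_nth nth_mem subset_trans)
  then obtain a where a: "\<And>j. j < n \<Longrightarrow> lincomb (a j) S = col R j" by metis
  have Rij: "R $$ (i, j) = (\<Sum>s\<in>S. a j s * Matrix.vec_index s i)" if "i < n" "j < n" for i j
  proof -
    have "R $$ (i, j) = Matrix.vec_index (lincomb (a j) S) i"
      using a[OF that(2)] R that by simp
    then show ?thesis using lincomb_index[OF that(1), of S] sub carr by auto
  qed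
  obtain h where h: "bij_betw h {..<card S} S"
    using ex_bij_betw_nat_finite[OF S(2)] by (auto simp: atLeast0LessThan)
  show thesis
  proof (rule that[of "\<lambda>i j. a j (h i)"])
    fix v :: "complex Matrix.vec"
    assume v: "v \<in> carrier_vec n" and z: "\<forall>i<mat_rank R. (\<Sum>j<n. a j (h i) * Matrix.vec_index v j) = 0"
    have z': "(\<Sum>j<n. a j s * Matrix.vec_index v j) = 0" if "s \<in> S" for s
    proof -
      have "s \<in> h ` {..<card S}" using that bij_betw_imp_surj_on[OF h] by simp
      then obtain i where "i < card S" "h i = s" by auto
      then show ?thesis using z rank by auto
    qed
    show "R *\<^sub>v v = 0\<^sub>v n"
    proof (rule eq_vecI)
      fix i assume "i < dim_vec (0\<^sub>v n :: complex Matrix.vec)"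
      then have i: "i < n" by simp
      have "Matrix.vec_index (R *\<^sub>v v) i = (\<Sum>j<n. \<Sum>s\<in>S. Matrix.vec_index s i * (a j s * Matrix.vec_index v j))"
        using mult_mat_vec_index_sum[OF R v i] i by (simp add: Rij sum_distrib_right sum_distrib_left mult_ac)
      also have "\<dots> = (\<Sum>s\<in>S. Matrix.vec_index s i * (\<Sum>j<n. a j s * Matrix.vec_index v j))"
        by (subst sum.swap) (simp add: sum_distrib_left)
      also have "\<dots> = 0" by (simp add: z')
      finally show "Matrix.vec_index (R *\<^sub>v v) i = Matrix.vec_index (0\<^sub>v n) i" using i by simp
    qed (use R in auto)
  qed
qed

section \<open>The rank of matrices supported on few rows and columns\<close>

lemma mat_rank_add:
  assumes "X \<in> carrier_mat n m" "Y \<in> carrier_mat n m"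
  shows "mat_rank (X + Y) \<le> mat_rank X + mat_rank Y"
  using vec_space.rank_subadditive[OF assms] assms by auto

text \<open>One supporting row is split off at a time; alone it forms the product of an indicator
  column with a row vector, of rank at most 1.\<close>

lemma mat_rank_row_support:
  assumes "finite S" "X \<in> carrier_mat n m" "\<And>i j. i < n \<Longrightarrow> j < m \<Longrightarrow> i \<notin> S \<Longrightarrow> X $$ (i, j) = 0"
  shows "mat_rank X \<le> card S"
  using assms
proof (induction S arbitrary: X rule: finite_induct)
  case empty
  then have "X = 0\<^sub>m n m" by (intro eq_matI) auto
  then show ?case using vec_space.rank_0I by simp
next
  case (insert x S)
  define Y where "Y = Matrix.mat n m (\<lambda>(i, j). if i = x then X $$ (i, j) else 0)"
  define Z where "Z = Matrix.mat n m (\<lambda>(i, j). if i = x then 0 else X $$ (i, j))"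
  have c: "Y \<in> carrier_mat n m" "Z \<in> carrier_mat n m" by (auto simp: Y_def Z_def)
  have "mat_rank Z \<le> card S"
    using insert.prems c by (intro insert.IH) (auto simp: Z_def)
  moreover have "vec_space.rank n Y \<le> 1"
    by (rule vec_space.rank_le_1_product_entries[OF c(1), of "\<lambda>i. if i = x then 1 else 0" "\<lambda>j. X $$ (x, j)"])
      (auto simp: Y_def)
  moreover have "X = Y + Z"
    using insert.prems by (intro eq_matI) (auto simp: Y_def Z_def)
  ultimately show ?case
    using mat_rank_add[OF c] c insert.hyps by (simp add: carrier_matD)
qed

lemma mat_rank_col_support:
  assumes "finite S" "X \<in> carrier_mat n m" "\<And>i j. i < n \<Longrightarrow> j < m \<Longrightarrow> j \<notin> S \<Longrightarrow> X $$ (i, j) = 0"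
  shows "mat_rank X \<le> card S"
  using assms
proof (induction S arbitrary: X rule: finite_induct)
  case empty
  then have "X = 0\<^sub>m n m" by (intro eq_matI) auto
  then show ?case using vec_space.rank_0I by simp
next
  case (insert x S)
  define Y where "Y = Matrix.mat n m (\<lambda>(i, j). if j = x then X $$ (i, j) else 0)"
  define Z where "Z = Matrix.mat n m (\<lambda>(i, j). if j = x then 0 else X $$ (i, j))"
  have c: "Y \<in> carrier_mat n m" "Z \<in> carrier_mat n m" by (auto simp: Y_def Z_def)
  have "mat_rank Z \<le> card S"
    using insert.prems c by (intro insert.IH) (auto simp: Z_def)
  moreover have "vec_space.rank n Y \<le> 1"
    by (rule vec_space.rank_le_1_product_entries[OF c(1), of "\<lambda>i. X $$ (i, x)" "\<lambda>j. if j = x then 1 else 0"])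
      (auto simp: Y_def)
  moreover have "X = Y + Z"
    using insert.prems by (intro eq_matI) (auto simp: Y_def Z_def)
  ultimately show ?case
    using mat_rank_add[OF c] c insert.hyps by (simp add: carrier_matD)
qed

lemma mat_rank_row_col_support:
  assumes "finite S" "finite S'" "X \<in> carrier_mat n m"
    and "\<And>i j. i < n \<Longrightarrow> j < m \<Longrightarrow> i \<notin> S \<Longrightarrow> j \<notin> S' \<Longrightarrow> X $$ (i, j) = 0"
  shows "mat_rank X \<le> card S + card S'"
proof -
  define Y where "Y = Matrix.mat n m (\<lambda>(i, j). if i \<in> S then X $$ (i, j) else 0)"
  define Z where "Z = Matrix.mat n m (\<lambda>(i, j). if i \<in> S then 0 else X $$ (i, j))"
  have c: "Y \<in> carrier_mat n m" "Z \<in> carrier_mat n m" by (auto simp: Y_def Z_def)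
  have "X = Y + Z"
    using assms(3) by (intro eq_matI) (auto simp: Y_def Z_def)
  moreover have "mat_rank Y \<le> card S"
    using assms(1) by (intro mat_rank_row_support[OF _ c(1)]) (auto simp: Y_def)
  moreover have "mat_rank Z \<le> card S'"
    using assms by (intro mat_rank_col_support[OF _ c(2)]) (auto simp: Z_def)
  ultimately show ?thesis
    using mat_rank_add[OF c] by simp
qed

text \<open>Negation does not change the span of the columns. One inclusion suffices, applied to
  \<open>X\<close> and to \<open>- X\<close>.\<close>

lemma mat_rank_uminus:
  assumes X: "X \<in> carrier_mat n m"
  shows "mat_rank (- X) = mat_rank X"
proof -
  interpret vec_space "TYPE(complex)" n .
  have *: "span (set (cols (- Y))) \<subseteq> span (set (cols Y))" if Y: "Y \<in> carrier_mat n m" for Y :: "complex mat"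
  proof (rule span_is_subset)
    have carr: "set (cols Y) \<subseteq> carrier_vec n" using Y cols_dim by blast
    show "set (cols (- Y)) \<subseteq> span (set (cols Y))"
    proof
      fix c assume "c \<in> set (cols (- Y))"
      then obtain j where j: "j < m" "c = col (- Y) j"
        using Y by (auto simp: in_set_conv_nth)
      then have "c = (-1) \<cdot>\<^sub>v col Y j"
        using Y by (intro eq_vecI) auto
      moreover have "col Y j \<in> span (set (cols Y))"
        using span_mem[OF carr, of "col Y j"] j Y by (auto simp: in_set_conv_nth cols_def)
      ultimately show "c \<in> span (set (cols Y))"
        using smult_in_span[OF carr] by simp
    qed
    show "submodule class_ring (span (set (cols Y))) V"
      by (rule span_is_submodule[OF carr])
  qed
  have "- (- X) = X" using X by (intro eq_matI) auto
  then have "span (set (cols (- X))) = span (set (cols X))"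
    using *[OF X] *[of "- X"] X by auto
  then show ?thesis using X by (simp add: rank_def)
qed


text \<open>The functions \<open>u k\<close> stand for an orthonormal basis of right singular
  vectors. It is recorded through its consequences: Parseval's identity, the weighted form of it for
  \<open>A *\<^sub>v v\<close>, and the traces of powers, which are the even moments of the singular
  values.\<close>

definition singular_basis :: "nat \<Rightarrow> complex mat \<Rightarrow> (nat \<Rightarrow> real) \<Rightarrow> (nat \<Rightarrow> nat \<Rightarrow> complex) \<Rightarrow> bool" where
  "singular_basis n A s u \<longleftrightarrow>
     (\<forall>k<n. 0 \<le> s k) \<and> singular_values A = image_mset s (mset_set {..<n}) \<and>
     (\<forall>v\<in>carrier_vec n.
        (vec_l2_norm v)\<^sup>2 = (\<Sum>k<n. (cmod (\<Sum>i<n. cnj (u k i) * Matrix.vec_index v i))\<^sup>2) \<and>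
        (vec_l2_norm (A *\<^sub>v v))\<^sup>2 = (\<Sum>k<n. (s k)\<^sup>2 * (cmod (\<Sum>i<n. cnj (u k i) * Matrix.vec_index v i))\<^sup>2)) \<and>
     (\<forall>p. mat_trace ((mat_adjoint A * A) ^\<^sub>m p) = complex_of_real (\<Sum>k<n. (s k) ^ (2 * p)))"

lemma proots_linear_factors:
  fixes xs :: "complex list"
  shows "proots (\<Prod>a\<leftarrow>xs. [:- a, 1:]) = mset xs"
proof (induction xs)
  case (Cons x xs)
  have "(\<Prod>a\<leftarrow>xs. [:- a, 1:]) \<noteq> 0" by (auto simp: prod_list_zero_iff)
  then show ?case using Cons by (simp add: proots_mult del: mult_pCons_left)
qed simp

lemma singular_basis_norm:
  assumes "singular_basis n A s u" "v \<in> carrier_vec n"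
  shows "(vec_l2_norm v)\<^sup>2 = (\<Sum>k<n. (cmod (\<Sum>i<n. cnj (u k i) * Matrix.vec_index v i))\<^sup>2)"
    and "(vec_l2_norm (A *\<^sub>v v))\<^sup>2
      = (\<Sum>k<n. (s k)\<^sup>2 * (cmod (\<Sum>i<n. cnj (u k i) * Matrix.vec_index v i))\<^sup>2)"
  using assms by (simp_all add: singular_basis_def)

lemma mat_diag_pow: "mat_diag n f ^\<^sub>m p = mat_diag n (\<lambda>i. (f i :: complex) ^ p)"
proof (induction p)
  case 0
  then show ?case by (simp add: mat_diag_dim[THEN carrier_matD(1)])
next
  case (Suc p)
  then show ?case by (simp add: mult.commute)
qed

lemma cnj_mult_self: "cnj z * z = complex_of_real ((cmod z)\<^sup>2)"
  by (simp add: complex_norm_square mult.commute del: of_real_power)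

lemma singular_basis_exists:
  assumes A: "A \<in> carrier_mat n n"
  obtains s u where "singular_basis n A s u"
proof -
  define H where "H = mat_adjoint A * A"
  have H: "H \<in> carrier_mat n n"
    unfolding H_def by (rule mult_carrier_mat[OF mat_adjoint_carrier[OF A] A])
  have Hij: "H $$ (i, j) = (\<Sum>l<n. cnj (A $$ (l, i)) * A $$ (l, j))" if "i < n" "j < n" for i j
    unfolding H_def using mult_mat_index_sum[OF mat_adjoint_carrier[OF A] A that] that A by simp
  have herm: "H $$ (i, j) = cnj (H $$ (j, i))" if "i < n" "j < n" for i j
    using that by (simp add: Hij mult.commute)
  obtain u e where eig: "\<And>l i. l < n \<Longrightarrow> i < n \<Longrightarrow> (\<Sum>j<n. H $$ (i, j) * u l j) = complex_of_real (e l) * u l i"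
    and orth: "\<And>l l'. l < n \<Longrightarrow> l' < n \<Longrightarrow> (\<Sum>i<n. u l i * cnj (u l' i)) = (if l = l' then 1 else 0)"
    by (rule hermitian_orthonormal_eigenbasis[OF H herm]) auto
  define U where "U = Matrix.mat n n (\<lambda>(i, k). u k i)"
  define V where "V = Matrix.mat n n (\<lambda>(k, i). cnj (u k i))"
  define D where "D = mat_diag n (\<lambda>k. complex_of_real (e k))"
  have c: "U \<in> carrier_mat n n" "V \<in> carrier_mat n n" "D \<in> carrier_mat n n"
    by (auto simp: U_def V_def D_def)
  have VU: "V * U = 1\<^sub>m n"
  proof (rule eq_matI)
    fix i j assume "i < dim_row (1\<^sub>m n :: complex mat)" "j < dim_col (1\<^sub>m n :: complex mat)"
    then have ij: "i < n" "j < n" by auto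
    then show "(V * U) $$ (i, j) = 1\<^sub>m n $$ (i, j)"
      using mult_mat_index_sum[OF c(2,1) ij] orth[OF ij(2,1)] by (auto simp: U_def V_def mult.commute)
  qed (use c in auto)
  \<comment> \<open>Orthonormality of the \<open>u k\<close> gives \<open>V * U = 1\<close>; the
    product in the other order is the completeness relation behind Parseval's identity.\<close>
  have UV: "U * V = 1\<^sub>m n"
    by (rule mat_mult_left_right_inverse[OF c(2,1) VU])
  have HU: "H * U = U * D"
  proof (rule eq_matI)
    fix i j assume "i < dim_row (U * D)" "j < dim_col (U * D)"
    then have ij: "i < n" "j < n" using c by auto
    have "(H * U) $$ (i, j) = (\<Sum>l<n. H $$ (i, l) * u j l)"
      using mult_mat_index_sum[OF H c(1) ij] ij by (simp add: U_def)
    also have "\<dots> = (U * D) $$ (i, j)"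
      unfolding D_def using mat_diag_mult_right[OF c(1)] ij eig by (simp add: U_def mult.commute)
    finally show "(H * U) $$ (i, j) = (U * D) $$ (i, j)" .
  qed (use c H in auto)
  have "H = H * (U * V)" using UV H by simp
  also have "\<dots> = H * U * V" by (rule assoc_mult_mat[OF H c(1,2), symmetric])
  also have "\<dots> = U * D * V" by (simp only: HU)
  finally have HD: "similar_mat_wit H D U V"
    by (intro similar_mat_witI[OF UV VU _ H c(3,1,2)])
  have Hsum: "H $$ (i, j) = (\<Sum>k<n. complex_of_real (e k) * u k i * cnj (u k j))" if "i < n" "j < n" for i j
  proof -
    have "H $$ (i, j) = ((U * D) * V) $$ (i, j)" using HD by (simp add: similar_mat_wit_def Let_def)
    also have "\<dots> = (\<Sum>k<n. (U * D) $$ (i, k) * V $$ (k, j))"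
      using mult_mat_index_sum[of "U * D" n n V n i j] c that by simp
    also have "\<dots> = (\<Sum>k<n. complex_of_real (e k) * u k i * cnj (u k j))"
      unfolding D_def using mat_diag_mult_right[OF c(1)] that by (intro sum.cong) (auto simp: U_def V_def)
    finally show ?thesis .
  qed
  have UV': "(\<Sum>k<n. u k i * cnj (u k j)) = (if i = j then 1 else 0)" if "i < n" "j < n" for i j
  proof -
    have "(\<Sum>k<n. u k i * cnj (u k j)) = (\<Sum>k<n. U $$ (i, k) * V $$ (k, j))"
      using that by (intro sum.cong) (auto simp: U_def V_def)
    also have "\<dots> = (U * V) $$ (i, j)" by (rule mult_mat_index_sum[OF c(1,2) that, symmetric])
    finally show ?thesis using that by (simp add: UV)
  qed
  \<comment> \<open>The quadratic form that is diagonal in the basis \<open>u\<close> with weights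
    \<open>f\<close>. All weights equal to 1 give Parseval's identity, the weights \<open>e\<close>
    give the norm of \<open>A *\<^sub>v v\<close>.\<close>
  have expand: "(\<Sum>i<n. \<Sum>j<n. cnj (x i) * (\<Sum>k<n. f k * u k i * cnj (u k j)) * x j)
      = (\<Sum>k<n. f k * complex_of_real ((cmod (\<Sum>i<n. cnj (u k i) * x i))\<^sup>2))" for x f
  proof -
    have "(\<Sum>i<n. \<Sum>j<n. cnj (x i) * (\<Sum>k<n. f k * u k i * cnj (u k j)) * x j)
        = (\<Sum>i<n. \<Sum>j<n. \<Sum>k<n. f k * ((cnj (u k j) * x j) * (u k i * cnj (x i))))"
      by (simp add: sum_distrib_left sum_distrib_right mult_ac)
    also have "\<dots> = (\<Sum>i<n. \<Sum>k<n. \<Sum>j<n. f k * ((cnj (u k j) * x j) * (u k i * cnj (x i))))"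
      by (rule sum.cong[OF refl], rule sum.swap)
    also have "\<dots> = (\<Sum>k<n. \<Sum>i<n. \<Sum>j<n. f k * ((cnj (u k j) * x j) * (u k i * cnj (x i))))"
      by (rule sum.swap)
    also have "\<dots> = (\<Sum>k<n. f k * (cnj (\<Sum>i<n. cnj (u k i) * x i) * (\<Sum>j<n. cnj (u k j) * x j)))"
      by (simp add: sum_product sum_distrib_left mult_ac)
    also have "\<dots> = (\<Sum>k<n. f k * complex_of_real ((cmod (\<Sum>i<n. cnj (u k i) * x i))\<^sup>2))"
      by (simp only: cnj_mult_self)
    finally show ?thesis .
  qed
  have n1: "(vec_l2_norm v)\<^sup>2 = (\<Sum>k<n. (cmod (\<Sum>i<n. cnj (u k i) * Matrix.vec_index v i))\<^sup>2)"
    if v: "v \<in> carrier_vec n" for v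
  proof -
    have "complex_of_real ((vec_l2_norm v)\<^sup>2) = (\<Sum>i<n. cnj (Matrix.vec_index v i) * Matrix.vec_index v i)"
      unfolding vec_l2_norm_square[OF v] by (simp add: complex_norm_square mult.commute del: of_real_power)
    also have "\<dots> = (\<Sum>i<n. \<Sum>j<n. cnj (Matrix.vec_index v i) * (\<Sum>k<n. 1 * u k i * cnj (u k j)) * Matrix.vec_index v j)"
    proof (intro sum.cong refl)
      fix i assume "i \<in> {..<n}"
      then have i: "i < n" by simp
      have "(\<Sum>j<n. cnj (Matrix.vec_index v i) * (\<Sum>k<n. 1 * u k i * cnj (u k j)) * Matrix.vec_index v j)
          = (\<Sum>j<n. if j = i then cnj (Matrix.vec_index v i) * Matrix.vec_index v j else 0)"
        using UV'[OF i] by (intro sum.cong refl) auto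
      then show "cnj (Matrix.vec_index v i) * Matrix.vec_index v i
          = (\<Sum>j<n. cnj (Matrix.vec_index v i) * (\<Sum>k<n. 1 * u k i * cnj (u k j)) * Matrix.vec_index v j)"
        using i by simp
    qed
    also have "\<dots> = complex_of_real (\<Sum>k<n. (cmod (\<Sum>i<n. cnj (u k i) * Matrix.vec_index v i))\<^sup>2)"
      unfolding expand by simp
    finally show ?thesis using of_real_eq_iff by blast
  qed
  have n2: "(vec_l2_norm (A *\<^sub>v v))\<^sup>2 = (\<Sum>k<n. e k * (cmod (\<Sum>i<n. cnj (u k i) * Matrix.vec_index v i))\<^sup>2)"
    if v: "v \<in> carrier_vec n" for v
  proof -
    have Av: "A *\<^sub>v v \<in> carrier_vec n" using A v by simp
    have "complex_of_real ((vec_l2_norm (A *\<^sub>v v))\<^sup>2) = (\<Sum>l<n. cnj (\<Sum>i<n. A $$ (l, i) * Matrix.vec_index v i) * (\<Sum>j<n. A $$ (l, j) * Matrix.vec_index v j))"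
      unfolding vec_l2_norm_square[OF Av] using A v
      by (simp add: complex_norm_square mult.commute mult_mat_vec_index_sum del: of_real_power index_mult_mat_vec)
    also have "\<dots> = (\<Sum>l<n. \<Sum>i<n. \<Sum>j<n. cnj (Matrix.vec_index v i) * (cnj (A $$ (l, i)) * A $$ (l, j)) * Matrix.vec_index v j)"
      unfolding cnj_sum sum_product by (intro sum.cong refl) (simp add: mult_ac)
    also have "\<dots> = (\<Sum>i<n. \<Sum>l<n. \<Sum>j<n. cnj (Matrix.vec_index v i) * (cnj (A $$ (l, i)) * A $$ (l, j)) * Matrix.vec_index v j)"
      by (rule sum.swap)
    also have "\<dots> = (\<Sum>i<n. \<Sum>j<n. \<Sum>l<n. cnj (Matrix.vec_index v i) * (cnj (A $$ (l, i)) * A $$ (l, j)) * Matrix.vec_index v j)"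
      by (rule sum.cong[OF refl], rule sum.swap)
    also have "\<dots> = (\<Sum>i<n. \<Sum>j<n. cnj (Matrix.vec_index v i) * H $$ (i, j) * Matrix.vec_index v j)"
      by (intro sum.cong refl) (simp add: Hij sum_distrib_left sum_distrib_right)
    also have "\<dots> = (\<Sum>i<n. \<Sum>j<n. cnj (Matrix.vec_index v i) * (\<Sum>k<n. complex_of_real (e k) * u k i * cnj (u k j)) * Matrix.vec_index v j)"
      by (intro sum.cong refl) (simp add: Hsum)
    also have "\<dots> = complex_of_real (\<Sum>k<n. e k * (cmod (\<Sum>i<n. cnj (u k i) * Matrix.vec_index v i))\<^sup>2)"
      unfolding expand by simp
    finally show ?thesis using of_real_eq_iff by blast
  qed
  \<comment> \<open>The eigenvalue \<open>e k\<close> is the squared norm of \<open>A\<close>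
    applied to the \<open>k\<close>-th eigenvector.\<close>
  have e0: "0 \<le> e k" if k: "k < n" for k
  proof -
    define v where "v = Matrix.vec n (u k)"
    have v: "v \<in> carrier_vec n" by (simp add: v_def)
    have "(\<Sum>i<n. cnj (u l i) * Matrix.vec_index v i) = (if l = k then 1 else 0)" if "l < n" for l
      using orth[OF k that] by (auto simp: v_def mult.commute)
    then have "(vec_l2_norm (A *\<^sub>v v))\<^sup>2 = (\<Sum>l<n. e l * (cmod (if l = k then 1 else 0))\<^sup>2)"
      unfolding n2[OF v] by (intro sum.cong) auto
    also have "\<dots> = (\<Sum>l<n. if l = k then e l else 0)"
      by (intro sum.cong) auto
    also have "\<dots> = e k" using k by simp
    finally show ?thesis by (metis zero_le_power2)
  qed
  define s where "s k = sqrt (e k)" for k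
  have se: "(s k)\<^sup>2 = e k" if "k < n" for k
    using e0[OF that] by (simp add: s_def)
  have "char_poly H = (\<Prod>a\<leftarrow>diag_mat D. [:- a, 1:])"
  proof -
    have "similar_mat H D" using HD unfolding similar_mat_def by blast
    moreover have "upper_triangular D" by (auto simp: D_def mat_diag_def)
    ultimately show ?thesis
      using char_poly_similar[of H D] char_poly_upper_triangular[OF c(3)] by simp
  qed
  then have "proots (char_poly H) = mset (diag_mat D)"
    by (simp add: proots_linear_factors)
  also have "diag_mat D = map (\<lambda>k. complex_of_real (e k)) [0..<n]"
    using c by (auto simp: diag_mat_def D_def mat_diag_def)
  finally have "singular_values A = image_mset s (mset_set {..<n})"
    by (simp add: singular_values_def H_def[symmetric] s_def[abs_def] image_mset.compositionality
        comp_def atLeast0LessThan)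
  moreover have "mat_trace (H ^\<^sub>m p) = complex_of_real (\<Sum>k<n. (s k) ^ (2 * p))" for p
  proof -
    have "mat_trace (H ^\<^sub>m p) = mat_trace (D ^\<^sub>m p)"
      by (rule trace_similar[OF similar_mat_wit_pow[OF HD]])
    also have "\<dots> = (\<Sum>k<n. complex_of_real (e k) ^ p)"
      unfolding D_def mat_diag_pow by (simp add: mat_trace_def mat_diag_def)
    finally show ?thesis by (simp add: power_mult se)
  qed
  ultimately have "singular_basis n A s u"
    unfolding singular_basis_def using n1 n2 e0 by (auto simp: se H_def[symmetric] s_def)
  then show thesis by (rule that)
qed

text \<open>A min-max argument in the form of a dimension count. If the inequality failed, the
  following would be fewer than \<open>n\<close> linear equations for \<open>v\<close>:
  orthogonality to the \<open>uA k\<close> with \<open>sA k \<le> t + \<epsilon>\<close>,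
  orthogonality to the \<open>uB k\<close> with \<open>sB k > t\<close>, and the equations of the
  kernel of \<open>R\<close>. A nonzero solution is stretched by \<open>A\<close> by more than
  \<open>t + \<epsilon>\<close> and by \<open>B\<close> by at most \<open>t\<close>, against
  \<open>le\<close>.\<close>

lemma singular_count_perturbation:
  assumes A: "singular_basis n A sA uA" and B: "singular_basis n B sB uB"
    and R: "R \<in> carrier_mat n n" and t: "0 \<le> t" and \<epsilon>: "0 \<le> \<epsilon>"
    and le: "\<And>v. v \<in> carrier_vec n \<Longrightarrow> R *\<^sub>v v = 0\<^sub>v n \<Longrightarrow>
      vec_l2_norm (A *\<^sub>v v) \<le> vec_l2_norm (B *\<^sub>v v) + \<epsilon> * vec_l2_norm v"
  shows "card {k. k < n \<and> sB k \<le> t} \<le> card {k. k < n \<and> sA k \<le> t + \<epsilon>} + mat_rank R"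
proof (rule ccontr)
  assume "\<not> ?thesis"
  define XA where "XA = {k. k < n \<and> sA k \<le> t + \<epsilon>}"
  define XB where "XB = {k. k < n \<and> \<not> sB k \<le> t}"
  have fin: "finite XA" "finite XB" by (auto simp: XA_def XB_def)
  have "card XB + card {k. k < n \<and> sB k \<le> t} = n"
  proof -
    have "card XB + card {k. k < n \<and> sB k \<le> t} = card (XB \<union> {k. k < n \<and> sB k \<le> t})"
      by (rule card_Un_disjoint[symmetric]) (auto simp: XB_def)
    also have "XB \<union> {k. k < n \<and> sB k \<le> t} = {..<n}" by (auto simp: XB_def)
    finally show ?thesis by simp
  qed
  with \<open>\<not> ?thesis\<close> have small: "card XA + card XB + mat_rank R < n"
    by (simp add: XA_def)
  obtain g where g: "\<And>v. v \<in> carrier_vec n \<Longrightarrow> (\<forall>i<mat_rank R. (\<Sum>j<n. g i j * Matrix.vec_index v j) = 0) \<Longrightarrow> R *\<^sub>v v = 0\<^sub>v n"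
    using mat_rank_kernel[OF R] by blast
  obtain a where a: "bij_betw a {..<card XA} XA"
    using ex_bij_betw_nat_finite[OF fin(1)] by (auto simp: atLeast0LessThan)
  obtain b where b: "bij_betw b {..<card XB} XB"
    using ex_bij_betw_nat_finite[OF fin(2)] by (auto simp: atLeast0LessThan)
  define h where "h i = (if i < card XA then (\<lambda>j. cnj (uA (a i) j))
    else if i < card XA + card XB then (\<lambda>j. cnj (uB (b (i - card XA)) j))
    else g (i - card XA - card XB))" for i
  obtain v where v: "v \<in> carrier_vec n" "v \<noteq> 0\<^sub>v n"
    and hv: "\<And>i. i < card XA + card XB + mat_rank R \<Longrightarrow> (\<Sum>j<n. h i j * Matrix.vec_index v j) = 0"
    by (rule homogeneous_system_solution[OF small, of h]) auto
  have vA: "(\<Sum>j<n. cnj (uA k j) * Matrix.vec_index v j) = 0" if "k \<in> XA" for k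
  proof -
    obtain i where i: "i < card XA" "a i = k" using \<open>k \<in> XA\<close> bij_betw_imp_surj_on[OF a] by (metis imageE lessThan_iff)
    then show ?thesis using hv[of i] by (simp add: h_def)
  qed
  have vB: "(\<Sum>j<n. cnj (uB k j) * Matrix.vec_index v j) = 0" if "k \<in> XB" for k
  proof -
    obtain i where i: "i < card XB" "b i = k" using \<open>k \<in> XB\<close> bij_betw_imp_surj_on[OF b] by (metis imageE lessThan_iff)
    then show ?thesis using hv[of "card XA + i"] by (simp add: h_def)
  qed
  have "R *\<^sub>v v = 0\<^sub>v n"
  proof (rule g[OF v(1)], intro allI impI)
    fix i assume "i < mat_rank R"
    then show "(\<Sum>j<n. g i j * Matrix.vec_index v j) = 0"
      using hv[of "card XA + card XB + i"] by (simp add: h_def)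
  qed
  then have le': "vec_l2_norm (A *\<^sub>v v) \<le> vec_l2_norm (B *\<^sub>v v) + \<epsilon> * vec_l2_norm v"
    using le v by blast
  have pos: "vec_l2_norm v > 0"
    using vec_l2_norm_eq_0[OF v(1)] v(2) by (auto simp: less_le)
  define cA where "cA k = (cmod (\<Sum>i<n. cnj (uA k i) * Matrix.vec_index v i))\<^sup>2" for k
  define cB where "cB k = (cmod (\<Sum>i<n. cnj (uB k i) * Matrix.vec_index v i))\<^sup>2" for k
  have nA: "(vec_l2_norm v)\<^sup>2 = (\<Sum>k<n. cA k)" "(vec_l2_norm (A *\<^sub>v v))\<^sup>2 = (\<Sum>k<n. (sA k)\<^sup>2 * cA k)"
    and nB: "(vec_l2_norm v)\<^sup>2 = (\<Sum>k<n. cB k)" "(vec_l2_norm (B *\<^sub>v v))\<^sup>2 = (\<Sum>k<n. (sB k)\<^sup>2 * cB k)"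
    using singular_basis_norm[OF A v(1)] singular_basis_norm[OF B v(1)] by (simp_all only: cA_def cB_def)
  have "(vec_l2_norm (B *\<^sub>v v))\<^sup>2 \<le> (\<Sum>k<n. t\<^sup>2 * cB k)"
    unfolding nB(2)
  proof (rule sum_mono)
    fix k assume "k \<in> {..<n}"
    then show "(sB k)\<^sup>2 * cB k \<le> t\<^sup>2 * cB k"
    proof (cases "k \<in> XB")
      case True
      then show ?thesis using vB[of k] by (simp add: cB_def)
    next
      case False
      then have "sB k \<le> t" "0 \<le> sB k" using \<open>k \<in> {..<n}\<close> B by (auto simp: XB_def singular_basis_def)
      then show ?thesis by (intro mult_right_mono power_mono) (auto simp: cB_def)
    qed
  qed
  also have "\<dots> = (t * vec_l2_norm v)\<^sup>2"
    by (simp add: power_mult_distrib nB(1) sum_distrib_left)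
  finally have leB: "vec_l2_norm (B *\<^sub>v v) \<le> t * vec_l2_norm v"
    using t by (auto intro: power2_le_imp_le)
  have "((t + \<epsilon>) * vec_l2_norm v)\<^sup>2 = (\<Sum>k<n. (t + \<epsilon>)\<^sup>2 * cA k)"
    by (simp add: power_mult_distrib nA(1) sum_distrib_left)
  \<comment> \<open>Strict, because \<open>v\<close> is nonzero and its coefficients over
    \<open>XA\<close> vanish: some coefficient with \<open>sA k > t + \<epsilon>\<close>
    remains.\<close>
  also have "\<dots> < (\<Sum>k<n. (sA k)\<^sup>2 * cA k)"
  proof (rule sum_strict_mono_ex1)
    have mono: "(t + \<epsilon>)\<^sup>2 < (sA k)\<^sup>2" if "k < n" "k \<notin> XA" for k
      using that t \<epsilon> by (intro power_strict_mono) (auto simp: XA_def)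
    have zero: "cA k = 0" if "k \<in> XA" for k using vA[OF that] by (simp add: cA_def)
    show "\<forall>k\<in>{..<n}. (t + \<epsilon>)\<^sup>2 * cA k \<le> (sA k)\<^sup>2 * cA k"
    proof
      fix k assume "k \<in> {..<n}"
      then show "(t + \<epsilon>)\<^sup>2 * cA k \<le> (sA k)\<^sup>2 * cA k"
        using mono[of k] zero[of k] by (cases "k \<in> XA") (auto intro!: mult_right_mono simp: cA_def)
    qed
    have "\<exists>k<n. cA k \<noteq> 0"
    proof (rule ccontr)
      assume "\<not> ?thesis"
      then have "(vec_l2_norm v)\<^sup>2 = 0" unfolding nA(1) by (intro sum.neutral) auto
      then show False using pos by simp
    qed
    then obtain k where k: "k < n" "cA k \<noteq> 0" by blast
    then have "k \<notin> XA" using zero by blast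
    have "cA k > 0" using k(2) by (simp add: cA_def)
    then show "\<exists>k\<in>{..<n}. (t + \<epsilon>)\<^sup>2 * cA k < (sA k)\<^sup>2 * cA k"
      using k(1) mono[OF k(1) \<open>k \<notin> XA\<close>] by (intro bexI[of _ k]) auto
  qed simp
  also have "\<dots> = (vec_l2_norm (A *\<^sub>v v))\<^sup>2" using nA(2) by simp
  finally have "(t + \<epsilon>) * vec_l2_norm v < vec_l2_norm (A *\<^sub>v v)"
    by (rule power_less_imp_less_base) simp
  with le' leB show False by (simp add: algebra_simps)
qed

text \<open>After sorting, the counting hypothesis says that the entry of \<open>a\<close> at place
  \<open>j - R\<close> exceeds the entry of \<open>b\<close> at place \<open>j\<close> by at most
  \<open>\<epsilon>\<close>. An antimonotone \<open>\<phi>\<close> turns this into a comparison term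
  by term; the first \<open>R\<close> terms of \<open>b\<close> have no partner and cost at most 1
  each.\<close>

lemma sorted_counts_matching:
  fixes a b :: "nat \<Rightarrow> real"
  assumes count: "\<And>k. k < n \<Longrightarrow> card {i. i < n \<and> b i \<le> b k} \<le> card {i. i < n \<and> a i \<le> b k + \<epsilon>} + R"
    and \<phi>: "antimono \<phi>" "\<And>x. 0 \<le> \<phi> x" "\<And>x. \<phi> x \<le> 1" "\<And>x. \<phi> x \<le> \<phi> (x + \<epsilon>) + \<delta>" and \<delta>: "0 \<le> (\<delta>::real)"
  shows "(\<Sum>k<n. \<phi> (b k)) \<le> (\<Sum>k<n. \<phi> (a k)) + real R + real n * \<delta>"
proof -
  define as where "as = sort (map a [0..<n])"
  define bs where "bs = sort (map b [0..<n])"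
  have len: "length as = n" "length bs = n" by (auto simp: as_def bs_def)
  have srt: "sorted as" "sorted bs" by (auto simp: as_def bs_def)
  have cnt: "card {i. i < n \<and> sort (map c [0..<n]) ! i \<le> t} = card {i. i < n \<and> c i \<le> t}" for c :: "nat \<Rightarrow> real" and t
  proof -
    have "card {i. i < n \<and> sort (map c [0..<n]) ! i \<le> t} = length (filter (\<lambda>x. x \<le> t) (sort (map c [0..<n])))"
      by (simp add: length_filter_conv_card)
    also have "\<dots> = length (filter (\<lambda>x. x \<le> t) (map c [0..<n]))"
      by (simp only: filter_sort length_sort)
    also have "\<dots> = card {i. i < n \<and> c i \<le> t}"
      by (simp add: length_filter_conv_card cong: conj_cong)
    finally show ?thesis .
  qed
  have sums: "(\<Sum>k<n. \<phi> (c k)) = (\<Sum>k<n. \<phi> (sort (map c [0..<n]) ! k))" for c :: "nat \<Rightarrow> real"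
  proof -
    have "(\<Sum>k<n. \<phi> (c k)) = sum_list (map \<phi> (map c [0..<n]))"
      by (simp add: sum_list_distinct_conv_sum_set atLeast0LessThan comp_def)
    also have "\<dots> = sum_list (map \<phi> (sort (map c [0..<n])))"
      by (metis mset_map mset_sort sum_mset_sum_list)
    also have "\<dots> = (\<Sum>k<n. \<phi> (sort (map c [0..<n]) ! k))"
      by (simp add: sum_list_sum_nth atLeast0LessThan)
    finally show ?thesis .
  qed
  have match: "as ! (j - R) \<le> bs ! j + \<epsilon>" if j: "j < n" "R \<le> j" for j
  proof (rule ccontr)
    assume gt: "\<not> ?thesis"
    \<comment> \<open>The hypothesis \<open>count\<close> speaks of thresholds that are values of
      \<open>b\<close>; \<open>bs ! j\<close> is one of them.\<close>
    have "bs ! j \<in> set (map b [0..<n])"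
      using j len by (metis bs_def nth_mem set_sort)
    then obtain k where k: "k < n" "bs ! j = b k" by auto
    have "{i. i < n \<and> as ! i \<le> bs ! j + \<epsilon>} \<subseteq> {..<j - R}"
    proof
      fix i assume i: "i \<in> {i. i < n \<and> as ! i \<le> bs ! j + \<epsilon>}"
      show "i \<in> {..<j - R}"
      proof (rule ccontr)
        assume "i \<notin> {..<j - R}"
        then have "as ! (j - R) \<le> as ! i" using i len by (intro sorted_nth_mono[OF srt(1)]) auto
        with i gt show False by simp
      qed
    qed
    then have a: "card {i. i < n \<and> as ! i \<le> bs ! j + \<epsilon>} \<le> j - R"
      using card_mono[OF finite_lessThan] by fastforce
    have "{..j} \<subseteq> {i. i < n \<and> bs ! i \<le> bs ! j}"
      using j len sorted_nth_mono[OF srt(2)] by auto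
    then have "Suc j \<le> card {i. i < n \<and> bs ! i \<le> bs ! j}"
      using card_mono[of "{i. i < n \<and> bs ! i \<le> bs ! j}" "{..j}"] by simp
    then have "Suc j \<le> card {i. i < n \<and> b i \<le> b k}"
      unfolding k(2)[symmetric] using cnt[of b "bs ! j"] by (simp add: bs_def)
    moreover have "card {i. i < n \<and> a i \<le> b k + \<epsilon>} \<le> j - R"
      using a cnt[of a "bs ! j + \<epsilon>"] by (simp add: as_def k(2))
    ultimately show False using count[OF k(1)] j by simp
  qed
  have "(\<Sum>k<n. \<phi> (b k)) = (\<Sum>j<n. \<phi> (bs ! j))"
    unfolding bs_def by (rule sums)
  also have "\<dots> = (\<Sum>j | j < n \<and> j < R. \<phi> (bs ! j)) + (\<Sum>j | j < n \<and> R \<le> j. \<phi> (bs ! j))"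
    by (subst sum.union_disjoint[symmetric]) (auto intro!: sum.cong)
  also have "(\<Sum>j | j < n \<and> j < R. \<phi> (bs ! j)) \<le> real R"
  proof -
    have "(\<Sum>j | j < n \<and> j < R. \<phi> (bs ! j)) \<le> (\<Sum>j | j < n \<and> j < R. 1)"
      by (intro sum_mono \<phi>)
    also have "\<dots> = real (card {j. j < n \<and> j < R})" by simp
    also have "\<dots> \<le> real (card {..<R})"
      by (intro of_nat_mono card_mono) auto
    finally show ?thesis by simp
  qed
  also have "(\<Sum>j | j < n \<and> R \<le> j. \<phi> (bs ! j)) \<le> (\<Sum>j | j < n \<and> R \<le> j. \<phi> (as ! (j - R)) + \<delta>)"
  proof (rule sum_mono)
    fix j assume "j \<in> {j. j < n \<and> R \<le> j}"
    then have "\<phi> (bs ! j + \<epsilon>) \<le> \<phi> (as ! (j - R))"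
      using match[of j] by (intro antimonoD[OF \<phi>(1)]) auto
    then show "\<phi> (bs ! j) \<le> \<phi> (as ! (j - R)) + \<delta>"
      using \<phi>(4)[of "bs ! j"] by simp
  qed
  also have "\<dots> = (\<Sum>j | j < n \<and> R \<le> j. \<phi> (as ! (j - R))) + real (card {j. j < n \<and> R \<le> j}) * \<delta>"
    by (simp add: sum.distrib)
  also have "(\<Sum>j | j < n \<and> R \<le> j. \<phi> (as ! (j - R))) = (\<Sum>i | i < n - R. \<phi> (as ! i))"
    by (rule sum.reindex_bij_witness[of _ "\<lambda>i. i + R" "\<lambda>j. j - R"]) auto
  also have "\<dots> \<le> (\<Sum>i<n. \<phi> (as ! i))"
    by (intro sum_mono2 \<phi>) auto
  also have "(\<Sum>i<n. \<phi> (as ! i)) = (\<Sum>k<n. \<phi> (a k))"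
    unfolding as_def by (rule sums[symmetric])
  also have "real (card {j. j < n \<and> R \<le> j}) * \<delta> \<le> real n * \<delta>"
    using \<delta> card_mono[of "{..<n}" "{j. j < n \<and> R \<le> j}"] by (intro mult_right_mono) auto
  finally show ?thesis by simp
qed

section \<open>Continuous step functions as test functions\<close>

lemma cts_step_clamp:
  assumes "x < y"
  shows "cts_step x y t = max 0 (min 1 ((y - t) / (y - x)))"
  using assms by (auto simp: cts_step_def field_simps max_def min_def)

lemma cts_step_lipschitz:
  assumes "x < y"
  shows "\<bar>cts_step x y s - cts_step x y t\<bar> \<le> \<bar>s - t\<bar> / (y - x)"
proof -
  have "\<bar>cts_step x y s - cts_step x y t\<bar> \<le> \<bar>(y - s) / (y - x) - (y - t) / (y - x)\<bar>"
    unfolding cts_step_clamp[OF assms] by linarith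
  also have "(y - s) / (y - x) - (y - t) / (y - x) = (t - s) / (y - x)"
    by (simp add: diff_divide_distrib[symmetric])
  finally show ?thesis using assms by (simp add: abs_divide abs_minus_commute)
qed

lemma cts_step_bounds:
  assumes "x < y"
  shows "0 \<le> cts_step x y t" "cts_step x y t \<le> 1" "\<bar>cts_step x y t\<bar> \<le> 1"
  unfolding cts_step_clamp[OF assms] by auto

lemma antimono_cts_step:
  assumes "x < y"
  shows "antimono (cts_step x y)"
proof (rule antimonoI)
  fix s t :: real assume "s \<le> t"
  then have "(y - t) / (y - x) \<le> (y - s) / (y - x)"
    using assms by (intro divide_right_mono) auto
  then show "cts_step x y t \<le> cts_step x y s"
    unfolding cts_step_clamp[OF assms] by linarith
qed

lemma continuous_on_cts_step: "x < y \<Longrightarrow> continuous_on S (cts_step x y)"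
  using cts_step_uniformly_continuous uniformly_continuous_imp_continuous continuous_on_subset
  by blast

lemma sum_singular_values:
  assumes "singular_basis n A s u"
  shows "(\<Sum>z\<in>#singular_values A. f z) = (\<Sum>k<n. f (s k))"
  using assms by (simp add: singular_basis_def sum_unfold_sum_mset image_mset.compositionality comp_def)

lemma sum_cts_step_perturbation_le:
  assumes A: "A \<in> carrier_mat n n" and B: "B \<in> carrier_mat n n"
    and R: "R \<in> carrier_mat n n" and xy: "x < y" and \<epsilon>: "0 \<le> \<epsilon>"
    and le: "\<And>v. v \<in> carrier_vec n \<Longrightarrow> R *\<^sub>v v = 0\<^sub>v n \<Longrightarrow>
      vec_l2_norm (A *\<^sub>v v) \<le> vec_l2_norm (B *\<^sub>v v) + \<epsilon> * vec_l2_norm v"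
  shows "(\<Sum>s\<in>#singular_values B. cts_step x y s)
    \<le> (\<Sum>s\<in>#singular_values A. cts_step x y s) + real (mat_rank R) + real n * (\<epsilon> / (y - x))"
proof -
  obtain sA uA where sA: "singular_basis n A sA uA" using singular_basis_exists[OF A] .
  obtain sB uB where sB: "singular_basis n B sB uB" using singular_basis_exists[OF B] .
  show ?thesis
    unfolding sum_singular_values[OF sA] sum_singular_values[OF sB]
  proof (rule sorted_counts_matching[where \<epsilon> = \<epsilon> and a = sA and b = sB and \<phi> = "cts_step x y"])
    fix k assume "k < n"
    then have "0 \<le> sB k" using sB by (simp add: singular_basis_def)
    then show "card {i. i < n \<and> sB i \<le> sB k} \<le> card {i. i < n \<and> sA i \<le> sB k + \<epsilon>} + mat_rank R"
      by (rule singular_count_perturbation[OF sA sB R _ \<epsilon> le])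
  next
    fix t
    show "cts_step x y t \<le> cts_step x y (t + \<epsilon>) + \<epsilon> / (y - x)"
      using cts_step_lipschitz[OF xy, of t "t + \<epsilon>"] \<epsilon> by (simp add: abs_le_iff)
  qed (use xy \<epsilon> antimono_cts_step cts_step_bounds in auto)
qed

text \<open>On the kernel of \<open>R\<close> the matrices \<open>A\<close> and \<open>B\<close>
  differ by \<open>E\<close> alone, so the one-sided estimate applies with \<open>A\<close> and
  \<open>B\<close> in either order and with the same \<open>R\<close>.\<close>

lemma sum_cts_step_perturbation:
  assumes c: "A \<in> carrier_mat n n" "B \<in> carrier_mat n n" "R \<in> carrier_mat n n" "E \<in> carrier_mat n n"
    and eq: "A = B + R + E" and xy: "x < y" and \<epsilon>: "spectral_norm E \<le> \<epsilon>"
  shows "\<bar>(\<Sum>s\<in>#singular_values A. cts_step x y s) - (\<Sum>s\<in>#singular_values B. cts_step x y s)\<bar>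
    \<le> real (mat_rank R) + real n * (\<epsilon> / (y - x))"
proof -
  have \<epsilon>0: "0 \<le> \<epsilon>" using spectral_norm_nonneg[OF c(4)] \<epsilon> by simp
  have Av: "A *\<^sub>v v = B *\<^sub>v v + E *\<^sub>v v" if v: "v \<in> carrier_vec n" "R *\<^sub>v v = 0\<^sub>v n" for v
  proof -
    have "A *\<^sub>v v = (B + R) *\<^sub>v v + E *\<^sub>v v"
      unfolding eq by (rule add_mult_distrib_mat_vec[of _ n n]) (use c v in auto)
    also have "(B + R) *\<^sub>v v = B *\<^sub>v v + R *\<^sub>v v"
      by (rule add_mult_distrib_mat_vec[of _ n n]) (use c v in auto)
    also have "\<dots> = B *\<^sub>v v" using c v by simp
    finally show ?thesis .
  qed
  have Ev: "vec_l2_norm (E *\<^sub>v v) \<le> \<epsilon> * vec_l2_norm v" if "v \<in> carrier_vec n" for v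
    using vec_l2_norm_mult_le_spectral_norm[OF c(4) that] mult_right_mono[OF \<epsilon>, of "vec_l2_norm v"] by simp
  have 1: "vec_l2_norm (A *\<^sub>v v) \<le> vec_l2_norm (B *\<^sub>v v) + \<epsilon> * vec_l2_norm v"
    if v: "v \<in> carrier_vec n" "R *\<^sub>v v = 0\<^sub>v n" for v
    using vec_l2_norm_add[of "B *\<^sub>v v" n "E *\<^sub>v v"] Ev[OF v(1)] Av[OF v] c v by simp
  have 2: "vec_l2_norm (B *\<^sub>v v) \<le> vec_l2_norm (A *\<^sub>v v) + \<epsilon> * vec_l2_norm v"
    if v: "v \<in> carrier_vec n" "R *\<^sub>v v = 0\<^sub>v n" for v
  proof -
    have "B *\<^sub>v v = A *\<^sub>v v + (-1) \<cdot>\<^sub>v (E *\<^sub>v v)"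
      unfolding Av[OF v] using c v by (intro eq_vecI) auto
    then have "vec_l2_norm (B *\<^sub>v v) \<le> vec_l2_norm (A *\<^sub>v v) + vec_l2_norm ((-1) \<cdot>\<^sub>v (E *\<^sub>v v))"
      using vec_l2_norm_add[of "A *\<^sub>v v" n "(-1) \<cdot>\<^sub>v (E *\<^sub>v v)"] c v by simp
    then show ?thesis using Ev[OF v(1)] by (simp add: vec_l2_norm_smult)
  qed
  show ?thesis
    using sum_cts_step_perturbation_le[OF c(1-3) xy \<epsilon>0 1] sum_cts_step_perturbation_le[OF c(2,1,3) xy \<epsilon>0 2]
    by linarith
qed

section \<open>Multi-indices\<close>

text \<open>Multi-indices are taken as integer vectors because diagonals are numbered by differences
  of them.\<close>

definition index_box :: "nat ^ 'd \<Rightarrow> (int ^ 'd) set" where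
  "index_box n = {i. \<forall>s. 0 \<le> i $ s \<and> i $ s < int (n $ s)}"

definition int_index :: "nat ^ 'd::{finite,linorder} \<Rightarrow> nat \<Rightarrow> int ^ 'd::{finite,linorder}" where
  "int_index n a = (\<chi> s. int (multi_index n a $ s))"

text \<open>Uniqueness of mixed-radix digits. The least level \<open>s\<close> of an upward closed
  set \<open>A\<close> leaves the upward closed set \<open>{s<..}\<close>, whose product of sizes is
  the weight of the digit at \<open>s\<close>; \<open>mod_mult2_eq\<close> splits this digit off.
  The case \<open>A = UNIV\<close> gives the injectivity of the enumeration.\<close>

lemma multi_index_mod_eq:
  fixes n :: "nat ^ 'd::{finite,linorder}"
  assumes "\<And>s t. s \<in> A \<Longrightarrow> s \<le> t \<Longrightarrow> t \<in> A"
    and "\<And>s. s \<in> A \<Longrightarrow> multi_index n k $ s = multi_index n k' $ s"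
  shows "k mod (\<Prod>t\<in>A. n $ t) = k' mod (\<Prod>t\<in>A. n $ t)"
  using finite[of A] assms
proof (induction A rule: finite_psubset_induct)
  case (psubset A)
  show ?case
  proof (cases "A = {}")
    case False
    define s where "s = Min A"
    have s: "s \<in> A" "\<And>t. t \<in> A \<Longrightarrow> s \<le> t"
      using False by (auto simp: s_def)
    have A: "A = insert s {s<..}"
      using s psubset.prems(1) by (auto simp: order.order_iff_strict)
    have "k mod (\<Prod>t\<in>{s<..}. n $ t) = k' mod (\<Prod>t\<in>{s<..}. n $ t)"
      using s psubset.prems by (intro psubset.IH) (auto simp: A)
    moreover have "k div (\<Prod>t\<in>{s<..}. n $ t) mod n $ s = k' div (\<Prod>t\<in>{s<..}. n $ t) mod n $ s"
      using psubset.prems(2)[OF s(1)] by (simp add: multi_index_def)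
    moreover have "(\<Prod>t\<in>A. n $ t) = (\<Prod>t\<in>{s<..}. n $ t) * n $ s"
      by (subst A) (simp add: mult.commute)
    ultimately show ?thesis by (simp add: mod_mult2_eq)
  qed simp
qed

lemma bij_betw_vec_box:
  fixes n :: "nat ^ 'd::finite"
  shows "bij_betw (\<lambda>f. \<chi> s. int (f s)) (PiE UNIV (\<lambda>s. {..<n $ s})) (index_box n)"
proof (rule bij_betwI[where g = "\<lambda>i s. nat (i $ s)"])
  show "(\<lambda>f. \<chi> s. int (f s)) \<in> (PiE UNIV (\<lambda>s. {..<n $ s})) \<rightarrow> index_box n"
    by (auto simp: index_box_def PiE_def Pi_def)
  show "(\<lambda>i s. nat (i $ s)) \<in> index_box n \<rightarrow> PiE UNIV (\<lambda>s. {..<n $ s})"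
    by (auto simp: index_box_def PiE_def Pi_def extensional_def nat_less_iff)
qed (auto simp: index_box_def Finite_Cartesian_Product.vec_eq_iff)

lemma finite_index_box [simp]: "finite (index_box (n :: nat ^ 'd::finite))"
  using bij_betw_finite[OF bij_betw_vec_box[of n]] by (simp add: finite_PiE)

lemma card_index_box: "card (index_box (n :: nat ^ 'd::finite)) = level_size n"
  using bij_betw_same_card[OF bij_betw_vec_box[of n]] by (simp add: card_PiE level_size_def)

lemma bij_betw_int_index: "bij_betw (int_index n) {..<level_size n} (index_box n)"
proof -
  have inj: "inj_on (int_index n) {..<level_size n}"
  proof (rule inj_onI)
    fix k k' assume k: "k \<in> {..<level_size n}" "k' \<in> {..<level_size n}" and eq: "int_index n k = int_index n k'"
    have "k mod (\<Prod>t\<in>UNIV. n $ t) = k' mod (\<Prod>t\<in>UNIV. n $ t)"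
    proof (rule multi_index_mod_eq)
      fix s
      have "int_index n k $ s = int_index n k' $ s" using eq by simp
      then show "multi_index n k $ s = multi_index n k' $ s" by (simp add: int_index_def)
    qed simp
    then show "k = k'" using k by (simp add: level_size_def)
  qed
  have sub: "int_index n ` {..<level_size n} \<subseteq> index_box n"
  proof
    fix i assume "i \<in> int_index n ` {..<level_size n}"
    then obtain k where k: "k < level_size n" "i = int_index n k" by auto
    have "n $ s > 0" for s
      using k(1) by (metis UNIV_I finite gr0I level_size_def not_less0 prod_zero)
    then show "i \<in> index_box n" by (auto simp: k int_index_def index_box_def multi_index_def)
  qed
  moreover have "card (int_index n ` {..<level_size n}) = card (index_box n)"
    using inj by (simp add: card_image card_index_box)
  ultimately show ?thesis
    using inj by (simp add: bij_betw_def card_subset_eq)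
qed

lemma sum_int_index: "(\<Sum>a<level_size n. f (int_index n a)) = (\<Sum>i\<in>index_box n. f i)"
  by (rule sum.reindex_bij_betw[OF bij_betw_int_index])

definition index_pos :: "nat ^ 'd::{finite,linorder} \<Rightarrow> int ^ 'd::{finite,linorder} \<Rightarrow> nat" where
  "index_pos n = the_inv_into {..<level_size n} (int_index n)"

lemma index_pos_int_index [simp]: "a < level_size n \<Longrightarrow> index_pos n (int_index n a) = a"
  unfolding index_pos_def using bij_betw_int_index[of n] by (simp add: bij_betw_def the_inv_into_f_f)

lemma int_index_index_pos [simp]: "i \<in> index_box n \<Longrightarrow> int_index n (index_pos n i) = i"
  unfolding index_pos_def using bij_betw_int_index[of n] by (simp add: bij_betw_def f_the_inv_into_f)

lemma index_pos_less [simp]: "i \<in> index_box n \<Longrightarrow> index_pos n i < level_size n"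
  unfolding index_pos_def using bij_betw_int_index[of n]
  by (metis bij_betw_def lessThan_iff order_refl the_inv_into_into)

lemma int_index_in_box [simp]: "a < level_size n \<Longrightarrow> int_index n a \<in> index_box n"
  using bij_betw_int_index[of n] by (auto simp: bij_betw_def)

text \<open>The \<open>+ 1\<close> converts multi-indices counted from 0, so that the grid has its
  points in the half-open cube, away from the faces through 0.\<close>

definition grid_point :: "nat ^ 'd \<Rightarrow> int ^ 'd \<Rightarrow> real ^ 'd" where
  "grid_point n i = (\<chi> s. (of_int (i $ s) + 1) / real (n $ s))"

lemma mem_unit_cube: "x \<in> unit_cube \<longleftrightarrow> (\<forall>s. 0 \<le> x $ s \<and> x $ s \<le> 1)"
  by (auto simp: mem_box_cart)

lemma grid_point_in_cube: "i \<in> index_box n \<Longrightarrow> grid_point n i \<in> unit_cube"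
proof -
  assume i: "i \<in> index_box n"
  have "of_int (i $ s) + 1 \<le> real (n $ s)" "0 \<le> real_of_int (i $ s)" for s
    using i by (auto simp: index_box_def) (smt (verit) of_int_less_iff of_int_of_nat_eq of_int_add of_int_1 of_int_le_iff)
  then show ?thesis by (auto simp: mem_unit_cube grid_point_def divide_le_eq_1 field_simps intro: add_nonneg_nonneg)
qed

lemma sampling_mat_index:
  assumes "a < level_size n" "b < level_size n"
  shows "sampling_mat n f $$ (a, b) = (if a = b then f (grid_point n (int_index n a)) else 0)"
  using assms by (auto simp: sampling_mat_def mat_diag_def grid_point_def int_index_def add.commute intro!: arg_cong[of _ _ f])

lemma toeplitz_mat_index:
  assumes "a < level_size n" "b < level_size n"
  shows "toeplitz_mat n f $$ (a, b) = fourier_coeff f (int_index n a - int_index n b)"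
proof -
  have "(\<chi> s. int (multi_index n a $ s) - int (multi_index n b $ s)) = int_index n a - int_index n b"
    by (simp add: Finite_Cartesian_Product.vec_eq_iff int_index_def)
  then show ?thesis using assms by (simp add: toeplitz_mat_def)
qed

lemma sampling_toeplitz_sum_carrier [simp]:
  "sampling_toeplitz_sum n M b f \<in> carrier_mat (level_size n) (level_size n)"
  by (simp add: sampling_toeplitz_sum_def)

lemma sampling_toeplitz_sum_index:
  assumes "a < level_size n" "c < level_size n"
  shows "sampling_toeplitz_sum n M b f $$ (a, c)
    = (\<Sum>l<M. b l (grid_point n (int_index n a)) * fourier_coeff (f l) (int_index n a - int_index n c))"
proof -
  have "(sampling_mat n g * toeplitz_mat n h) $$ (a, c)
      = g (grid_point n (int_index n a)) * fourier_coeff h (int_index n a - int_index n c)" for g h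
  proof -
    have "(sampling_mat n g * toeplitz_mat n h) $$ (a, c)
        = (\<Sum>l<level_size n. sampling_mat n g $$ (a, l) * toeplitz_mat n h $$ (l, c))"
      using assms by (intro mult_mat_index_sum) (auto simp: sampling_mat_def toeplitz_mat_def)
    also have "\<dots> = (\<Sum>l<level_size n. if l = a then g (grid_point n (int_index n a)) * toeplitz_mat n h $$ (a, c) else 0)"
      using assms by (intro sum.cong) (auto simp: sampling_mat_index)
    finally show ?thesis using assms by (simp add: toeplitz_mat_index)
  qed
  then show ?thesis using assms by (simp add: sampling_toeplitz_sum_def)
qed

section \<open>Fourier coefficients\<close>

text \<open>Fubini's theorem over the coordinates: \<open>lborel_eq\<close> presents Lebesgue
  measure as an image of a product measure over \<open>Basis\<close>, whose elements are the vectors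
  \<open>axis s 1\<close>, and \<open>g\<close> relabels the factors \<open>f\<close> by these
  vectors.\<close>

lemma lborel_integral_prod_cart:
  fixes f :: "'d::finite \<Rightarrow> real \<Rightarrow> complex"
  assumes "\<And>s. integrable lborel (f s)"
  shows "(LINT x|lborel. (\<Prod>s\<in>UNIV. f s (x $ s))) = (\<Prod>s\<in>UNIV. integral\<^sup>L lborel (f s))"
proof -
  have B: "(Basis :: (real ^ 'd) set) = (\<lambda>s. axis s 1) ` UNIV"
    by (auto simp: Basis_vec_def)
  have inj: "inj (\<lambda>s::'d. axis s (1::real))"
    by (auto simp: inj_on_def axis_eq_axis)
  define g where "g b = f (the_inv (\<lambda>s::'d. axis s (1::real)) b)" for b
  have g: "g (axis s 1) = f s" for s
    using the_inv_f_f[OF inj, of s] by (simp add: g_def)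
  interpret product_sigma_finite "\<lambda>b::real ^ 'd. lborel :: real measure"
    by standard
  have meas: "f s \<in> borel_measurable borel" for s using assms[of s] by auto
  have m: "(\<lambda>x::real ^ 'd. \<Prod>s\<in>UNIV. f s (x $ s)) \<in> borel_measurable borel"
    by (intro borel_measurable_prod measurable_compose[OF _ meas] borel_measurable_continuous_onI continuous_intros)
  have nth: "(\<Sum>b\<in>Basis. y b *\<^sub>R b :: real ^ 'd) $ s = y (axis s 1)" for y s
  proof -
    have "(\<Sum>b\<in>Basis. y b *\<^sub>R b :: real ^ 'd) $ s = (\<Sum>b\<in>Basis. y b *\<^sub>R b :: real ^ 'd) \<bullet> axis s 1"
      by (simp add: inner_axis)
    also have "\<dots> = y (axis s 1)"
      by (simp add: inner_sum_left_Basis axis_in_Basis_iff)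
    finally show ?thesis .
  qed
  have "(LINT x|lborel. (\<Prod>s\<in>UNIV. f s (x $ s)))
      = (\<integral>y. (\<Prod>s\<in>UNIV. f s ((\<Sum>b\<in>Basis. y b *\<^sub>R b :: real ^ 'd) $ s)) \<partial>(\<Pi>\<^sub>M b\<in>(Basis::(real ^ 'd) set). lborel))"
    by (subst lborel_eq, subst integral_distr) (auto simp: m)
  also have "\<dots> = (\<integral>y. (\<Prod>b\<in>Basis. g b (y b)) \<partial>(\<Pi>\<^sub>M b\<in>(Basis::(real ^ 'd) set). lborel))"
    unfolding nth by (simp add: B prod.reindex inj g)
  also have "\<dots> = (\<Prod>b\<in>(Basis::(real ^ 'd) set). integral\<^sup>L lborel (g b))"
    by (rule product_integral_prod) (auto simp: B g assms)
  also have "\<dots> = (\<Prod>s\<in>UNIV. integral\<^sup>L lborel (f s))"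
    by (simp add: B prod.reindex inj g)
  finally show ?thesis .
qed

text \<open>Symbols are integrated over \<open>lebesgue_on\<close> a compact set, whereas Fubini's
  theorem and the fundamental theorem of calculus are applied over \<open>lborel\<close>; this is
  the passage between them.\<close>

lemma lebesgue_on_integral_continuous:
  fixes f :: "'a::euclidean_space \<Rightarrow> 'b::euclidean_space"
  assumes "compact S" "continuous_on S f"
  shows "integral\<^sup>L (lebesgue_on S) f = (LINT x|lborel. indicator S x *\<^sub>R f x)"
    and "integrable (lebesgue_on S) f"
proof -
  have S: "S \<in> sets lebesgue" "S \<in> sets borel" using assms(1) by (auto simp: borel_closed compact_imp_closed)
  have m: "(\<lambda>x. indicator S x *\<^sub>R f x) \<in> borel_measurable borel"
    by (rule borel_measurable_continuous_on_indicator[OF S(2) assms(2)])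
  show "integral\<^sup>L (lebesgue_on S) f = (LINT x|lborel. indicator S x *\<^sub>R f x)"
    using S m by (simp add: integral_restrict_space integral_completion)
  show "integrable (lebesgue_on S) f"
    using S m borel_integrable_compact[OF assms] by (simp add: integrable_restrict_space integrable_completion)
qed

lemma integral_exp_int_interval:
  "(LINT t|lborel. indicator {- pi..pi} t *\<^sub>R exp (\<i> * complex_of_real (of_int m * t)))
    = (if m = 0 then 2 * complex_of_real pi else 0)"
proof (cases "m = 0")
  case True
  then show ?thesis by (simp add: scaleR_conv_of_real)
next
  case False
  define F where "F t = exp (\<i> * complex_of_real (of_int m * t)) / (\<i> * of_int m)" for t :: real
  have "(LINT t|lborel. indicator {- pi..pi} t *\<^sub>R exp (\<i> * complex_of_real (of_int m * t))) = F pi - F (- pi)"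
  proof (rule integral_FTC_atLeastAtMost)
    fix x :: real
    show "(F has_vector_derivative exp (\<i> * complex_of_real (of_int m * x))) (at x within {- pi..pi})"
      unfolding F_def using False
      by (auto intro!: derivative_eq_intros has_vector_derivative_real_field simp: field_simps)
  qed (auto intro!: continuous_intros)
  also have "F pi = F (- pi)"
  proof -
    have "exp (\<i> * complex_of_real (of_int m * pi)) = exp (\<i> * complex_of_real (of_int m * (- pi)) + of_int (2 * m) * (of_real pi * \<i>))"
      by (simp add: algebra_simps)
    also have "\<dots> = exp (\<i> * complex_of_real (of_int m * (- pi)))"
      by (rule exp_plus_2pin[of _ m, THEN trans[rotated]]) (simp add: algebra_simps)
    finally show ?thesis by (simp add: F_def)
  qed
  finally show ?thesis using False by simp
qed

lemma continuous_int_dot [continuous_intros]: "continuous_on S (int_dot k)"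
  unfolding int_dot_def by (intro continuous_intros)

lemma integral_exp_int_dot:
  fixes k :: "int ^ 'd::finite"
  shows "(LINT \<theta>|lebesgue_on pi_cube. exp (\<i> * of_real (int_dot k \<theta>)))
    = (if k = 0 then of_real ((2 * pi) ^ CARD('d)) else 0)"
proof -
  have "(LINT \<theta>|lebesgue_on pi_cube. exp (\<i> * of_real (int_dot k \<theta>)))
      = (LINT \<theta>|lborel. indicator pi_cube \<theta> *\<^sub>R exp (\<i> * of_real (int_dot k \<theta>)))"
    by (rule lebesgue_on_integral_continuous) (auto intro!: continuous_intros)
  also have "\<dots> = (LINT \<theta>|lborel. (\<Prod>s\<in>UNIV. indicator {- pi..pi} (\<theta> $ s) *\<^sub>R exp (\<i> * complex_of_real (of_int (k $ s) * \<theta> $ s))))"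
  proof (rule Bochner_Integration.integral_cong[OF refl])
    fix \<theta> :: "real ^ 'd"
    have "(\<Prod>s\<in>UNIV. indicator {- pi..pi} (\<theta> $ s) *\<^sub>R exp (\<i> * complex_of_real (of_int (k $ s) * \<theta> $ s)))
        = (\<Prod>s\<in>UNIV. complex_of_real (indicator {- pi..pi} (\<theta> $ s))) * exp (\<i> * of_real (int_dot k \<theta>))"
      by (simp add: scaleR_conv_of_real prod.distrib int_dot_def exp_sum sum_distrib_left)
    also have "(\<Prod>s\<in>UNIV. complex_of_real (indicator {- pi..pi} (\<theta> $ s))) = of_real (indicator pi_cube \<theta>)"
    proof (cases "\<theta> \<in> pi_cube")
      case True
      then show ?thesis by (simp add: mem_box_cart)
    next
      case False
      then obtain s where "\<theta> $ s \<notin> {- pi..pi}" by (auto simp: mem_box_cart)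
      then have "(\<Prod>s\<in>UNIV. complex_of_real (indicator {- pi..pi} (\<theta> $ s))) = 0"
        by (intro prod_zero) (auto simp: indicator_def)
      then show ?thesis using False by simp
    qed
    finally show "indicator pi_cube \<theta> *\<^sub>R exp (\<i> * of_real (int_dot k \<theta>))
        = (\<Prod>s\<in>UNIV. indicator {- pi..pi} (\<theta> $ s) *\<^sub>R exp (\<i> * complex_of_real (of_int (k $ s) * \<theta> $ s)))"
      by (simp add: scaleR_conv_of_real)
  qed
  also have "\<dots> = (\<Prod>s\<in>UNIV. if k $ s = 0 then 2 * complex_of_real pi else 0)"
    by (subst lborel_integral_prod_cart)
      (simp_all only: integral_exp_int_interval, auto intro!: borel_integrable_compact continuous_intros)
  also have "\<dots> = (if k = 0 then of_real ((2 * pi) ^ CARD('d)) else 0)"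
  proof (cases "k = 0")
    case False
    then obtain s where "k $ s \<noteq> 0" by (metis Finite_Cartesian_Product.vec_eq_iff Finite_Cartesian_Product.zero_index)
    then have "(\<Prod>s\<in>UNIV. if k $ s = 0 then 2 * complex_of_real pi else 0) = 0"
      by (intro prod_zero) auto
    then show ?thesis using False by simp
  qed simp
  finally show ?thesis .
qed

lemma fourier_coeff_trig_poly:
  fixes c :: "int ^ 'd::finite \<Rightarrow> complex"
  assumes "finite K"
  shows "fourier_coeff (\<lambda>\<theta>. \<Sum>k\<in>K. c k * exp (\<i> * of_real (int_dot k \<theta>))) m = (if m \<in> K then c m else 0)"
proof -
  have e: "exp (\<i> * of_real (int_dot k \<theta>)) * exp (- \<i> * of_real (int_dot m \<theta>)) = exp (\<i> * of_real (int_dot (k - m) \<theta>))"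
    for k m :: "int ^ 'd" and \<theta>
    by (simp add: int_dot_def exp_add[symmetric] algebra_simps sum_subtractf)
  have "(LINT \<theta>|lebesgue_on pi_cube. (\<Sum>k\<in>K. c k * exp (\<i> * of_real (int_dot k \<theta>))) * exp (- \<i> * of_real (int_dot m \<theta>)))
      = (LINT \<theta>|lebesgue_on pi_cube. (\<Sum>k\<in>K. c k * exp (\<i> * of_real (int_dot (k - m) \<theta>))))"
    unfolding sum_distrib_right mult.assoc e ..
  also have "\<dots> = (\<Sum>k\<in>K. c k * (LINT \<theta>|lebesgue_on pi_cube. exp (\<i> * of_real (int_dot (k - m) \<theta>))))"
    by (subst Bochner_Integration.integral_sum)
      (auto intro!: integrable_mult_right lebesgue_on_integral_continuous(2) continuous_intros)
  also have "\<dots> = (\<Sum>k\<in>K. if k = m then c k * of_real ((2 * pi) ^ CARD('d)) else 0)"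
    unfolding integral_exp_int_dot by (intro sum.cong) auto
  also have "\<dots> = (if m \<in> K then c m * of_real ((2 * pi) ^ CARD('d)) else 0)"
    using assms by simp
  finally show ?thesis by (simp add: fourier_coeff_def)
qed

section \<open>Riemann sums\<close>

lemma continuous_on_cube_bounded:
  fixes c :: "real ^ 'd::finite \<Rightarrow> complex"
  assumes "continuous_on unit_cube c"
  obtains B where "0 \<le> B" "\<And>x. x \<in> unit_cube \<Longrightarrow> cmod (c x) \<le> B"
proof -
  have "bounded (c ` unit_cube)"
    by (intro compact_imp_bounded compact_continuous_image assms) simp
  then obtain B where "\<And>x. x \<in> unit_cube \<Longrightarrow> cmod (c x) \<le> B"
    by (auto simp: bounded_iff)
  then show thesis using that[of "\<bar>B\<bar>"] by (meson abs_ge_self abs_ge_zero order_trans)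
qed

text \<open>For positive sizes, the half-open cell whose upper corner is
  \<open>grid_point n i\<close>. Clearing the denominators makes membership a statement about
  ceilings of \<open>n $ s * x $ s\<close>.\<close>

definition grid_cell :: "nat ^ 'd \<Rightarrow> int ^ 'd \<Rightarrow> (real ^ 'd) set" where
  "grid_cell n i = {x. \<forall>s. of_int (i $ s) < real (n $ s) * x $ s \<and> real (n $ s) * x $ s \<le> of_int (i $ s) + 1}"

lemma grid_cell_borel [measurable]: "grid_cell n (i :: int ^ 'd::finite) \<in> sets borel"
proof -
  have "grid_cell n i = (\<Inter>s. {x. of_int (i $ s) < real (n $ s) * x $ s} \<inter> {x. real (n $ s) * x $ s \<le> of_int (i $ s) + 1})"
    by (auto simp: grid_cell_def)
  also have "\<dots> \<in> sets borel"
    by (intro sets.countable_INT'' sets.Int borel_open borel_closed open_Collect_less closed_Collect_le continuous_intros) auto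
  finally show ?thesis .
qed

lemma emeasure_grid_cell:
  fixes n :: "nat ^ 'd::finite"
  assumes n: "\<And>s. 0 < n $ s"
  shows "emeasure lborel (grid_cell n i) = ennreal (1 / real (level_size n))"
proof -
  define l :: "real ^ 'd" where "l = (\<chi> s. of_int (i $ s) / real (n $ s))"
  define u :: "real ^ 'd" where "u = (\<chi> s. (of_int (i $ s) + 1) / real (n $ s))"
  have sub: "box l u \<subseteq> grid_cell n i" "grid_cell n i \<subseteq> cbox l u"
    using n by (auto simp: grid_cell_def l_def u_def mem_box_cart field_simps less_imp_le)
  have lu: "\<forall>b\<in>Basis. l \<bullet> b \<le> u \<bullet> b"
    using n by (auto simp: Basis_vec_def inner_axis l_def u_def divide_right_mono)
  have "emeasure lborel (box l u) = emeasure lborel (cbox l u)"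
    using lu by (simp add: emeasure_lborel_box_eq emeasure_lborel_cbox_eq)
  moreover have "emeasure lborel (cbox l u) = ennreal (1 / real (level_size n))"
  proof -
    have ne: "cbox l u \<noteq> {}" using lu by (simp add: box_ne_empty)
    have "measure lborel (cbox l u) = (\<Prod>s\<in>UNIV. u $ s - l $ s)"
      using ne by (simp add: content_cbox_if_cart)
    also have "\<dots> = (\<Prod>s\<in>UNIV. 1 / real (n $ s))"
      by (simp add: u_def l_def diff_divide_distrib[symmetric])
    also have "\<dots> = 1 / real (level_size n)"
      by (simp add: prod_dividef level_size_def)
    finally show ?thesis
      by (metis emeasure_eq_ennreal_measure emeasure_lborel_cbox_finite infinity_ennreal_def less_top)
  qed
  moreover have "emeasure lborel (box l u) \<le> emeasure lborel (grid_cell n i)"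
      "emeasure lborel (grid_cell n i) \<le> emeasure lborel (cbox l u)"
    using sub by (auto intro!: emeasure_mono)
  ultimately show ?thesis by simp
qed

definition half_open_cube :: "(real ^ 'd) set" where
  "half_open_cube = {x. \<forall>s. 0 < x $ s \<and> x $ s \<le> 1}"

lemma mem_grid_cell_iff:
  fixes n :: "nat ^ 'd::finite"
  assumes n: "\<And>s. 0 < n $ s"
  shows "x \<in> grid_cell n i \<longleftrightarrow> i = (\<chi> s. \<lceil>real (n $ s) * x $ s\<rceil> - 1)"
  unfolding grid_cell_def Finite_Cartesian_Product.vec_eq_iff
proof (simp, intro all_cong1)
  fix s
  show "(real_of_int (i $ s) < real (n $ s) * x $ s \<and> real (n $ s) * x $ s \<le> real_of_int (i $ s) + 1)
      \<longleftrightarrow> i $ s = \<lceil>real (n $ s) * x $ s\<rceil> - 1"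
    using ceiling_eq_iff[of "real (n $ s) * x $ s" "i $ s + 1"] by auto
qed

lemma ceiling_index_in_box_iff:
  fixes n :: "nat ^ 'd::finite"
  assumes n: "\<And>s. 0 < n $ s"
  shows "(\<chi> s. \<lceil>real (n $ s) * x $ s\<rceil> - 1) \<in> index_box n \<longleftrightarrow> x \<in> half_open_cube"
proof -
  have "(0 \<le> \<lceil>real (n $ s) * x $ s\<rceil> - 1 \<and> \<lceil>real (n $ s) * x $ s\<rceil> - 1 < int (n $ s)) \<longleftrightarrow> 0 < x $ s \<and> x $ s \<le> 1" for s
  proof -
    have "0 \<le> \<lceil>real (n $ s) * x $ s\<rceil> - 1 \<longleftrightarrow> 0 < real (n $ s) * x $ s" by linarith
    also have "\<dots> \<longleftrightarrow> 0 < x $ s" using n[of s] by (simp add: zero_less_mult_iff)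
    finally have 1: "0 \<le> \<lceil>real (n $ s) * x $ s\<rceil> - 1 \<longleftrightarrow> 0 < x $ s" .
    have "\<lceil>real (n $ s) * x $ s\<rceil> - 1 < int (n $ s) \<longleftrightarrow> real (n $ s) * x $ s \<le> real (n $ s)" by linarith
    also have "\<dots> \<longleftrightarrow> x $ s \<le> 1" using n[of s] by simp
    finally show ?thesis using 1 by simp
  qed
  then show ?thesis by (simp add: index_box_def half_open_cube_def)
qed

lemma eventually_all_levels:
  fixes n :: "nat \<Rightarrow> nat ^ 'd::finite"
  assumes "\<And>s. filterlim (\<lambda>k. n k $ s) at_top sequentially"
  shows "\<forall>\<^sub>F k in sequentially. \<forall>s. b \<le> n k $ s"
  using assms by (intro eventually_all_finite) (auto simp: filterlim_at_top)

lemma negligible_cube_boundary: "negligible (unit_cube - half_open_cube :: (real ^ 'd::finite) set)"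
proof (rule negligible_subset)
  show "negligible (cbox 0 1 - box 0 1 :: (real ^ 'd) set)" by (rule negligible_frontier_interval)
  show "unit_cube - half_open_cube \<subseteq> (cbox 0 1 - box 0 1 :: (real ^ 'd) set)"
    by (auto simp: half_open_cube_def mem_box_cart less_imp_le)
qed

text \<open>The sum is the integral of the step function \<open>g k\<close>, which takes at a point
  of the half-open cube the value of \<open>c\<close> at that point rounded up to the grid.
  Continuity of \<open>c\<close> gives pointwise convergence, and a bound of \<open>c\<close> on the
  cube dominates.\<close>

theorem riemann_sum_tendsto:
  fixes n :: "nat \<Rightarrow> nat ^ 'd::finite" and c :: "real ^ 'd \<Rightarrow> complex"
  assumes lim: "\<And>s. filterlim (\<lambda>k. n k $ s) at_top sequentially" and c: "continuous_on unit_cube c"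
  shows "(\<lambda>k. (\<Sum>i\<in>index_box (n k). c (grid_point (n k) i)) / of_nat (level_size (n k)))
    \<longlonglongrightarrow> (LINT x|lebesgue_on unit_cube. c x)"
proof -
  obtain B where B: "0 \<le> B" "\<And>x. x \<in> unit_cube \<Longrightarrow> cmod (c x) \<le> B"
    using continuous_on_cube_bounded[OF c] by metis
  define g where "g k x = (if \<forall>s. 0 < n k $ s then \<Sum>i\<in>index_box (n k). indicator (grid_cell (n k) i) x *\<^sub>R c (grid_point (n k) i) else 0)" for k x
  have g: "g k x = indicator half_open_cube x *\<^sub>R c (\<chi> s. of_int \<lceil>real (n k $ s) * x $ s\<rceil> / real (n k $ s))"
    if n: "\<And>s. 0 < n k $ s" for k x
  proof -
    define j where "j = (\<chi> s. \<lceil>real (n k $ s) * x $ s\<rceil> - 1)"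
    have ind: "indicator (grid_cell (n k) i) x *\<^sub>R c (grid_point (n k) i) = (if i = j then c (grid_point (n k) i) else 0)" for i
      using mem_grid_cell_iff[OF n, where x = x] by (auto simp: j_def indicator_def)
    have "g k x = (\<Sum>i\<in>index_box (n k). if i = j then c (grid_point (n k) i) else 0)"
      unfolding g_def ind using n by auto
    also have "\<dots> = (if j \<in> index_box (n k) then c (grid_point (n k) j) else 0)"
      by simp
    also have "\<dots> = indicator half_open_cube x *\<^sub>R c (grid_point (n k) j)"
      using ceiling_index_in_box_iff[OF n, of x] by (auto simp: j_def)
    also have "grid_point (n k) j = (\<chi> s. of_int \<lceil>real (n k $ s) * x $ s\<rceil> / real (n k $ s))"
      by (simp add: grid_point_def j_def)
    finally show ?thesis .
  qed
  have int: "integral\<^sup>L lborel (g k) = (\<Sum>i\<in>index_box (n k). c (grid_point (n k) i)) / of_nat (level_size (n k))"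
    if n: "\<And>s. 0 < n k $ s" for k
  proof -
    have fin: "emeasure lborel (grid_cell (n k) i) < \<infinity>" for i
      using emeasure_grid_cell[OF n] by simp
    have m: "measure lborel (grid_cell (n k) i) = 1 / real (level_size (n k))" for i
      using emeasure_grid_cell[OF n] by (simp add: measure_def)
    have geq: "g k = (\<lambda>x. \<Sum>i\<in>index_box (n k). indicator (grid_cell (n k) i) x *\<^sub>R c (grid_point (n k) i))"
      by (rule ext) (simp add: g_def n)
    have "integral\<^sup>L lborel (g k) = (\<Sum>i\<in>index_box (n k). LINT x|lborel. indicator (grid_cell (n k) i) x *\<^sub>R c (grid_point (n k) i))"
      unfolding geq using fin by (intro Bochner_Integration.integral_sum integrable_scaleR_left integrable_real_indicator) auto
    also have "\<dots> = (\<Sum>i\<in>index_box (n k). (1 / real (level_size (n k))) *\<^sub>R c (grid_point (n k) i))"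
      using fin by (intro sum.cong refl) (simp add: m integrable_indicator_iff)
    also have "\<dots> = (\<Sum>i\<in>index_box (n k). c (grid_point (n k) i)) / of_nat (level_size (n k))"
      by (simp add: scaleR_conv_of_real sum_distrib_left divide_inverse mult.commute)
    finally show ?thesis .
  qed
  have "(\<lambda>k. integral\<^sup>L lborel (g k)) \<longlonglongrightarrow> (LINT x|lborel. indicator half_open_cube x *\<^sub>R c x)"
  proof (rule integral_dominated_convergence[where w = "\<lambda>x. indicator unit_cube x *\<^sub>R B"])
    have hb: "half_open_cube \<in> sets (borel :: (real ^ 'd) measure)"
    proof -
      have "(half_open_cube :: (real ^ 'd) set) = (\<Inter>s. {x. 0 < x $ s} \<inter> {x. x $ s \<le> 1})"
        by (auto simp: half_open_cube_def)
      also have "\<dots> \<in> sets borel"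
        by (intro sets.countable_INT'' sets.Int borel_open borel_closed open_Collect_less closed_Collect_le continuous_intros) auto
      finally show ?thesis .
    qed
    have sub: "half_open_cube \<subseteq> (unit_cube :: (real ^ 'd) set)"
      by (auto simp: half_open_cube_def mem_unit_cube less_imp_le)
    show "(\<lambda>x. indicator half_open_cube x *\<^sub>R c x) \<in> borel_measurable lborel"
      using borel_measurable_continuous_on_indicator[OF hb continuous_on_subset[OF c sub]] by simp
    show "g k \<in> borel_measurable lborel" for k
    proof -
      have "(\<lambda>x. \<Sum>i\<in>index_box (n k). indicator (grid_cell (n k) i) x *\<^sub>R c (grid_point (n k) i)) \<in> borel_measurable lborel"
        by (intro borel_measurable_sum borel_measurable_scaleR borel_measurable_const borel_measurable_indicator) auto
      then show ?thesis by (cases "\<forall>s. 0 < n k $ s") (auto simp: g_def[abs_def])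
    qed
    show "integrable lborel (\<lambda>x. indicator unit_cube x *\<^sub>R B)"
      by (intro integrable_scaleR_left integrable_real_indicator emeasure_lborel_cbox_finite) simp
    show "AE x in lborel. (\<lambda>k. g k x) \<longlonglongrightarrow> indicator half_open_cube x *\<^sub>R c x"
    proof (rule AE_I2)
      fix x :: "real ^ 'd"
      have ev: "\<forall>\<^sub>F k in sequentially. \<forall>s. 0 < n k $ s"
        using eventually_all_levels[OF lim, of 1] by (simp add: Suc_le_eq)
      show "(\<lambda>k. g k x) \<longlonglongrightarrow> indicator half_open_cube x *\<^sub>R c x"
      proof (cases "x \<in> half_open_cube")
        case False
        have "\<forall>\<^sub>F k in sequentially. g k x = 0"
          using ev by eventually_elim (use False in \<open>simp add: g\<close>)
        then show ?thesis using False by (simp add: tendsto_eventually)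
      next
        case True
        define y where "y k = (\<chi> s. of_int \<lceil>real (n k $ s) * x $ s\<rceil> / real (n k $ s))" for k
        have ylim: "y \<longlonglongrightarrow> x"
        proof (rule vec_tendstoI)
          fix s
          have nlim: "(\<lambda>k. 1 / real (n k $ s)) \<longlonglongrightarrow> 0"
            using filterlim_compose[OF filterlim_real_sequentially lim[of s]]
            by (intro tendsto_divide_0[OF tendsto_const] filterlim_at_top_imp_at_infinity)
          show "(\<lambda>k. y k $ s) \<longlonglongrightarrow> x $ s"
          proof (rule LIM_zero_cancel, rule Lim_null_comparison[OF _ nlim])
            show "\<forall>\<^sub>F k in sequentially. norm (y k $ s - x $ s) \<le> 1 / real (n k $ s)"
              using ev
            proof eventually_elim
              case (elim k)
              then have p: "0 < real (n k $ s)" by simp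
              have "y k $ s - x $ s = (of_int \<lceil>real (n k $ s) * x $ s\<rceil> - real (n k $ s) * x $ s) / real (n k $ s)"
                using p by (simp add: y_def field_simps)
              moreover have "\<bar>of_int \<lceil>real (n k $ s) * x $ s\<rceil> - real (n k $ s) * x $ s\<bar> \<le> 1" by linarith
              ultimately show ?case using p by (simp add: abs_divide divide_right_mono)
            qed
          qed
        qed
        have yin: "\<forall>\<^sub>F k in sequentially. y k \<in> unit_cube"
          using ev
        proof eventually_elim
          case (elim k)
          then have "y k = grid_point (n k) (\<chi> s. \<lceil>real (n k $ s) * x $ s\<rceil> - 1)"
            by (simp add: y_def grid_point_def)
          then show ?case
            using grid_point_in_cube ceiling_index_in_box_iff[of "n k" x] elim True by auto
        qed
        have "(\<lambda>k. c (y k)) \<longlonglongrightarrow> c x"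
          by (rule continuous_on_tendsto_compose[OF c ylim _ yin]) (use True sub in auto)
        moreover have "\<forall>\<^sub>F k in sequentially. g k x = c (y k)"
          using ev by eventually_elim (use True in \<open>simp add: g y_def\<close>)
        ultimately show ?thesis using True by (simp add: tendsto_cong)
      qed
    qed
    show "AE x in lborel. norm (g k x) \<le> indicator unit_cube x *\<^sub>R B" for k
    proof (rule AE_I2)
      fix x :: "real ^ 'd"
      show "norm (g k x) \<le> indicator unit_cube x *\<^sub>R B"
      proof (cases "(\<forall>s. 0 < n k $ s) \<and> x \<in> half_open_cube")
        case True
        then have "(\<chi> s. of_int \<lceil>real (n k $ s) * x $ s\<rceil> / real (n k $ s)) = grid_point (n k) (\<chi> s. \<lceil>real (n k $ s) * x $ s\<rceil> - 1)"
          by (simp add: grid_point_def)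
        then have "(\<chi> s. of_int \<lceil>real (n k $ s) * x $ s\<rceil> / real (n k $ s)) \<in> (unit_cube :: (real ^ 'd) set)"
          using grid_point_in_cube ceiling_index_in_box_iff[of "n k" x] True by auto
        then show ?thesis using B(2) True sub by (auto simp: g)
      next
        case False
        have "g k x = 0"
        proof (cases "\<forall>s. 0 < n k $ s")
          case True
          then show ?thesis using False by (simp add: g)
        next
          case False
          then show ?thesis by (simp only: g_def if_False)
        qed
        then show ?thesis using B(1) by simp
      qed
    qed
  qed
  \<comment> \<open>The cells cover the half-open cube; the missing faces form a null set.\<close>
  moreover have "(LINT x|lborel. indicator half_open_cube x *\<^sub>R c x) = (LINT x|lebesgue_on unit_cube. c x)"
  proof -
    have sub: "half_open_cube \<subseteq> (unit_cube :: (real ^ 'd) set)"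
      by (auto simp: half_open_cube_def mem_unit_cube less_imp_le)
    have hb: "half_open_cube \<in> sets (borel :: (real ^ 'd) measure)"
    proof -
      have "(half_open_cube :: (real ^ 'd) set) = (\<Inter>s. {x. 0 < x $ s} \<inter> {x. x $ s \<le> 1})"
        by (auto simp: half_open_cube_def)
      also have "\<dots> \<in> sets borel"
        by (intro sets.countable_INT'' sets.Int borel_open borel_closed open_Collect_less closed_Collect_le continuous_intros) auto
      finally show ?thesis .
    qed
    have "AE x in lborel. x \<notin> (unit_cube - half_open_cube :: (real ^ 'd) set)"
    proof (rule AE_not_in)
      have "(unit_cube - half_open_cube :: (real ^ 'd) set) \<in> sets lborel" using hb by simp
      then show "(unit_cube - half_open_cube :: (real ^ 'd) set) \<in> null_sets lborel"
        using negligible_cube_boundary[where 'd = 'd] by (metis negligible_iff_null_sets null_sets_completion_iff)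
    qed
    then have "(LINT x|lborel. indicator half_open_cube x *\<^sub>R c x) = (LINT x|lborel. indicator unit_cube x *\<^sub>R c x)"
    proof (intro integral_cong_AE)
      show "(\<lambda>x. indicator half_open_cube x *\<^sub>R c x) \<in> borel_measurable lborel"
        using borel_measurable_continuous_on_indicator[OF hb continuous_on_subset[OF c sub]] by simp
      show "(\<lambda>x. indicator unit_cube x *\<^sub>R c x) \<in> borel_measurable lborel"
        using borel_measurable_continuous_on_indicator[OF _ c] by simp
      assume "AE x in lborel. x \<notin> (unit_cube - half_open_cube :: (real ^ 'd) set)"
      then show "AE x in lborel. indicator half_open_cube x *\<^sub>R c x = indicator unit_cube x *\<^sub>R c x"
        by eventually_elim (use sub in \<open>auto simp: indicator_def\<close>)
    qed
    then show ?thesis using lebesgue_on_integral_continuous(1)[OF _ c] by simp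
  qed
  moreover have "\<forall>\<^sub>F k in sequentially. integral\<^sup>L lborel (g k) = (\<Sum>i\<in>index_box (n k). c (grid_point (n k) i)) / of_nat (level_size (n k))"
    using eventually_all_levels[OF lim, of 1] by eventually_elim (simp add: int Suc_le_eq)
  ultimately show ?thesis by (simp add: tendsto_cong)
qed

section \<open>Approximation in the mean along the diagonals\<close>

text \<open>Here \<open>u k\<close> is meant to be one diagonal of the \<open>k\<close>-th matrix.
  The approximation is in the mean because products of matrices lose terms near the boundary of the
  index box, where the entries stay wrong but are a vanishing fraction. The uniform bound is what
  makes the notion stable under products.\<close>

definition mean_approx :: "(nat \<Rightarrow> nat ^ 'd::finite) \<Rightarrow> (nat \<Rightarrow> int ^ 'd \<Rightarrow> complex) \<Rightarrow> (real ^ 'd \<Rightarrow> complex) \<Rightarrow> bool" where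
  "mean_approx n u c \<longleftrightarrow> continuous_on unit_cube c \<and> (\<exists>B. \<forall>k i. cmod (u k i) \<le> B) \<and>
     (\<lambda>k. (\<Sum>i\<in>index_box (n k). cmod (u k i - c (grid_point (n k) i))) / real (level_size (n k))) \<longlonglongrightarrow> 0"

lemma mean_approx_null:
  "(\<And>k i. i \<in> index_box (n k) \<Longrightarrow> u k i = c (grid_point (n k) i)) \<Longrightarrow> continuous_on unit_cube c \<Longrightarrow>
    (\<And>k i. i \<notin> index_box (n k) \<Longrightarrow> u k i = 0) \<Longrightarrow> mean_approx n u c"
proof -
  assume *: "\<And>k i. i \<in> index_box (n k) \<Longrightarrow> u k i = c (grid_point (n k) i)" "continuous_on unit_cube c"
    "\<And>k i. i \<notin> index_box (n k) \<Longrightarrow> u k i = 0"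
  obtain B where "0 \<le> B" "\<And>x. x \<in> unit_cube \<Longrightarrow> cmod (c x) \<le> B"
    using continuous_on_cube_bounded[OF *(2)] by metis
  then have "cmod (u k i) \<le> B" for k i
    using * by (cases "i \<in> index_box (n k)") (auto simp: grid_point_in_cube)
  then show ?thesis using * by (auto simp: mean_approx_def)
qed

lemma mean_approx_mult:
  assumes u: "mean_approx n u c" and v: "mean_approx n v d"
  shows "mean_approx n (\<lambda>k i. u k i * v k i) (\<lambda>x. c x * d x)"
proof -
  obtain Bu where Bu: "\<And>k i. cmod (u k i) \<le> Bu" using u by (auto simp: mean_approx_def)
  obtain Bv where Bv: "\<And>k i. cmod (v k i) \<le> Bv" using v by (auto simp: mean_approx_def)
  have c: "continuous_on unit_cube c" "continuous_on unit_cube d" using u v by (auto simp: mean_approx_def)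
  obtain C where C: "0 \<le> C" "\<And>x. x \<in> unit_cube \<Longrightarrow> cmod (c x) \<le> C"
    using continuous_on_cube_bounded[OF c(1)] by metis
  define S where "S u c k = (\<Sum>i\<in>index_box (n k). cmod (u k i - c (grid_point (n k) i))) / real (level_size (n k))" for u :: "nat \<Rightarrow> int ^ 'a \<Rightarrow> complex" and c k
  have S: "S u c \<longlonglongrightarrow> 0" "S v d \<longlonglongrightarrow> 0" using u v by (simp_all add: mean_approx_def S_def[abs_def])
  have "(\<lambda>k. Bv * S u c k + C * S v d k) \<longlonglongrightarrow> Bv * 0 + C * 0"
    by (intro tendsto_intros S)
  then have lim: "(\<lambda>k. Bv * S u c k + C * S v d k) \<longlonglongrightarrow> 0" by simp
  have "S (\<lambda>k i. u k i * v k i) (\<lambda>x. c x * d x) \<longlonglongrightarrow> 0"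
  proof (rule Lim_null_comparison[OF always_eventually lim], rule allI)
    fix k
    have "(\<Sum>i\<in>index_box (n k). cmod (u k i * v k i - c (grid_point (n k) i) * d (grid_point (n k) i)))
        \<le> (\<Sum>i\<in>index_box (n k). Bv * cmod (u k i - c (grid_point (n k) i)) + C * cmod (v k i - d (grid_point (n k) i)))"
    proof (rule sum_mono)
      fix i assume i: "i \<in> index_box (n k)"
      let ?x = "grid_point (n k) i"
      have "u k i * v k i - c ?x * d ?x = v k i * (u k i - c ?x) + c ?x * (v k i - d ?x)"
        by (simp add: algebra_simps)
      then have "cmod (u k i * v k i - c ?x * d ?x) \<le> cmod (v k i) * cmod (u k i - c ?x) + cmod (c ?x) * cmod (v k i - d ?x)"
        by (metis norm_mult norm_triangle_ineq)
      also have "\<dots> \<le> Bv * cmod (u k i - c ?x) + C * cmod (v k i - d ?x)"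
        using Bv C(2)[OF grid_point_in_cube[OF i]] by (intro add_mono mult_right_mono) auto
      finally show "cmod (u k i * v k i - c ?x * d ?x) \<le> Bv * cmod (u k i - c ?x) + C * cmod (v k i - d ?x)" .
    qed
    also have "\<dots> = Bv * (\<Sum>i\<in>index_box (n k). cmod (u k i - c (grid_point (n k) i))) + C * (\<Sum>i\<in>index_box (n k). cmod (v k i - d (grid_point (n k) i)))"
      by (simp add: sum.distrib sum_distrib_left)
    finally have "S (\<lambda>k i. u k i * v k i) (\<lambda>x. c x * d x) k \<le> Bv * S u c k + C * S v d k"
      unfolding S_def times_divide_eq_right add_divide_distrib[symmetric] by (rule divide_right_mono) simp
    then show "norm (S (\<lambda>k i. u k i * v k i) (\<lambda>x. c x * d x) k) \<le> Bv * S u c k + C * S v d k"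
      by (simp add: S_def sum_nonneg)
  qed
  moreover have "cmod (u k i * v k i) \<le> Bu * Bv" for k i
    unfolding norm_mult using Bu Bv by (intro mult_mono) (auto intro: order_trans[OF norm_ge_zero])
  ultimately show ?thesis
    unfolding mean_approx_def S_def[abs_def] using c by (blast intro: continuous_on_mult)
qed

lemma mean_approx_sum:
  assumes "finite K" "\<And>m. m \<in> K \<Longrightarrow> mean_approx n (u m) (c m)"
  shows "mean_approx n (\<lambda>k i. \<Sum>m\<in>K. u m k i) (\<lambda>x. \<Sum>m\<in>K. c m x)"
proof -
  have "\<exists>B. \<forall>k i. cmod (\<Sum>m\<in>K. u m k i) \<le> B"
  proof -
    have "\<forall>m\<in>K. \<exists>B. \<forall>k i. cmod (u m k i) \<le> B" using assms by (auto simp: mean_approx_def)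
    then obtain B where "\<And>m k i. m \<in> K \<Longrightarrow> cmod (u m k i) \<le> B m" by metis
    then show ?thesis by (intro exI[of _ "sum B K"] allI sum_norm_le) auto
  qed
  moreover have "(\<lambda>k. (\<Sum>i\<in>index_box (n k). cmod ((\<Sum>m\<in>K. u m k i) - (\<Sum>m\<in>K. c m (grid_point (n k) i)))) / real (level_size (n k))) \<longlonglongrightarrow> 0"
  proof (rule Lim_null_comparison[OF always_eventually])
    have "(\<lambda>k. \<Sum>m\<in>K. (\<Sum>i\<in>index_box (n k). cmod (u m k i - c m (grid_point (n k) i))) / real (level_size (n k))) \<longlonglongrightarrow> (\<Sum>m\<in>K. 0)"
      using assms by (intro tendsto_sum) (auto simp: mean_approx_def)
    then show "(\<lambda>k. \<Sum>m\<in>K. (\<Sum>i\<in>index_box (n k). cmod (u m k i - c m (grid_point (n k) i))) / real (level_size (n k))) \<longlonglongrightarrow> 0" by simp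
    show "\<forall>k. norm ((\<Sum>i\<in>index_box (n k). cmod ((\<Sum>m\<in>K. u m k i) - (\<Sum>m\<in>K. c m (grid_point (n k) i)))) / real (level_size (n k)))
      \<le> (\<Sum>m\<in>K. (\<Sum>i\<in>index_box (n k). cmod (u m k i - c m (grid_point (n k) i))) / real (level_size (n k)))"
    proof
      fix k
      have "(\<Sum>i\<in>index_box (n k). cmod ((\<Sum>m\<in>K. u m k i) - (\<Sum>m\<in>K. c m (grid_point (n k) i))))
        \<le> (\<Sum>i\<in>index_box (n k). \<Sum>m\<in>K. cmod (u m k i - c m (grid_point (n k) i)))"
        by (intro sum_mono) (simp add: sum_subtractf[symmetric] norm_sum)
      also have "\<dots> = (\<Sum>m\<in>K. \<Sum>i\<in>index_box (n k). cmod (u m k i - c m (grid_point (n k) i)))"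
        by (rule sum.swap)
      finally show "norm ((\<Sum>i\<in>index_box (n k). cmod ((\<Sum>m\<in>K. u m k i) - (\<Sum>m\<in>K. c m (grid_point (n k) i)))) / real (level_size (n k)))
      \<le> (\<Sum>m\<in>K. (\<Sum>i\<in>index_box (n k). cmod (u m k i - c m (grid_point (n k) i))) / real (level_size (n k)))"
        by (simp add: sum_nonneg sum_divide_distrib[symmetric] divide_right_mono)
    qed
  qed
  ultimately show ?thesis
    using assms by (auto simp: mean_approx_def intro!: continuous_intros)
qed

lemma mean_approx_cnj:
  assumes "mean_approx n u c"
  shows "mean_approx n (\<lambda>k i. cnj (u k i)) (\<lambda>x. cnj (c x))"
proof -
  have "cmod (cnj a - cnj b) = cmod (a - b)" for a b
    by (metis complex_cnj_diff complex_mod_cnj)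
  then show ?thesis using assms by (auto simp: mean_approx_def intro!: continuous_intros)
qed

text \<open>In each coordinate, \<open>{0..<n}\<close> meets its translate by \<open>m\<close> in an
  interval of length \<open>n - \<bar>m\<bar>\<close> that starts at \<open>max 0 m\<close>, or not
  at all; in the second case \<open>nat\<close> supplies the size 0.\<close>

lemma index_box_inter_translate:
  fixes n :: "nat ^ 'd::finite"
  shows "card {i \<in> index_box n. i - m \<in> index_box n} = level_size (\<chi> s. nat (int (n $ s) - \<bar>m $ s\<bar>))"
proof -
  have "{i \<in> index_box n. i - m \<in> index_box n}
      = (\<lambda>j. j + (\<chi> s. max 0 (m $ s))) ` index_box (\<chi> s. nat (int (n $ s) - \<bar>m $ s\<bar>))"
  proof (intro equalityI subsetI)
    fix i assume i: "i \<in> {i \<in> index_box n. i - m \<in> index_box n}"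
    have "i - (\<chi> s. max 0 (m $ s)) \<in> index_box (\<chi> s. nat (int (n $ s) - \<bar>m $ s\<bar>))"
      unfolding index_box_def
    proof (rule CollectI, rule allI)
      fix s
      have "0 \<le> i $ s" "i $ s < int (n $ s)" "0 \<le> i $ s - m $ s" "i $ s - m $ s < int (n $ s)"
        using i by (auto simp: index_box_def)
      then show "0 \<le> (i - (\<chi> s. max 0 (m $ s))) $ s \<and> (i - (\<chi> s. max 0 (m $ s))) $ s < int ((\<chi> s. nat (int (n $ s) - \<bar>m $ s\<bar>)) $ s)"
        by auto
    qed
    moreover have "i = (i - (\<chi> s. max 0 (m $ s))) + (\<chi> s. max 0 (m $ s))" by simp
    ultimately show "i \<in> (\<lambda>j. j + (\<chi> s. max 0 (m $ s))) ` index_box (\<chi> s. nat (int (n $ s) - \<bar>m $ s\<bar>))" by blast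
  next
    fix i assume "i \<in> (\<lambda>j. j + (\<chi> s. max 0 (m $ s))) ` index_box (\<chi> s. nat (int (n $ s) - \<bar>m $ s\<bar>))"
    then obtain j where j: "j \<in> index_box (\<chi> s. nat (int (n $ s) - \<bar>m $ s\<bar>))" "i = j + (\<chi> s. max 0 (m $ s))" by auto
    have "0 \<le> i $ s \<and> i $ s < int (n $ s) \<and> 0 \<le> i $ s - m $ s \<and> i $ s - m $ s < int (n $ s)" for s
    proof -
      have "0 \<le> j $ s" "j $ s < int (nat (int (n $ s) - \<bar>m $ s\<bar>))" using j(1) by (auto simp: index_box_def)
      then have "0 \<le> j $ s" "j $ s < int (n $ s) - \<bar>m $ s\<bar>" by (auto split: if_splits)
      then show ?thesis unfolding j(2) by (auto simp: max_def abs_if split: if_splits)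
    qed
    then show "i \<in> {i \<in> index_box n. i - m \<in> index_box n}" by (auto simp: index_box_def)
  qed
  then show ?thesis by (simp add: card_image inj_on_def card_index_box)
qed

lemma boundary_fraction_tendsto_0:
  fixes n :: "nat \<Rightarrow> nat ^ 'd::finite"
  assumes lim: "\<And>s. filterlim (\<lambda>k. n k $ s) at_top sequentially"
  shows "(\<lambda>k. real (card {i \<in> index_box (n k). i - m \<notin> index_box (n k)}) / real (level_size (n k))) \<longlonglongrightarrow> 0"
proof -
  have r: "(\<lambda>k. real (nat (int (n k $ s) - \<bar>m $ s\<bar>)) / real (n k $ s)) \<longlonglongrightarrow> 1" for s
  proof -
    have "(\<lambda>k. of_int \<bar>m $ s\<bar> / real (n k $ s)) \<longlonglongrightarrow> 0"
      using filterlim_compose[OF filterlim_real_sequentially lim[of s]]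
      by (intro tendsto_divide_0[OF tendsto_const] filterlim_at_top_imp_at_infinity)
    then have "(\<lambda>k. 1 - of_int \<bar>m $ s\<bar> / real (n k $ s)) \<longlonglongrightarrow> 1 - 0"
      by (intro tendsto_intros)
    moreover have "\<forall>\<^sub>F k in sequentially. 1 - of_int \<bar>m $ s\<bar> / real (n k $ s) = real (nat (int (n k $ s) - \<bar>m $ s\<bar>)) / real (n k $ s)"
    proof -
      have "\<forall>\<^sub>F k in sequentially. nat \<bar>m $ s\<bar> + 1 \<le> n k $ s" using lim[of s] by (auto simp: filterlim_at_top)
      then show ?thesis
      proof eventually_elim
        case (elim k)
        then have "real (nat (int (n k $ s) - \<bar>m $ s\<bar>)) = real (n k $ s) - of_int \<bar>m $ s\<bar>" "real (n k $ s) > 0" by auto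
        then show ?case by (simp add: field_simps)
      qed
    qed
    ultimately show ?thesis by (simp add: tendsto_cong)
  qed
  have "(\<lambda>k. \<Prod>s\<in>UNIV. real (nat (int (n k $ s) - \<bar>m $ s\<bar>)) / real (n k $ s)) \<longlonglongrightarrow> (\<Prod>s\<in>(UNIV::'d set). 1)"
    by (intro tendsto_prod r)
  then have "(\<lambda>k. 1 - (\<Prod>s\<in>UNIV. real (nat (int (n k $ s) - \<bar>m $ s\<bar>)) / real (n k $ s))) \<longlonglongrightarrow> 1 - 1"
    by (intro tendsto_intros) simp
  moreover have "\<forall>\<^sub>F k in sequentially. 1 - (\<Prod>s\<in>UNIV. real (nat (int (n k $ s) - \<bar>m $ s\<bar>)) / real (n k $ s))
      = real (card {i \<in> index_box (n k). i - m \<notin> index_box (n k)}) / real (level_size (n k))"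
    using eventually_all_levels[OF lim, of 1]
  proof eventually_elim
    case (elim k)
    then have pos: "level_size (n k) > 0" by (auto simp: level_size_def Suc_le_eq)
    have "card {i \<in> index_box (n k). i - m \<in> index_box (n k)} + card {i \<in> index_box (n k). i - m \<notin> index_box (n k)} = level_size (n k)"
      unfolding card_index_box[symmetric]
      by (subst card_Un_disjoint[symmetric]) (auto intro!: arg_cong[of _ _ card])
    then have "real (card {i \<in> index_box (n k). i - m \<notin> index_box (n k)})
        = real (level_size (n k)) - (\<Prod>s\<in>UNIV. real (nat (int (n k $ s) - \<bar>m $ s\<bar>)))"
      unfolding index_box_inter_translate by (simp add: level_size_def flip: of_nat_prod)
    then show ?case using pos by (simp add: prod_dividef diff_divide_distrib level_size_def)
  qed
  ultimately show ?thesis by (simp add: tendsto_cong)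
qed


text \<open>The grid point moves by \<open>m / n\<close> in each coordinate, which uniform
  continuity of \<open>c\<close> absorbs. The rows where the shift leaves the box are replaced by 0;
  they are a vanishing fraction, and \<open>c\<close> is bounded there.\<close>

lemma mean_approx_shift:
  fixes n :: "nat \<Rightarrow> nat ^ 'd::finite"
  assumes lim: "\<And>s. filterlim (\<lambda>k. n k $ s) at_top sequentially" and u: "mean_approx n u c"
  shows "mean_approx n (\<lambda>k i. if i - m \<in> index_box (n k) then u k (i - m) else 0) c"
proof -
  have c: "continuous_on unit_cube c" using u by (simp add: mean_approx_def)
  obtain Bu where Bu: "\<And>k i. cmod (u k i) \<le> Bu" using u by (auto simp: mean_approx_def)
  obtain C where C: "0 \<le> C" "\<And>x. x \<in> unit_cube \<Longrightarrow> cmod (c x) \<le> C"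
    using continuous_on_cube_bounded[OF c] by metis
  have uc: "uniformly_continuous_on unit_cube c"
    by (rule compact_uniformly_continuous[OF c]) simp
  define u' where "u' k i = (if i - m \<in> index_box (n k) then u k (i - m) else 0)" for k i
  define S where "S k = (\<Sum>i\<in>index_box (n k). cmod (u k i - c (grid_point (n k) i))) / real (level_size (n k))" for k
  define T where "T k = real (card {i \<in> index_box (n k). i - m \<notin> index_box (n k)}) / real (level_size (n k))" for k
  define S' where "S' k = (\<Sum>i\<in>index_box (n k). cmod (u' k i - c (grid_point (n k) i))) / real (level_size (n k))" for k
  have S: "S \<longlonglongrightarrow> 0" using u by (simp add: mean_approx_def S_def[abs_def])
  have T: "T \<longlonglongrightarrow> 0" unfolding T_def[abs_def] by (rule boundary_fraction_tendsto_0[OF lim])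
  have "S' \<longlonglongrightarrow> 0"
  proof (rule LIMSEQ_I)
    fix r :: real assume r: "0 < r"
    obtain \<delta> where \<delta>: "0 < \<delta>" "\<And>x y. x \<in> unit_cube \<Longrightarrow> y \<in> unit_cube \<Longrightarrow> dist y x < \<delta> \<Longrightarrow> dist (c y) (c x) < r / 2"
      using uc r unfolding uniformly_continuous_on_def by (metis half_gt_zero)
    have "(\<lambda>k. \<Sum>s\<in>UNIV. \<bar>of_int (m $ s)\<bar> / real (n k $ s)) \<longlonglongrightarrow> (\<Sum>s\<in>(UNIV :: 'd set). 0)"
      by (intro tendsto_sum tendsto_divide_0[OF tendsto_const] filterlim_at_top_imp_at_infinity
          filterlim_compose[OF filterlim_real_sequentially lim])
    then have e1: "\<forall>\<^sub>F k in sequentially. (\<Sum>s\<in>UNIV. \<bar>of_int (m $ s)\<bar> / real (n k $ s)) < \<delta>"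
      using \<delta>(1) by (auto dest: order_tendstoD(2))
    have "(\<lambda>k. S k + C * T k) \<longlonglongrightarrow> 0 + C * 0" by (intro tendsto_intros S T)
    then have e2: "\<forall>\<^sub>F k in sequentially. S k + C * T k < r / 2"
      using r by (auto dest: order_tendstoD(2)[of _ _ _ "r / 2"])
    have "\<forall>\<^sub>F k in sequentially. norm (S' k - 0) < r"
      using e1 e2 eventually_all_levels[OF lim, of 1]
    proof eventually_elim
      case (elim k)
      have pos: "real (level_size (n k)) > 0" using elim(3) by (auto simp: level_size_def Suc_le_eq intro!: prod_pos)
      let ?I = "{i \<in> index_box (n k). i - m \<in> index_box (n k)}"
      let ?J = "{i \<in> index_box (n k). i - m \<notin> index_box (n k)}"
      have "(\<Sum>i\<in>index_box (n k). cmod (u' k i - c (grid_point (n k) i)))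
          = (\<Sum>i\<in>?I. cmod (u k (i - m) - c (grid_point (n k) i))) + (\<Sum>i\<in>?J. cmod (c (grid_point (n k) i)))"
      proof -
        have "index_box (n k) = ?I \<union> ?J" by auto
        then have "(\<Sum>i\<in>index_box (n k). cmod (u' k i - c (grid_point (n k) i)))
            = (\<Sum>i\<in>?I \<union> ?J. cmod (u' k i - c (grid_point (n k) i)))" by simp
        also have "\<dots> = (\<Sum>i\<in>?I. cmod (u' k i - c (grid_point (n k) i))) + (\<Sum>i\<in>?J. cmod (u' k i - c (grid_point (n k) i)))"
          by (rule sum.union_disjoint) auto
        finally show ?thesis by (simp add: u'_def)
      qed
      also have "(\<Sum>i\<in>?J. cmod (c (grid_point (n k) i))) \<le> (\<Sum>i\<in>?J. C)"
        by (intro sum_mono C grid_point_in_cube) auto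
      also have "(\<Sum>i\<in>?J. C) = C * real (card ?J)" by simp
      also have "(\<Sum>i\<in>?I. cmod (u k (i - m) - c (grid_point (n k) i)))
          \<le> (\<Sum>i\<in>?I. cmod (u k (i - m) - c (grid_point (n k) (i - m))) + r / 2)"
      proof (rule sum_mono)
        fix i assume i: "i \<in> ?I"
        have "dist (grid_point (n k) (i - m)) (grid_point (n k) i) \<le> (\<Sum>s\<in>UNIV. \<bar>(grid_point (n k) (i - m) - grid_point (n k) i) $ s\<bar>)"
          unfolding dist_norm by (rule norm_le_l1_cart)
        also have "\<dots> = (\<Sum>s\<in>UNIV. \<bar>of_int (m $ s)\<bar> / real (n k $ s))"
          by (simp add: grid_point_def diff_divide_distrib[symmetric] abs_divide)
        also have "\<dots> < \<delta>" by (rule elim(1))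
        finally have "dist (c (grid_point (n k) (i - m))) (c (grid_point (n k) i)) < r / 2"
          using i by (intro \<delta>(2) grid_point_in_cube) auto
        then show "cmod (u k (i - m) - c (grid_point (n k) i)) \<le> cmod (u k (i - m) - c (grid_point (n k) (i - m))) + r / 2"
          using norm_triangle_ineq[of "u k (i - m) - c (grid_point (n k) (i - m))" "c (grid_point (n k) (i - m)) - c (grid_point (n k) i)"]
          by (simp add: dist_norm)
      qed
      also have "\<dots> = (\<Sum>i\<in>?I. cmod (u k (i - m) - c (grid_point (n k) (i - m)))) + real (card ?I) * (r / 2)"
        by (simp add: sum.distrib)
      also have "(\<Sum>i\<in>?I. cmod (u k (i - m) - c (grid_point (n k) (i - m)))) = (\<Sum>j\<in>(\<lambda>i. i - m) ` ?I. cmod (u k j - c (grid_point (n k) j)))"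
        by (subst sum.reindex) (auto simp: inj_on_def)
      also have "\<dots> \<le> (\<Sum>j\<in>index_box (n k). cmod (u k j - c (grid_point (n k) j)))"
        by (rule sum_mono2) auto
      also have "real (card ?I) * (r / 2) \<le> real (level_size (n k)) * (r / 2)"
        using card_mono[of "index_box (n k)" ?I] r by (intro mult_right_mono) (auto simp: card_index_box)
      finally have "(\<Sum>i\<in>index_box (n k). cmod (u' k i - c (grid_point (n k) i)))
          \<le> (\<Sum>j\<in>index_box (n k). cmod (u k j - c (grid_point (n k) j))) + real (level_size (n k)) * (r / 2) + C * real (card ?J)"
        by simp
      then have "S' k \<le> ((\<Sum>j\<in>index_box (n k). cmod (u k j - c (grid_point (n k) j))) + real (level_size (n k)) * (r / 2) + C * real (card ?J)) / real (level_size (n k))"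
        unfolding S'_def by (rule divide_right_mono) simp
      also have "\<dots> = S k + r / 2 + C * T k"
        using pos by (simp add: S_def T_def add_divide_distrib)
      finally have "S' k < r" using elim(2) by simp
      moreover have "0 \<le> S' k" by (simp add: S'_def sum_nonneg)
      ultimately show ?case by simp
    qed
    then show "\<exists>no. \<forall>k\<ge>no. norm (S' k - 0) < r" by (simp add: eventually_sequentially)
  qed
  moreover have "\<exists>B. \<forall>k i. cmod (u' k i) \<le> B"
    using Bu order_trans[OF norm_ge_zero Bu] by (intro exI[of _ Bu]) (auto simp: u'_def)
  ultimately show ?thesis
    using c by (simp add: mean_approx_def S'_def[abs_def] u'_def[abs_def])
qed

lemma mean_approx_average:
  fixes n :: "nat \<Rightarrow> nat ^ 'd::finite"
  assumes lim: "\<And>s. filterlim (\<lambda>k. n k $ s) at_top sequentially" and u: "mean_approx n u c"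
  shows "(\<lambda>k. (\<Sum>i\<in>index_box (n k). u k i) / of_nat (level_size (n k))) \<longlonglongrightarrow> (LINT x|lebesgue_on unit_cube. c x)"
proof -
  have c: "continuous_on unit_cube c" using u by (simp add: mean_approx_def)
  have "(\<lambda>k. (\<Sum>i\<in>index_box (n k). u k i - c (grid_point (n k) i)) / of_nat (level_size (n k))) \<longlonglongrightarrow> 0"
  proof (rule Lim_null_comparison[OF always_eventually], rule allI)
    show "norm ((\<Sum>i\<in>index_box (n k). u k i - c (grid_point (n k) i)) / of_nat (level_size (n k)))
        \<le> (\<Sum>i\<in>index_box (n k). cmod (u k i - c (grid_point (n k) i))) / real (level_size (n k))" for k
      by (simp add: norm_divide divide_right_mono norm_sum)
    show "(\<lambda>k. (\<Sum>i\<in>index_box (n k). cmod (u k i - c (grid_point (n k) i))) / real (level_size (n k))) \<longlonglongrightarrow> 0"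
      using u by (simp add: mean_approx_def)
  qed
  from tendsto_add[OF this riemann_sum_tendsto[OF lim c]] show ?thesis
    by (simp add: add_divide_distrib[symmetric] sum.distrib[symmetric])
qed

section \<open>Locally Toeplitz matrices of finite bandwidth\<close>

text \<open>The default 0 outside the matrix lets sums over diagonals run over one finite set of
  \<open>m\<close> that does not depend on the row.\<close>

definition diag_entry :: "nat ^ 'd::{finite,linorder} \<Rightarrow> complex mat \<Rightarrow> int ^ 'd::{finite,linorder} \<Rightarrow> int ^ 'd::{finite,linorder} \<Rightarrow> complex" where
  "diag_entry n Y m i = (if i \<in> index_box n \<and> i - m \<in> index_box n then Y $$ (index_pos n i, index_pos n (i - m)) else 0)"

text \<open>A class that contains the approximating sums and is closed under products and adjoints.
  The diagonals in \<open>K\<close> are the same for all \<open>k\<close> and carry the slowly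
  varying functions \<open>C m\<close>, which are the Fourier coefficients in
  \<open>\<theta>\<close> of the symbol. No approximating class is involved, so that traces can be
  computed.\<close>

definition locally_toeplitz :: "(nat \<Rightarrow> nat ^ 'd::{finite,linorder}) \<Rightarrow> (nat \<Rightarrow> complex mat) \<Rightarrow>
    (real ^ 'd::{finite,linorder} \<Rightarrow> real ^ 'd::{finite,linorder} \<Rightarrow> complex) \<Rightarrow> bool" where
  "locally_toeplitz n Y \<kappa> \<longleftrightarrow>
     (\<exists>K C. finite K \<and> (\<forall>m. m \<notin> K \<longrightarrow> C m = (\<lambda>_. 0)) \<and>
        (\<forall>m. mean_approx n (\<lambda>k. diag_entry (n k) (Y k) m) (C m)) \<and>
        (\<forall>k. Y k \<in> carrier_mat (level_size (n k)) (level_size (n k))) \<and>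
        (\<forall>k m i. m \<notin> K \<longrightarrow> diag_entry (n k) (Y k) m i = 0) \<and>
        (\<forall>x \<theta>. \<kappa> x \<theta> = (\<Sum>m\<in>K. C m x * exp (\<i> * of_real (int_dot m \<theta>)))))"

lemma int_dot_simps:
  "int_dot (m + m') \<theta> = int_dot m \<theta> + int_dot m' \<theta>" "int_dot (- m) \<theta> = - int_dot m \<theta>" "int_dot 0 \<theta> = 0"
  by (simp_all add: int_dot_def algebra_simps sum.distrib sum_negf)

text \<open>The adjoint at row \<open>i\<close>, diagonal \<open>m\<close>, is the conjugate of the
  entry at row \<open>i - m\<close>, diagonal \<open>- m\<close>; the change of row is a shift in
  the sense of \<open>mean_approx_shift\<close>.\<close>

lemma locally_toeplitz_adjoint:
  assumes lim: "\<And>s. filterlim (\<lambda>k. n k $ s) at_top sequentially" and Y: "locally_toeplitz n Y \<kappa>"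
  shows "locally_toeplitz n (\<lambda>k. mat_adjoint (Y k)) (\<lambda>x \<theta>. cnj (\<kappa> x \<theta>))"
proof -
  obtain K C where K: "finite K" "\<And>m. m \<notin> K \<Longrightarrow> C m = (\<lambda>_. 0)"
    "\<And>m. mean_approx n (\<lambda>k. diag_entry (n k) (Y k) m) (C m)"
    "\<And>k. Y k \<in> carrier_mat (level_size (n k)) (level_size (n k))"
    "\<And>k m i. m \<notin> K \<Longrightarrow> diag_entry (n k) (Y k) m i = 0"
    "\<And>x \<theta>. \<kappa> x \<theta> = (\<Sum>m\<in>K. C m x * exp (\<i> * of_real (int_dot m \<theta>)))"
    using Y unfolding locally_toeplitz_def by blast
  have de: "diag_entry (n k) (mat_adjoint (Y k)) m i
      = cnj (if i - m \<in> index_box (n k) then diag_entry (n k) (Y k) (- m) (i - m) else 0)" for k m i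
    using K(4)[of k] by (auto simp: diag_entry_def)
  show ?thesis
    unfolding locally_toeplitz_def
  proof (rule exI[of _ "uminus ` K"], rule exI[of _ "\<lambda>m x. cnj (C (- m) x)"], intro conjI allI impI)
    show "finite (uminus ` K)" using K(1) by simp
    show "(\<lambda>x. cnj (C (- m) x)) = (\<lambda>_. 0)" if "m \<notin> uminus ` K" for m
    proof -
      have "- m \<notin> K" using that by (metis add.inverse_inverse image_eqI)
      then show ?thesis by (simp add: K(2))
    qed
    show "mean_approx n (\<lambda>k. diag_entry (n k) (mat_adjoint (Y k)) m) (\<lambda>x. cnj (C (- m) x))" for m
      using mean_approx_cnj[OF mean_approx_shift[OF lim K(3)[of "- m"], of m]] by (simp add: de[abs_def] if_distrib)
    show "mat_adjoint (Y k) \<in> carrier_mat (level_size (n k)) (level_size (n k))" for k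
      using K(4) by simp
    show "diag_entry (n k) (mat_adjoint (Y k)) m i = 0" if "m \<notin> uminus ` K" for k m i
    proof -
      have "- m \<notin> K" using that by (metis add.inverse_inverse image_eqI)
      then show ?thesis using K(5) by (simp add: de)
    qed
    show "cnj (\<kappa> x \<theta>) = (\<Sum>m\<in>uminus ` K. cnj (C (- m) x) * exp (\<i> * complex_of_real (int_dot m \<theta>)))" for x \<theta>
      by (subst sum.reindex) (auto simp: K(6) exp_cnj int_dot_simps inj_on_def)
  qed
qed

text \<open>The substitution \<open>m = i - j\<close> turns the sum over the intermediate index
  \<open>j\<close> into a convolution over diagonals, up to the row of the second factor, which is
  \<open>i - m\<close> instead of \<open>i\<close>.\<close>

lemma diag_entry_mult:
  assumes Y: "Y \<in> carrier_mat (level_size n) (level_size n)" and Z: "Z \<in> carrier_mat (level_size n) (level_size n)"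
    and K: "finite K" "\<And>m i. m \<notin> K \<Longrightarrow> diag_entry n Y m i = 0"
  shows "diag_entry n (Y * Z) p i
    = (\<Sum>m\<in>K. diag_entry n Y m i * (if i - m \<in> index_box n then diag_entry n Z (p - m) (i - m) else 0))"
proof (cases "i \<in> index_box n \<and> i - p \<in> index_box n")
  case True
  then have "diag_entry n (Y * Z) p i = (\<Sum>l<level_size n. Y $$ (index_pos n i, l) * Z $$ (l, index_pos n (i - p)))"
    using mult_mat_index_sum[OF Y Z] by (simp add: diag_entry_def del: index_mult_mat)
  also have "\<dots> = (\<Sum>l<level_size n. Y $$ (index_pos n i, index_pos n (int_index n l)) * Z $$ (index_pos n (int_index n l), index_pos n (i - p)))"
    by (intro sum.cong) auto
  also have "\<dots> = (\<Sum>j\<in>index_box n. Y $$ (index_pos n i, index_pos n j) * Z $$ (index_pos n j, index_pos n (i - p)))"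
    by (rule sum_int_index)
  also have "\<dots> = (\<Sum>j\<in>index_box n. diag_entry n Y (i - j) i * diag_entry n Z (p - (i - j)) j)"
    using True by (intro sum.cong) (auto simp: diag_entry_def algebra_simps)
  also have "\<dots> = (\<Sum>m\<in>(\<lambda>j. i - j) ` index_box n. diag_entry n Y m i * diag_entry n Z (p - m) (i - m))"
    by (subst sum.reindex) (auto simp: inj_on_def)
  also have "\<dots> = (\<Sum>m\<in>(\<lambda>j. i - j) ` index_box n \<inter> K. diag_entry n Y m i * diag_entry n Z (p - m) (i - m))"
    using K by (intro sum.mono_neutral_right) auto
  also have "\<dots> = (\<Sum>m\<in>K. diag_entry n Y m i * (if i - m \<in> index_box n then diag_entry n Z (p - m) (i - m) else 0))"
  proof (rule sum.mono_neutral_cong_left)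
    show "\<forall>m\<in>K - (\<lambda>j. i - j) ` index_box n \<inter> K. diag_entry n Y m i * (if i - m \<in> index_box n then diag_entry n Z (p - m) (i - m) else 0) = 0"
    proof
      fix m assume "m \<in> K - (\<lambda>j. i - j) ` index_box n \<inter> K"
      then have m: "m \<notin> (\<lambda>j. i - j) ` index_box n" by auto
      have "i - m \<notin> index_box n"
      proof
        assume "i - m \<in> index_box n"
        then have "i - (i - m) \<in> (\<lambda>j. i - j) ` index_box n" by (rule imageI)
        with m show False by simp
      qed
      then show "diag_entry n Y m i * (if i - m \<in> index_box n then diag_entry n Z (p - m) (i - m) else 0) = 0" by simp
    qed
  qed (use K in auto)
  finally show ?thesis .
next
  case False
  then have "diag_entry n Y m i * (if i - m \<in> index_box n then diag_entry n Z (p - m) (i - m) else 0) = 0" for m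
    by (auto simp: diag_entry_def)
  then show ?thesis using False by (auto simp: diag_entry_def)
qed

text \<open>Diagonals of matrices and frequencies of trigonometric polynomials are both added under
  multiplication, so the coefficient functions convolve on both sides; the shift of the row in the
  second factor is harmless in the mean.\<close>

lemma locally_toeplitz_mult:
  assumes lim: "\<And>s. filterlim (\<lambda>k. n k $ s) at_top sequentially"
    and Y: "locally_toeplitz n Y \<kappa>" and Z: "locally_toeplitz n Z \<mu>"
  shows "locally_toeplitz n (\<lambda>k. Y k * Z k) (\<lambda>x \<theta>. \<kappa> x \<theta> * \<mu> x \<theta>)"
proof -
  obtain K C where K: "finite K" "\<And>m. m \<notin> K \<Longrightarrow> C m = (\<lambda>_. 0)"
    "\<And>m. mean_approx n (\<lambda>k. diag_entry (n k) (Y k) m) (C m)"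
    "\<And>k. Y k \<in> carrier_mat (level_size (n k)) (level_size (n k))"
    "\<And>k m i. m \<notin> K \<Longrightarrow> diag_entry (n k) (Y k) m i = 0"
    "\<And>x \<theta>. \<kappa> x \<theta> = (\<Sum>m\<in>K. C m x * exp (\<i> * of_real (int_dot m \<theta>)))"
    using Y unfolding locally_toeplitz_def by blast
  obtain L D where L: "finite L" "\<And>m. m \<notin> L \<Longrightarrow> D m = (\<lambda>_. 0)"
    "\<And>m. mean_approx n (\<lambda>k. diag_entry (n k) (Z k) m) (D m)"
    "\<And>k. Z k \<in> carrier_mat (level_size (n k)) (level_size (n k))"
    "\<And>k m i. m \<notin> L \<Longrightarrow> diag_entry (n k) (Z k) m i = 0"
    "\<And>x \<theta>. \<mu> x \<theta> = (\<Sum>m\<in>L. D m x * exp (\<i> * of_real (int_dot m \<theta>)))"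
    using Z unfolding locally_toeplitz_def by blast
  define P where "P = (\<lambda>(m, m'). m + m') ` (K \<times> L)"
  have P: "p - m \<notin> L" if "p \<notin> P" "m \<in> K" for p m
  proof
    assume "p - m \<in> L"
    then have "(\<lambda>(m, m'). m + m') (m, p - m) \<in> P" unfolding P_def using \<open>m \<in> K\<close> by (intro imageI) auto
    then have "p \<in> P" by simp
    then show False using that by simp
  qed
  have de: "diag_entry (n k) (Y k * Z k) p i
    = (\<Sum>m\<in>K. diag_entry (n k) (Y k) m i * (if i - m \<in> index_box (n k) then diag_entry (n k) (Z k) (p - m) (i - m) else 0))" for k p i
    by (rule diag_entry_mult[OF K(4) L(4) K(1,5)])
  show ?thesis
    unfolding locally_toeplitz_def
  proof (rule exI[of _ P], rule exI[of _ "\<lambda>p x. \<Sum>m\<in>K. C m x * D (p - m) x"], intro conjI allI impI)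
    show "finite P" using K(1) L(1) by (simp add: P_def)
    show "(\<lambda>x. \<Sum>m\<in>K. C m x * D (p - m) x) = (\<lambda>_. 0)" if "p \<notin> P" for p
      using P[OF that] L(2) by (auto intro!: sum.neutral)
    show "mean_approx n (\<lambda>k. diag_entry (n k) (Y k * Z k) p) (\<lambda>x. \<Sum>m\<in>K. C m x * D (p - m) x)" for p
      unfolding de[abs_def] by (intro mean_approx_sum K mean_approx_mult mean_approx_shift[OF lim] L)
    show "Y k * Z k \<in> carrier_mat (level_size (n k)) (level_size (n k))" for k
      using K(4)[of k] L(4)[of k] by simp
    show "diag_entry (n k) (Y k * Z k) p i = 0" if "p \<notin> P" for k p i
      unfolding de using P[OF that] L(5) by (intro sum.neutral) auto
    fix x \<theta>
    have "\<kappa> x \<theta> * \<mu> x \<theta> = (\<Sum>m\<in>K. \<Sum>m'\<in>L. C m x * D m' x * exp (\<i> * of_real (int_dot (m + m') \<theta>)))"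
      by (simp add: K(6) L(6) sum_product int_dot_simps exp_add algebra_simps)
    also have "\<dots> = (\<Sum>m\<in>K. \<Sum>p\<in>P. C m x * D (p - m) x * exp (\<i> * of_real (int_dot p \<theta>)))"
    proof (rule sum.cong[OF refl])
      fix m assume m: "m \<in> K"
      have "(\<Sum>m'\<in>L. C m x * D m' x * exp (\<i> * of_real (int_dot (m + m') \<theta>)))
          = (\<Sum>p\<in>(+) m ` L. C m x * D (p - m) x * exp (\<i> * of_real (int_dot p \<theta>)))"
        by (subst sum.reindex) (auto simp: inj_on_def)
      also have "\<dots> = (\<Sum>p\<in>P. C m x * D (p - m) x * exp (\<i> * of_real (int_dot p \<theta>)))"
      proof (rule sum.mono_neutral_left)
        show "finite P" using K(1) L(1) by (simp add: P_def)
        show "(+) m ` L \<subseteq> P" using m by (auto simp: P_def)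
        show "\<forall>p\<in>P - (+) m ` L. C m x * D (p - m) x * exp (\<i> * complex_of_real (int_dot p \<theta>)) = 0"
        proof
          fix p assume "p \<in> P - (+) m ` L"
          then have m: "p \<notin> (+) m ` L" by auto
          have "p - m \<notin> L"
          proof
            assume "p - m \<in> L"
            then have "m + (p - m) \<in> (+) m ` L" by (rule imageI)
            with m show False by simp
          qed
          then show "C m x * D (p - m) x * exp (\<i> * complex_of_real (int_dot p \<theta>)) = 0" by (simp add: L(2))
        qed
      qed
      finally show "(\<Sum>m'\<in>L. C m x * D m' x * exp (\<i> * of_real (int_dot (m + m') \<theta>)))
          = (\<Sum>p\<in>P. C m x * D (p - m) x * exp (\<i> * of_real (int_dot p \<theta>)))" .
    qed
    also have "\<dots> = (\<Sum>p\<in>P. (\<Sum>m\<in>K. C m x * D (p - m) x) * exp (\<i> * of_real (int_dot p \<theta>)))"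
      by (subst sum.swap) (simp add: sum_distrib_right)
    finally show "\<kappa> x \<theta> * \<mu> x \<theta> = (\<Sum>p\<in>P. (\<Sum>m\<in>K. C m x * D (p - m) x) * exp (\<i> * of_real (int_dot p \<theta>)))" .
  qed
qed

lemma locally_toeplitz_one:
  "locally_toeplitz n (\<lambda>k. 1\<^sub>m (level_size (n k))) (\<lambda>x \<theta>. 1)"
proof -
  have de: "diag_entry (n k) (1\<^sub>m (level_size (n k))) m i = (if m = 0 \<and> i \<in> index_box (n k) then 1 else 0)" for k m i
  proof (cases "m = 0")
    case False
    have "index_pos (n k) i \<noteq> index_pos (n k) (i - m)" if "i \<in> index_box (n k)" "i - m \<in> index_box (n k)"
    proof
      assume "index_pos (n k) i = index_pos (n k) (i - m)"
      then have "int_index (n k) (index_pos (n k) i) = int_index (n k) (index_pos (n k) (i - m))" by simp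
      then show False using that False by simp
    qed
    then show ?thesis using False by (auto simp: diag_entry_def)
  qed (auto simp: diag_entry_def)
  show ?thesis
    unfolding locally_toeplitz_def
  proof (rule exI[of _ "{0}"], rule exI[of _ "\<lambda>m x. if m = 0 then 1 else 0"], intro conjI allI impI)
    show "mean_approx n (\<lambda>k. diag_entry (n k) (1\<^sub>m (level_size (n k))) m) (\<lambda>x. if m = 0 then 1 else 0)" for m
      by (rule mean_approx_null) (auto simp: de)
  qed (auto simp: de int_dot_simps)
qed

lemma locally_toeplitz_pow:
  assumes lim: "\<And>s. filterlim (\<lambda>k. n k $ s) at_top sequentially" and Y: "locally_toeplitz n Y \<kappa>"
  shows "locally_toeplitz n (\<lambda>k. Y k ^\<^sub>m p) (\<lambda>x \<theta>. \<kappa> x \<theta> ^ p)"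
proof (induction p)
  case 0
  have "dim_row (Y k) = level_size (n k)" for k
    using Y unfolding locally_toeplitz_def by (metis carrier_matD(1))
  then show ?case using locally_toeplitz_one by simp
next
  case (Suc p)
  then show ?case
    using locally_toeplitz_mult[OF lim Suc Y] by (simp add: mult.commute)
qed

lemma locally_toeplitz_sampling_toeplitz_sum:
  fixes n :: "nat \<Rightarrow> nat ^ 'd::{finite,linorder}"
  assumes lim: "\<And>s. filterlim (\<lambda>k. n k $ s) at_top sequentially"
    and bf: "\<And>l. l < M \<Longrightarrow> continuous_on unit_cube (b l) \<and> trig_poly (f l)"
  shows "locally_toeplitz n (\<lambda>k. sampling_toeplitz_sum (n k) M b f) (\<lambda>x \<theta>. \<Sum>l<M. b l x * f l \<theta>)"
proof -
  have "\<forall>l. \<exists>Kc. l < M \<longrightarrow> finite (fst Kc) \<and> f l = (\<lambda>\<theta>. \<Sum>k\<in>fst Kc. snd Kc k * exp (\<i> * of_real (int_dot k \<theta>)))"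
  proof
    fix l
    show "\<exists>Kc. l < M \<longrightarrow> finite (fst Kc) \<and> f l = (\<lambda>\<theta>. \<Sum>k\<in>fst Kc. snd Kc k * exp (\<i> * of_real (int_dot k \<theta>)))"
    proof (cases "l < M")
      case True
      then obtain K c where "finite K" "f l = (\<lambda>\<theta>. \<Sum>k\<in>K. c k * exp (\<i> * of_real (int_dot k \<theta>)))"
        using bf unfolding trig_poly_def by blast
      then show ?thesis by (intro exI[of _ "(K, c)"]) simp
    qed simp
  qed
  from choice[OF this] obtain Kc' where Kc': "\<forall>l. l < M \<longrightarrow> finite (fst (Kc' l)) \<and>
      f l = (\<lambda>\<theta>. \<Sum>k\<in>fst (Kc' l). snd (Kc' l) k * exp (\<i> * of_real (int_dot k \<theta>)))" ..
  define K where "K l = fst (Kc' l)" for l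
  define c where "c l = snd (Kc' l)" for l
  have Kc: "finite (K l)" "f l = (\<lambda>\<theta>. \<Sum>k\<in>K l. c l k * exp (\<i> * of_real (int_dot k \<theta>)))" if "l < M" for l
    using Kc' that unfolding K_def c_def by blast+
  define C where "C m x = (\<Sum>l<M. b l x * (if m \<in> K l then c l m else 0))" for m x
  have four: "fourier_coeff (f l) m = (if m \<in> K l then c l m else 0)" if "l < M" for l m
    unfolding Kc(2)[OF that] by (rule fourier_coeff_trig_poly[OF Kc(1)[OF that]])
  \<comment> \<open>The second factor is the indicator of the box shifted by \<open>m\<close>,
    written with a doubled condition so that it is literally an instance of
    \<open>mean_approx_shift\<close>.\<close>
  have de: "diag_entry (n k) (sampling_toeplitz_sum (n k) M b f) m i
      = (if i \<in> index_box (n k) then C m (grid_point (n k) i) else 0) *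
        (if i - m \<in> index_box (n k) then (if i - m \<in> index_box (n k) then 1 else 0) else 0)" for k m i
    by (auto simp: diag_entry_def sampling_toeplitz_sum_index C_def four intro!: sum.cong)
  have cC: "continuous_on unit_cube (C m)" for m
    unfolding C_def using bf by (intro continuous_intros) auto
  show ?thesis
    unfolding locally_toeplitz_def
  proof (rule exI[of _ "\<Union>l<M. K l"], rule exI[of _ C], intro conjI allI impI)
    show "finite (\<Union>l<M. K l)" using Kc(1) by auto
    show C0: "C m = (\<lambda>_. 0)" if "m \<notin> (\<Union>l<M. K l)" for m
      using that by (auto simp: C_def[abs_def] intro!: sum.neutral)
    have "mean_approx n (\<lambda>k i. (if i \<in> index_box (n k) then C m (grid_point (n k) i) else 0) *
        (if i - m \<in> index_box (n k) then (if i - m \<in> index_box (n k) then 1 else 0) else 0)) (\<lambda>x. C m x * 1)" for m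
      by (intro mean_approx_mult mean_approx_shift[OF lim, where u = "\<lambda>k i. if i \<in> index_box (n k) then 1 else 0"] mean_approx_null cC) auto
    then show "mean_approx n (\<lambda>k. diag_entry (n k) (sampling_toeplitz_sum (n k) M b f) m) (C m)" for m
      by (simp add: de[abs_def])
    show "diag_entry (n k) (sampling_toeplitz_sum (n k) M b f) m i = 0" if "m \<notin> (\<Union>l<M. K l)" for k m i
      using C0[OF that] by (simp add: de)
    fix x \<theta>
    have "(\<Sum>l<M. b l x * f l \<theta>) = (\<Sum>l<M. \<Sum>m\<in>(\<Union>l<M. K l). b l x * (if m \<in> K l then c l m else 0) * exp (\<i> * of_real (int_dot m \<theta>)))"
    proof (rule sum.cong[OF refl])
      fix l assume "l \<in> {..<M}"
      then have l: "l < M" by simp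
      have "b l x * f l \<theta> = (\<Sum>m\<in>K l. b l x * (if m \<in> K l then c l m else 0) * exp (\<i> * of_real (int_dot m \<theta>)))"
        by (simp add: Kc(2)[OF l] sum_distrib_left mult.assoc)
      also have "\<dots> = (\<Sum>m\<in>(\<Union>l<M. K l). b l x * (if m \<in> K l then c l m else 0) * exp (\<i> * of_real (int_dot m \<theta>)))"
        using Kc(1) l by (intro sum.mono_neutral_left) auto
      finally show "b l x * f l \<theta> = (\<Sum>m\<in>(\<Union>l<M. K l). b l x * (if m \<in> K l then c l m else 0) * exp (\<i> * of_real (int_dot m \<theta>)))" .
    qed
    also have "\<dots> = (\<Sum>m\<in>(\<Union>l<M. K l). C m x * exp (\<i> * of_real (int_dot m \<theta>)))"
      by (subst sum.swap) (simp add: C_def sum_distrib_right)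
    finally show "(\<Sum>l<M. b l x * f l \<theta>) = (\<Sum>m\<in>(\<Union>l<M. K l). C m x * exp (\<i> * of_real (int_dot m \<theta>)))" .
  qed simp
qed

lemma lebesgue_on_integral_times:
  fixes f :: "'a::euclidean_space \<Rightarrow> complex" and g :: "'b::euclidean_space \<Rightarrow> complex"
  assumes S: "compact S" and T: "compact T" and f: "continuous_on S f" and g: "continuous_on T g"
  shows "(LINT p|lebesgue_on (S \<times> T). f (fst p) * g (snd p)) = (LINT x|lebesgue_on S. f x) * (LINT y|lebesgue_on T. g y)"
proof -
  have ST: "compact (S \<times> T)" using S T by (rule compact_Times)
  have c: "continuous_on (S \<times> T) (\<lambda>p. f (fst p) * g (snd p))"
    by (intro continuous_intros continuous_on_compose2[OF f] continuous_on_compose2[OF g]) auto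
  define F where "F p = indicator (S \<times> T) p *\<^sub>R (f (fst p) * g (snd p))" for p
  have F: "integrable (lborel \<Otimes>\<^sub>M lborel) F"
    unfolding lborel_prod F_def by (rule borel_integrable_compact[OF ST c])
  have "(LINT p|lebesgue_on (S \<times> T). f (fst p) * g (snd p)) = integral\<^sup>L (lborel \<Otimes>\<^sub>M lborel) F"
    unfolding lborel_prod F_def by (rule lebesgue_on_integral_continuous(1)[OF ST c])
  also have "\<dots> = (LINT x|lborel. LINT y|lborel. F (x, y))"
    by (rule lborel_pair.integral_fst'[OF F, symmetric])
  also have "\<dots> = (LINT x|lborel. LINT y|lborel. (indicator S x *\<^sub>R f x) * (indicator T y *\<^sub>R g y))"
    by (intro Bochner_Integration.integral_cong refl) (auto simp: F_def indicator_def)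
  also have "\<dots> = (LINT x|lborel. indicator S x *\<^sub>R f x) * (LINT y|lborel. indicator T y *\<^sub>R g y)"
    by (simp only: integral_mult_right_zero integral_mult_left_zero)
  finally show ?thesis
    using lebesgue_on_integral_continuous(1)[OF S f] lebesgue_on_integral_continuous(1)[OF T g] by simp
qed

text \<open>Only the diagonal 0 enters the trace, and integration over \<open>\<theta>\<close> keeps
  only the coefficient of frequency 0 of the symbol. What remains is the convergence of averages to
  the integral of \<open>C 0\<close>.\<close>

lemma locally_toeplitz_trace:
  fixes n :: "nat \<Rightarrow> nat ^ 'd::{finite,linorder}"
  assumes lim: "\<And>s. filterlim (\<lambda>k. n k $ s) at_top sequentially" and Y: "locally_toeplitz n Y \<kappa>"
  shows "(\<lambda>k. mat_trace (Y k) / of_nat (level_size (n k)))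
    \<longlonglongrightarrow> (LINT p|lebesgue_on (unit_cube \<times> pi_cube). \<kappa> (fst p) (snd p)) / of_real ((2 * pi) ^ CARD('d))"
proof -
  obtain K C where K: "finite K" "\<And>m. m \<notin> K \<Longrightarrow> C m = (\<lambda>_. 0)"
    "\<And>m. mean_approx n (\<lambda>k. diag_entry (n k) (Y k) m) (C m)"
    "\<And>k. Y k \<in> carrier_mat (level_size (n k)) (level_size (n k))"
    "\<And>x \<theta>. \<kappa> x \<theta> = (\<Sum>m\<in>K. C m x * exp (\<i> * of_real (int_dot m \<theta>)))"
    using Y unfolding locally_toeplitz_def by blast
  have c: "continuous_on unit_cube (C m)" for m using K(3) by (simp add: mean_approx_def)
  have "mat_trace (Y k) = (\<Sum>i\<in>index_box (n k). diag_entry (n k) (Y k) 0 i)" for k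
  proof -
    have "mat_trace (Y k) = (\<Sum>a<level_size (n k). diag_entry (n k) (Y k) 0 (int_index (n k) a))"
      using K(4)[of k] by (auto simp: mat_trace_def diag_entry_def intro!: sum.cong)
    then show ?thesis by (simp add: sum_int_index)
  qed
  then have lim': "(\<lambda>k. mat_trace (Y k) / of_nat (level_size (n k))) \<longlonglongrightarrow> (LINT x|lebesgue_on unit_cube. C 0 x)"
    using mean_approx_average[OF lim K(3)] by simp
  have cont: "continuous_on (unit_cube \<times> pi_cube) (\<lambda>p. C m (fst p) * exp (\<i> * of_real (int_dot m (snd p))))" for m
    by (intro continuous_intros continuous_on_compose2[OF c] continuous_on_compose2[OF continuous_int_dot[of UNIV]]) auto
  have comp: "compact (unit_cube :: (real ^ 'd::{finite,linorder}) set)"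
      "compact (pi_cube :: (real ^ 'd::{finite,linorder}) set)" by auto
  have "(LINT p|lebesgue_on (unit_cube \<times> pi_cube). \<kappa> (fst p) (snd p))
      = (\<Sum>m\<in>K. LINT p|lebesgue_on (unit_cube \<times> pi_cube). C m (fst p) * exp (\<i> * of_real (int_dot m (snd p))))"
    unfolding K(5) by (intro Bochner_Integration.integral_sum lebesgue_on_integral_continuous(2) compact_Times comp cont)
  also have "\<dots> = (\<Sum>m\<in>K. (LINT x|lebesgue_on unit_cube. C m x) * (LINT \<theta>|lebesgue_on pi_cube. exp (\<i> * of_real (int_dot m \<theta>))))"
    by (intro sum.cong refl lebesgue_on_integral_times comp c continuous_intros)
  also have "\<dots> = (\<Sum>m\<in>K. if m = 0 then (LINT x|lebesgue_on unit_cube. C m x) * of_real ((2 * pi) ^ CARD('d)) else 0)"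
    unfolding integral_exp_int_dot by (intro sum.cong) auto
  also have "\<dots> = (LINT x|lebesgue_on unit_cube. C 0 x) * of_real ((2 * pi) ^ CARD('d))"
    using K(1,2) by (cases "0 \<in> K") auto
  finally show ?thesis using lim' by simp
qed

section \<open>Moments of the singular values\<close>

text \<open>A row or a column meets each diagonal at most once.\<close>

lemma row_col_sum_le_diag:
  assumes Y: "Y \<in> carrier_mat (level_size n) (level_size n)" and K: "finite K"
    and zero: "\<And>m i. m \<notin> K \<Longrightarrow> diag_entry n Y m i = 0"
    and B: "\<And>m i. m \<in> K \<Longrightarrow> cmod (diag_entry n Y m i) \<le> B m"
  shows "a < level_size n \<Longrightarrow> (\<Sum>b<level_size n. cmod (Y $$ (a, b))) \<le> sum B K"
    and "b < level_size n \<Longrightarrow> (\<Sum>a<level_size n. cmod (Y $$ (a, b))) \<le> sum B K"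
proof -
  have B0: "0 \<le> B m" if "m \<in> K" for m using order_trans[OF norm_ge_zero B[OF that]] .
  have entry: "Y $$ (a, b) = diag_entry n Y (int_index n a - int_index n b) (int_index n a)"
    if "a < level_size n" "b < level_size n" for a b
    using that by (simp add: diag_entry_def)
  {
    fix a assume a: "a < level_size n"
    have "(\<Sum>b<level_size n. cmod (Y $$ (a, b)))
        = (\<Sum>b<level_size n. cmod (diag_entry n Y (int_index n a - int_index n b) (int_index n a)))"
      using a by (intro sum.cong) (auto simp: entry)
    also have "\<dots> = (\<Sum>j\<in>index_box n. cmod (diag_entry n Y (int_index n a - j) (int_index n a)))"
      by (rule sum_int_index)
    also have "\<dots> = (\<Sum>m\<in>(\<lambda>j. int_index n a - j) ` index_box n. cmod (diag_entry n Y m (int_index n a)))"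
      by (subst sum.reindex) (auto simp: inj_on_def)
    also have "\<dots> = (\<Sum>m\<in>(\<lambda>j. int_index n a - j) ` index_box n \<inter> K. cmod (diag_entry n Y m (int_index n a)))"
      using zero by (intro sum.mono_neutral_right) auto
    also have "\<dots> \<le> (\<Sum>m\<in>(\<lambda>j. int_index n a - j) ` index_box n \<inter> K. B m)"
      using B by (intro sum_mono) auto
    also have "\<dots> \<le> sum B K"
      using K B0 by (intro sum_mono2) auto
    finally show "(\<Sum>b<level_size n. cmod (Y $$ (a, b))) \<le> sum B K" .
  }
  {
    fix b assume b: "b < level_size n"
    have "(\<Sum>a<level_size n. cmod (Y $$ (a, b)))
        = (\<Sum>a<level_size n. cmod (diag_entry n Y (int_index n a - int_index n b) (int_index n a)))"
      using b by (intro sum.cong) (auto simp: entry)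
    also have "\<dots> = (\<Sum>i\<in>index_box n. cmod (diag_entry n Y (i - int_index n b) i))"
      by (rule sum_int_index)
    also have "\<dots> = (\<Sum>m\<in>(\<lambda>i. i - int_index n b) ` index_box n. cmod (diag_entry n Y m (m + int_index n b)))"
      by (subst sum.reindex) (auto simp: inj_on_def)
    also have "\<dots> = (\<Sum>m\<in>(\<lambda>i. i - int_index n b) ` index_box n \<inter> K. cmod (diag_entry n Y m (m + int_index n b)))"
      using zero by (intro sum.mono_neutral_right) auto
    also have "\<dots> \<le> (\<Sum>m\<in>(\<lambda>i. i - int_index n b) ` index_box n \<inter> K. B m)"
      using B by (intro sum_mono) auto
    also have "\<dots> \<le> sum B K"
      using K B0 by (intro sum_mono2) auto
    finally show "(\<Sum>a<level_size n. cmod (Y $$ (a, b))) \<le> sum B K" .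
  }
qed

lemma spectral_norm_le_diag:
  assumes "Y \<in> carrier_mat (level_size n) (level_size n)" "finite K"
    and "\<And>m i. m \<notin> K \<Longrightarrow> diag_entry n Y m i = 0"
    and "\<And>m i. m \<in> K \<Longrightarrow> cmod (diag_entry n Y m i) \<le> B m"
  shows "spectral_norm Y \<le> sum B K"
proof (rule spectral_norm_le_row_col[OF assms(1)])
  show "0 \<le> sum B K"
    using order_trans[OF norm_ge_zero assms(4)] by (intro sum_nonneg) auto
qed (use row_col_sum_le_diag[OF assms] in auto)

text \<open>Comparison with the zero matrix at the threshold 0, with rank correction 0 and
  \<open>\<epsilon>\<close> the norm of \<open>A\<close>: all \<open>n\<close> singular values of
  the zero matrix lie below the threshold, hence all \<open>n\<close> of \<open>A\<close> lie below
  its norm.\<close>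

lemma singular_basis_le_spectral_norm:
  assumes A: "A \<in> carrier_mat n n" and s: "singular_basis n A s u" and k: "k < n"
  shows "s k \<le> spectral_norm A"
proof -
  define Z where "Z = (0\<^sub>m n n :: complex mat)"
  have Z: "Z \<in> carrier_mat n n" by (simp add: Z_def)
  obtain z w where z: "singular_basis n Z z w" using singular_basis_exists[OF Z] .
  have "mat_adjoint Z * 0\<^sub>m n n = 0\<^sub>m n n"
    by (rule right_mult_zero_mat[OF mat_adjoint_carrier[OF Z]])
  then have eq: "mat_adjoint Z * Z = 0\<^sub>m n n" by (simp only: Z_def)
  have "mat_trace ((mat_adjoint Z * Z) ^\<^sub>m 1) = complex_of_real (\<Sum>k<n. (z k) ^ (2 * 1))"
    using z unfolding singular_basis_def by blast
  then have "complex_of_real (\<Sum>k<n. (z k)\<^sup>2) = 0"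
    unfolding eq by (simp add: mat_trace_def)
  then have "(\<Sum>k<n. (z k)\<^sup>2) = 0" using of_real_eq_0_iff by blast
  then have z0: "z k = 0" if "k < n" for k
    using that by (simp add: sum_nonneg_eq_0_iff)
  have "mat_rank Z = 0" using vec_space.rank_0I by (simp add: Z_def)
  have "card {k. k < n \<and> z k \<le> 0} \<le> card {k. k < n \<and> s k \<le> 0 + spectral_norm A} + mat_rank Z"
    by (rule singular_count_perturbation[OF s z Z])
      (use spectral_norm_nonneg[OF A] vec_l2_norm_mult_le_spectral_norm[OF A] in \<open>auto intro!: add_increasing\<close>)
  moreover have "{k. k < n \<and> z k \<le> 0} = {..<n}" using z0 by auto
  ultimately have "card {..<n} \<le> card {k. k < n \<and> s k \<le> spectral_norm A}"
    using \<open>mat_rank Z = 0\<close> by simp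
  then have "{k. k < n \<and> s k \<le> spectral_norm A} = {..<n}"
    by (intro card_seteq) auto
  then show ?thesis using k by auto
qed

lemma locally_toeplitz_norm_bounded:
  assumes "locally_toeplitz n Y \<kappa>"
  obtains M where "0 \<le> M" "\<And>k. spectral_norm (Y k) \<le> M"
proof -
  obtain K C where K: "finite K"
    "\<And>m. mean_approx n (\<lambda>k. diag_entry (n k) (Y k) m) (C m)"
    "\<And>k. Y k \<in> carrier_mat (level_size (n k)) (level_size (n k))"
    "\<And>k m i. m \<notin> K \<Longrightarrow> diag_entry (n k) (Y k) m i = 0"
    using assms unfolding locally_toeplitz_def by blast
  have "\<forall>m. \<exists>B. \<forall>k i. cmod (diag_entry (n k) (Y k) m i) \<le> B"
    using K(2) by (simp add: mean_approx_def)
  from choice[OF this] obtain B where B: "\<And>m k i. cmod (diag_entry (n k) (Y k) m i) \<le> B m" by blast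
  have "spectral_norm (Y k) \<le> sum B K" for k
    by (rule spectral_norm_le_diag[OF K(3) K(1) K(4) B])
  moreover have "0 \<le> sum B K"
    using order_trans[OF norm_ge_zero B] by (intro sum_nonneg) auto
  ultimately show thesis using that by blast
qed

lemma measure_symbol_domain:
  "measure lebesgue (unit_cube \<times> pi_cube :: ((real ^ 'd::finite) \<times> (real ^ 'd)) set) = (2 * pi) ^ CARD('d)"
  "unit_cube \<times> pi_cube \<in> (lmeasurable :: ((real ^ 'd::finite) \<times> (real ^ 'd)) set set)"
proof -
  have ne: "(unit_cube :: (real ^ 'd) set) \<noteq> {}" "(pi_cube :: (real ^ 'd) set) \<noteq> {}"
    using pi_gt_zero by (auto simp: interval_ne_empty_cart less_imp_le)
  have "measure lborel (unit_cube :: (real ^ 'd) set) = 1"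
    using ne by (simp add: content_cbox_if_cart)
  moreover have "measure lborel (pi_cube :: (real ^ 'd) set) = (2 * pi) ^ CARD('d)"
    using ne by (simp add: content_cbox_if_cart)
  moreover have "measure lborel (cbox (0 :: real ^ 'd, (\<chi> _. - pi) :: real ^ 'd) (1, \<chi> _. pi))
      = measure lborel (unit_cube :: (real ^ 'd) set) * measure lborel (pi_cube :: (real ^ 'd) set)"
    by (rule content_Pair)
  ultimately show "measure lebesgue (unit_cube \<times> pi_cube :: ((real ^ 'd) \<times> (real ^ 'd)) set) = (2 * pi) ^ CARD('d)"
    by (simp add: cbox_Pair_eq[symmetric] measure_completion)
  show "unit_cube \<times> pi_cube \<in> (lmeasurable :: ((real ^ 'd) \<times> (real ^ 'd)) set set)"
    unfolding cbox_Pair_eq[symmetric] by (rule lmeasurable_cbox)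
qed

lemma finite_measure_symbol_domain:
  "finite_measure (lebesgue_on (unit_cube \<times> pi_cube :: ((real ^ 'd::finite) \<times> (real ^ 'd)) set))"
  by (rule finite_measure_lebesgue_on) (rule measure_symbol_domain)

lemma locally_toeplitz_continuous:
  assumes "locally_toeplitz n Y \<kappa>"
  shows "continuous_on (unit_cube \<times> pi_cube) (\<lambda>p. \<kappa> (fst p) (snd p))"
proof -
  obtain K C where K: "finite K"
    "\<And>m. mean_approx n (\<lambda>k. diag_entry (n k) (Y k) m) (C m)"
    "\<And>x \<theta>. \<kappa> x \<theta> = (\<Sum>m\<in>K. C m x * exp (\<i> * of_real (int_dot m \<theta>)))"
    using assms unfolding locally_toeplitz_def by blast
  have c: "continuous_on unit_cube (C m)" for m using K(2) by (simp add: mean_approx_def)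
  show ?thesis
    unfolding K(3)
    by (intro continuous_intros continuous_on_compose2[OF c] continuous_on_compose2[OF continuous_int_dot[of UNIV]]) auto
qed

lemma locally_toeplitz_moments:
  fixes n :: "nat \<Rightarrow> nat ^ 'd::{finite,linorder}"
  assumes lim: "\<And>s. filterlim (\<lambda>k. n k $ s) at_top sequentially" and Y: "locally_toeplitz n Y \<kappa>"
    and s: "\<And>k. singular_basis (level_size (n k)) (Y k) (s k) (u k)"
  shows "(\<lambda>k. (\<Sum>j<level_size (n k). ((s k j)\<^sup>2) ^ p) / real (level_size (n k)))
    \<longlonglongrightarrow> (LINT z|lebesgue_on (unit_cube \<times> pi_cube). ((cmod (\<kappa> (fst z) (snd z)))\<^sup>2) ^ p) / (2 * pi) ^ CARD('d)"
proof -
  have lt: "locally_toeplitz n (\<lambda>k. (mat_adjoint (Y k) * Y k) ^\<^sub>m p) (\<lambda>x \<theta>. (cnj (\<kappa> x \<theta>) * \<kappa> x \<theta>) ^ p)"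
    by (rule locally_toeplitz_pow[OF lim locally_toeplitz_mult[OF lim locally_toeplitz_adjoint[OF lim Y] Y]])
  have tr: "mat_trace ((mat_adjoint (Y k) * Y k) ^\<^sub>m p) = complex_of_real (\<Sum>j<level_size (n k). ((s k j)\<^sup>2) ^ p)" for k
    using s[of k] unfolding singular_basis_def power_mult by blast
  have sym: "(cnj (\<kappa> x \<theta>) * \<kappa> x \<theta>) ^ p = complex_of_real (((cmod (\<kappa> x \<theta>))\<^sup>2) ^ p)" for x \<theta>
    unfolding cnj_mult_self by simp
  have "(\<lambda>k. complex_of_real ((\<Sum>j<level_size (n k). ((s k j)\<^sup>2) ^ p) / real (level_size (n k))))
      \<longlonglongrightarrow> complex_of_real ((LINT z|lebesgue_on (unit_cube \<times> pi_cube). ((cmod (\<kappa> (fst z) (snd z)))\<^sup>2) ^ p) / (2 * pi) ^ CARD('d))"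
    using locally_toeplitz_trace[OF lim lt] unfolding tr sym integral_complex_of_real by simp
  then show ?thesis by (simp only: tendsto_of_real_iff)
qed

theorem locally_toeplitz_cts_step:
  fixes n :: "nat \<Rightarrow> nat ^ 'd::{finite,linorder}"
  assumes lim: "\<And>s. filterlim (\<lambda>k. n k $ s) at_top sequentially" and Y: "locally_toeplitz n Y \<kappa>"
    and xy: "x < y"
  shows "(\<lambda>k. (\<Sum>s\<in>#singular_values (Y k). cts_step x y s) / real (level_size (n k)))
    \<longlonglongrightarrow> (LINT z|lebesgue_on (unit_cube \<times> pi_cube). cts_step x y (cmod (\<kappa> (fst z) (snd z)))) / (2 * pi) ^ CARD('d)"
proof -
  let ?D = "unit_cube \<times> pi_cube :: ((real ^ 'd::{finite,linorder}) \<times> (real ^ 'd::{finite,linorder})) set"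
  have carr: "Y k \<in> carrier_mat (level_size (n k)) (level_size (n k))" for k
    using Y unfolding locally_toeplitz_def by blast
  have "\<forall>k. \<exists>su. singular_basis (level_size (n k)) (Y k) (fst su) (snd su)"
    using singular_basis_exists[OF carr] by (metis fst_conv snd_conv)
  from choice[OF this] obtain su where su: "\<And>k. singular_basis (level_size (n k)) (Y k) (fst (su k)) (snd (su k))" by blast
  define s where "s k = fst (su k)" for k
  have s: "singular_basis (level_size (n k)) (Y k) (s k) (snd (su k))" for k using su by (simp add: s_def)
  obtain M1 where M1: "0 \<le> M1" "\<And>k. spectral_norm (Y k) \<le> M1"
    using locally_toeplitz_norm_bounded[OF Y] by blast
  have cD: "compact ?D" by (intro compact_Times) auto
  have c\<kappa>: "continuous_on ?D (\<lambda>z. \<kappa> (fst z) (snd z))" by (rule locally_toeplitz_continuous[OF Y])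
  have "bounded ((\<lambda>z. \<kappa> (fst z) (snd z)) ` ?D)"
    by (intro compact_imp_bounded compact_continuous_image c\<kappa> cD)
  then obtain M2 where M2: "\<And>z. z \<in> ?D \<Longrightarrow> cmod (\<kappa> (fst z) (snd z)) \<le> M2"
    unfolding bounded_iff by blast
  \<comment> \<open>One interval \<open>{0..M\<^sup>2}\<close> contains the squares of all singular
    values, for every \<open>k\<close>, and those of the moduli of the symbol; polynomial
    approximation takes place there.\<close>
  define M where "M = max M1 M2"
  have sM: "(s k j)\<^sup>2 \<in> {0..M\<^sup>2}" if "j < level_size (n k)" for k j
    using singular_basis_le_spectral_norm[OF carr s that] M1(2)[of k] s[of k] that
    by (auto simp: M_def singular_basis_def intro!: power_mono)
  have \<kappa>M: "(cmod (\<kappa> (fst z) (snd z)))\<^sup>2 \<in> {0..M\<^sup>2}" if "z \<in> ?D" for z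
    using M2[OF that] by (auto simp: M_def intro!: power_mono)
  \<comment> \<open>Traces provide moments of the squares of the singular values, so the test
    function is expressed in the variable \<open>t = s\<^sup>2\<close>.\<close>
  define \<phi> where "\<phi> t = cts_step x y (sqrt t)" for t
  have \<phi>: "continuous_on {0..M\<^sup>2} \<phi>"
    unfolding \<phi>_def by (intro continuous_on_compose2[OF continuous_on_cts_step[OF xy, of UNIV]] continuous_intros) auto
  let ?V = "(2 * pi) ^ CARD('d)"
  have V: "?V > 0" by simp
  have c2: "continuous_on ?D (\<lambda>z. (cmod (\<kappa> (fst z) (snd z)))\<^sup>2)"
    by (intro continuous_intros c\<kappa>)
  have int\<phi>: "integrable (lebesgue_on ?D) (\<lambda>z. \<phi> ((cmod (\<kappa> (fst z) (snd z)))\<^sup>2))"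
    by (intro lebesgue_on_integral_continuous(2) cD continuous_on_compose2[OF \<phi> c2]) (use \<kappa>M in auto)
  have "(\<lambda>k. (\<Sum>j<level_size (n k). \<phi> ((s k j)\<^sup>2)) / real (level_size (n k)))
      \<longlonglongrightarrow> (LINT z|lebesgue_on ?D. \<phi> ((cmod (\<kappa> (fst z) (snd z)))\<^sup>2)) / ?V"
  proof (rule LIMSEQ_I)
    fix r :: real assume r: "0 < r"
    \<comment> \<open>A quarter each goes to replacing \<open>\<phi>\<close> by \<open>g\<close> in
      the sum, to the same in the integral, and to the convergence of the moments.\<close>
    obtain g where g: "real_polynomial_function g" "\<And>t. t \<in> {0..M\<^sup>2} \<Longrightarrow> \<bar>\<phi> t - g t\<bar> < r / 4"
      using Stone_Weierstrass_real_polynomial_function[OF compact_Icc \<phi>, of "r / 4"] r by auto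
    obtain a q where gq: "g = (\<lambda>t. \<Sum>i\<le>q. a i * t ^ i)"
      using g(1) real_polynomial_function_iff_sum by auto
    have cg: "continuous_on UNIV g" unfolding gq by (intro continuous_intros)
    have intp: "integrable (lebesgue_on ?D) (\<lambda>z. ((cmod (\<kappa> (fst z) (snd z)))\<^sup>2) ^ i)" for i
      by (intro lebesgue_on_integral_continuous(2) cD continuous_intros c\<kappa>)
    have intg: "integrable (lebesgue_on ?D) (\<lambda>z. g ((cmod (\<kappa> (fst z) (snd z)))\<^sup>2))"
      by (intro lebesgue_on_integral_continuous(2) cD continuous_on_compose2[OF cg c2]) auto
    have "(\<lambda>k. \<Sum>i\<le>q. a i * ((\<Sum>j<level_size (n k). ((s k j)\<^sup>2) ^ i) / real (level_size (n k))))
        \<longlonglongrightarrow> (\<Sum>i\<le>q. a i * ((LINT z|lebesgue_on ?D. ((cmod (\<kappa> (fst z) (snd z)))\<^sup>2) ^ i) / ?V))"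
      by (intro tendsto_sum tendsto_mult tendsto_const locally_toeplitz_moments[OF lim Y s])
    also have "(\<lambda>k. \<Sum>i\<le>q. a i * ((\<Sum>j<level_size (n k). ((s k j)\<^sup>2) ^ i) / real (level_size (n k))))
        = (\<lambda>k. (\<Sum>j<level_size (n k). g ((s k j)\<^sup>2)) / real (level_size (n k)))"
    proof (rule ext)
      fix k
      have "(\<Sum>i\<le>q. a i * ((\<Sum>j<level_size (n k). ((s k j)\<^sup>2) ^ i) / real (level_size (n k))))
          = (\<Sum>i\<le>q. \<Sum>j<level_size (n k). a i * ((s k j)\<^sup>2) ^ i) / real (level_size (n k))"
        by (simp add: sum_divide_distrib sum_distrib_left)
      also have "(\<Sum>i\<le>q. \<Sum>j<level_size (n k). a i * ((s k j)\<^sup>2) ^ i) = (\<Sum>j<level_size (n k). g ((s k j)\<^sup>2))"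
        unfolding gq by (rule sum.swap)
      finally show "(\<Sum>i\<le>q. a i * ((\<Sum>j<level_size (n k). ((s k j)\<^sup>2) ^ i) / real (level_size (n k))))
          = (\<Sum>j<level_size (n k). g ((s k j)\<^sup>2)) / real (level_size (n k))" .
    qed
    also have "(\<Sum>i\<le>q. a i * ((LINT z|lebesgue_on ?D. ((cmod (\<kappa> (fst z) (snd z)))\<^sup>2) ^ i) / ?V))
        = (LINT z|lebesgue_on ?D. g ((cmod (\<kappa> (fst z) (snd z)))\<^sup>2)) / ?V"
      unfolding gq using intp by (simp add: sum_divide_distrib)
    finally have "\<exists>no. \<forall>k\<ge>no. norm ((\<Sum>j<level_size (n k). g ((s k j)\<^sup>2)) / real (level_size (n k))
        - (LINT z|lebesgue_on ?D. g ((cmod (\<kappa> (fst z) (snd z)))\<^sup>2)) / ?V) < r / 4"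
      using r by (intro LIMSEQ_D) auto
    then obtain no where no: "\<And>k. no \<le> k \<Longrightarrow> \<bar>(\<Sum>j<level_size (n k). g ((s k j)\<^sup>2)) / real (level_size (n k))
        - (LINT z|lebesgue_on ?D. g ((cmod (\<kappa> (fst z) (snd z)))\<^sup>2)) / ?V\<bar> < r / 4"
      by auto
    have d1: "\<bar>(\<Sum>j<level_size (n k). \<phi> ((s k j)\<^sup>2)) / real (level_size (n k)) - (\<Sum>j<level_size (n k). g ((s k j)\<^sup>2)) / real (level_size (n k))\<bar> \<le> r / 4" for k
    proof -
      have "\<bar>\<Sum>j<level_size (n k). \<phi> ((s k j)\<^sup>2) - g ((s k j)\<^sup>2)\<bar> \<le> (\<Sum>j<level_size (n k). r / 4)"
        by (intro order_trans[OF sum_abs] sum_mono less_imp_le g(2) sM) auto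
      then have "\<bar>\<Sum>j<level_size (n k). \<phi> ((s k j)\<^sup>2) - g ((s k j)\<^sup>2)\<bar> / real (level_size (n k)) \<le> (real (level_size (n k)) * (r / 4)) / real (level_size (n k))"
        by (intro divide_right_mono) auto
      also have "\<dots> \<le> r / 4" using r by simp
      finally show ?thesis by (simp add: diff_divide_distrib[symmetric] sum_subtractf[symmetric] abs_divide)
    qed
    have d2: "\<bar>(LINT z|lebesgue_on ?D. \<phi> ((cmod (\<kappa> (fst z) (snd z)))\<^sup>2)) / ?V - (LINT z|lebesgue_on ?D. g ((cmod (\<kappa> (fst z) (snd z)))\<^sup>2)) / ?V\<bar> \<le> r / 4"
    proof -
      interpret finite_measure "lebesgue_on ?D" by (rule finite_measure_symbol_domain)
      have "\<bar>LINT z|lebesgue_on ?D. \<phi> ((cmod (\<kappa> (fst z) (snd z)))\<^sup>2) - g ((cmod (\<kappa> (fst z) (snd z)))\<^sup>2)\<bar>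
          \<le> (LINT z|lebesgue_on ?D. \<bar>\<phi> ((cmod (\<kappa> (fst z) (snd z)))\<^sup>2) - g ((cmod (\<kappa> (fst z) (snd z)))\<^sup>2)\<bar>)"
        by (rule integral_abs_bound)
      also have "\<dots> \<le> (LINT z|lebesgue_on ?D. r / 4)"
        using int\<phi> intg g(2) \<kappa>M by (intro integral_mono) (auto intro: less_imp_le)
      also have "\<dots> = ?V * (r / 4)"
        using measure_symbol_domain[where 'd = 'd] by (simp add: measure_restrict_space)
      finally have "\<bar>(LINT z|lebesgue_on ?D. \<phi> ((cmod (\<kappa> (fst z) (snd z)))\<^sup>2)) - (LINT z|lebesgue_on ?D. g ((cmod (\<kappa> (fst z) (snd z)))\<^sup>2))\<bar> \<le> ?V * (r / 4)"
        using int\<phi> intg by simp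
      then show ?thesis
        unfolding diff_divide_distrib[symmetric] abs_divide using V by (simp add: divide_le_eq mult.commute)
    qed
    show "\<exists>no. \<forall>k\<ge>no. norm ((\<Sum>j<level_size (n k). \<phi> ((s k j)\<^sup>2)) / real (level_size (n k))
        - (LINT z|lebesgue_on ?D. \<phi> ((cmod (\<kappa> (fst z) (snd z)))\<^sup>2)) / ?V) < r"
    proof (intro exI allI impI)
      fix k assume "no \<le> k"
      from no[OF this] d1[of k] d2 r show "norm ((\<Sum>j<level_size (n k). \<phi> ((s k j)\<^sup>2)) / real (level_size (n k))
        - (LINT z|lebesgue_on ?D. \<phi> ((cmod (\<kappa> (fst z) (snd z)))\<^sup>2)) / ?V) < r"
        unfolding real_norm_def by linarith
    qed
  qed
  moreover have "(\<Sum>j<level_size (n k). \<phi> ((s k j)\<^sup>2)) = (\<Sum>s\<in>#singular_values (Y k). cts_step x y s)" for k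
    unfolding sum_singular_values[OF s] \<phi>_def using s[of k] by (intro sum.cong) (auto simp: singular_basis_def)
  ultimately show ?thesis by (simp add: \<phi>_def)
qed


section \<open>Singular values of GLT sequences\<close>

text \<open>Where the functions are close, the Lipschitz bound of the step is used; elsewhere the
  steps differ by at most 1, on a set of small measure.\<close>

lemma integral_cts_step_tendsto_in_measure:
  fixes \<phi> :: "nat \<Rightarrow> 'a::euclidean_space \<Rightarrow> complex"
  assumes D: "D \<in> lmeasurable" and xy: "x < y"
    and m: "\<And>r. \<phi> r \<in> borel_measurable (lebesgue_on D)" "\<kappa> \<in> borel_measurable (lebesgue_on D)"
    and lim: "tendsto_in_measure D \<phi> \<kappa>"
  shows "(\<lambda>r. LINT z|lebesgue_on D. cts_step x y (cmod (\<phi> r z))) \<longlonglongrightarrow> (LINT z|lebesgue_on D. cts_step x y (cmod (\<kappa> z)))"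
proof (rule LIMSEQ_I)
  interpret finite_measure "lebesgue_on D" by (rule finite_measure_lebesgue_on[OF D])
  have cm: "cts_step x y \<in> borel_measurable borel"
    by (rule borel_measurable_continuous_onI[OF continuous_on_cts_step[OF xy]])
  have int: "integrable (lebesgue_on D) (\<lambda>z. cts_step x y (cmod (f z)))" if "f \<in> borel_measurable (lebesgue_on D)" for f :: "'a \<Rightarrow> complex"
  proof (rule integrable_const_bound[of _ 1])
    show "(\<lambda>z. cts_step x y (cmod (f z))) \<in> borel_measurable (lebesgue_on D)"
      by (rule measurable_compose[OF _ cm]) (use that in measurable)
  qed (use cts_step_bounds[OF xy] in auto)
  fix e :: real assume e: "0 < e"
  define V where "V = measure lebesgue D"
  have V: "0 \<le> V" by (simp add: V_def)
  \<comment> \<open>Chosen so that the Lipschitz bound \<open>\<epsilon> / (y - x)\<close>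
    integrates to at most \<open>e / 2\<close>; the \<open>+ 1\<close> covers the case
    \<open>V = 0\<close>.\<close>
  define \<epsilon> where "\<epsilon> = e * (y - x) / (2 * (V + 1))"
  have \<epsilon>: "0 < \<epsilon>" using e xy V by (simp add: \<epsilon>_def)
  have "(\<lambda>r. measure lebesgue {p \<in> D. cmod (\<phi> r p - \<kappa> p) > \<epsilon>}) \<longlonglongrightarrow> 0"
    using lim \<epsilon> by (simp add: tendsto_in_measure_def)
  then obtain no where no: "\<And>r. no \<le> r \<Longrightarrow> measure lebesgue {p \<in> D. cmod (\<phi> r p - \<kappa> p) > \<epsilon>} < e / 2"
    using LIMSEQ_D[of _ 0 "e / 2"] e by fastforce
  show "\<exists>no. \<forall>r\<ge>no. norm ((LINT z|lebesgue_on D. cts_step x y (cmod (\<phi> r z))) - (LINT z|lebesgue_on D. cts_step x y (cmod (\<kappa> z)))) < e"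
  proof (intro exI allI impI)
    fix r assume r: "no \<le> r"
    let ?B = "{p \<in> D. cmod (\<phi> r p - \<kappa> p) > \<epsilon>}"
    have Bs: "?B \<in> sets (lebesgue_on D)"
    proof -
      have "{p \<in> space (lebesgue_on D). cmod (\<phi> r p - \<kappa> p) > \<epsilon>} \<in> sets (lebesgue_on D)"
        using m(1)[of r] m(2) by measurable
      then show ?thesis by simp
    qed
    have fB: "integrable (lebesgue_on D) (indicator ?B :: 'a \<Rightarrow> real)"
      using Bs by (intro integrable_real_indicator) (auto simp: less_top[symmetric])
    have le: "\<bar>cts_step x y (cmod (\<phi> r z)) - cts_step x y (cmod (\<kappa> z))\<bar> \<le> \<epsilon> / (y - x) + indicator ?B z" if "z \<in> D" for z
    proof (cases "z \<in> ?B")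
      case True
      have "\<bar>cts_step x y (cmod (\<phi> r z)) - cts_step x y (cmod (\<kappa> z))\<bar> \<le> 1"
        using cts_step_bounds[OF xy, of "cmod (\<phi> r z)"] cts_step_bounds[OF xy, of "cmod (\<kappa> z)"] by linarith
      moreover have "0 \<le> \<epsilon> / (y - x)" using \<epsilon> xy by simp
      ultimately show ?thesis using True by simp
    next
      case False
      have "\<bar>cmod (\<phi> r z) - cmod (\<kappa> z)\<bar> \<le> cmod (\<phi> r z - \<kappa> z)" by (rule norm_triangle_ineq3)
      also have "\<dots> \<le> \<epsilon>" using False that by auto
      finally have "\<bar>cmod (\<phi> r z) - cmod (\<kappa> z)\<bar> / (y - x) \<le> \<epsilon> / (y - x)" using xy by (intro divide_right_mono) auto
      then show ?thesis using cts_step_lipschitz[OF xy, of "cmod (\<phi> r z)" "cmod (\<kappa> z)"] False by simp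
    qed
    have "\<bar>(LINT z|lebesgue_on D. cts_step x y (cmod (\<phi> r z))) - (LINT z|lebesgue_on D. cts_step x y (cmod (\<kappa> z)))\<bar>
        = \<bar>LINT z|lebesgue_on D. cts_step x y (cmod (\<phi> r z)) - cts_step x y (cmod (\<kappa> z))\<bar>"
      using int m by simp
    also have "\<dots> \<le> (LINT z|lebesgue_on D. \<bar>cts_step x y (cmod (\<phi> r z)) - cts_step x y (cmod (\<kappa> z))\<bar>)"
      by (rule integral_abs_bound)
    also have "\<dots> \<le> (LINT z|lebesgue_on D. \<epsilon> / (y - x) + indicator ?B z)"
      using int m fB le by (intro integral_mono) auto
    also have "\<dots> = V * (\<epsilon> / (y - x)) + measure lebesgue ?B"
    proof -
      have "(LINT z|lebesgue_on D. \<epsilon> / (y - x) + indicator ?B z)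
          = (LINT z|lebesgue_on D. \<epsilon> / (y - x)) + (LINT z|lebesgue_on D. indicator ?B z)"
        using fB by (intro Bochner_Integration.integral_add) auto
      moreover have "(LINT z|lebesgue_on D. indicator ?B z) = measure (lebesgue_on D) ?B"
        using Bs by (subst Bochner_Integration.integral_indicator) (auto intro!: arg_cong[of _ _ "measure (lebesgue_on D)"])
      moreover have "measure (lebesgue_on D) ?B = measure lebesgue ?B"
        using D by (intro measure_restrict_space) auto
      moreover have "measure (lebesgue_on D) D = V"
        unfolding V_def using D by (intro measure_restrict_space) auto
      ultimately show ?thesis by simp
    qed
    also have "\<dots> < e"
    proof -
      have "V * (\<epsilon> / (y - x)) = V * e / (2 * (V + 1))" using xy by (simp add: \<epsilon>_def)
      also have "\<dots> \<le> e / 2" using V e by (simp add: field_simps)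
      finally show ?thesis using no[OF r] by linarith
    qed
    finally show "norm ((LINT z|lebesgue_on D. cts_step x y (cmod (\<phi> r z))) - (LINT z|lebesgue_on D. cts_step x y (cmod (\<kappa> z)))) < e"
      by simp
  qed
qed

text \<open>Three errors: the sequence against its approximating sums, by perturbation; these sums
  against their own symbols, by moments; and these symbols against \<open>\<kappa>\<close>, by
  convergence in measure. The index \<open>r\<close> is fixed first, since the range of admissible
  \<open>k\<close> depends on it.\<close>

theorem glt_cts_step:
  fixes n :: "nat \<Rightarrow> nat ^ 'd::{finite,linorder}"
  assumes glt: "glt_sequence n A \<kappa>" and xy: "x < y"
  shows "(\<lambda>k. (\<Sum>s\<in>#singular_values (A k). cts_step x y s) / real (level_size (n k)))
    \<longlonglongrightarrow> (LINT z|lebesgue_on (unit_cube \<times> pi_cube). cts_step x y (cmod (\<kappa> (fst z) (snd z)))) / (2 * pi) ^ CARD('d)"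
proof -
  let ?D = "unit_cube \<times> pi_cube :: ((real ^ 'd::{finite,linorder}) \<times> (real ^ 'd::{finite,linorder})) set"
  let ?V = "(2 * pi) ^ CARD('d)"
  have lim: "\<And>s. filterlim (\<lambda>k. n k $ s) at_top sequentially"
    and carr: "\<And>k. A k \<in> carrier_mat (level_size (n k)) (level_size (n k))"
    and m\<kappa>: "(\<lambda>(x, \<theta>). \<kappa> x \<theta>) \<in> borel_measurable (lebesgue_on ?D)"
    using glt by (auto simp: glt_sequence_def)
  obtain M b f where bf: "\<And>r l. l < M r \<Longrightarrow> continuous_on unit_cube (b r l) \<and> trig_poly (f r l)"
    and im: "tendsto_in_measure ?D (\<lambda>r (x, \<theta>). \<Sum>l<M r. b r l x * f r l \<theta>) (\<lambda>(x, \<theta>). \<kappa> x \<theta>)"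
    and acs: "approx_class (\<lambda>k. level_size (n k)) (\<lambda>r k. sampling_toeplitz_sum (n k) (M r) (b r) (f r)) A"
    using glt unfolding glt_sequence_def by blast
  obtain c \<omega> where c: "c \<longlonglongrightarrow> 0" and \<omega>: "\<omega> \<longlonglongrightarrow> 0"
    and ev: "\<And>r. \<forall>\<^sub>F k in sequentially. \<exists>R E. R \<in> carrier_mat (level_size (n k)) (level_size (n k)) \<and>
        E \<in> carrier_mat (level_size (n k)) (level_size (n k)) \<and>
        A k = sampling_toeplitz_sum (n k) (M r) (b r) (f r) + R + E \<and>
        real (mat_rank R) \<le> c r * real (level_size (n k)) \<and> spectral_norm E \<le> \<omega> r"
    using acs unfolding approx_class_def by blast
  define \<kappa>r where "\<kappa>r r x \<theta> = (\<Sum>l<M r. b r l x * f r l \<theta>)" for r x \<theta>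
  have lt: "locally_toeplitz n (\<lambda>k. sampling_toeplitz_sum (n k) (M r) (b r) (f r)) (\<kappa>r r)" for r
    unfolding \<kappa>r_def[abs_def] by (rule locally_toeplitz_sampling_toeplitz_sum[OF lim bf])
  define I where "I r = (LINT z|lebesgue_on ?D. cts_step x y (cmod (\<kappa>r r (fst z) (snd z)))) / ?V" for r
  define I0 where "I0 = (LINT z|lebesgue_on ?D. cts_step x y (cmod (\<kappa> (fst z) (snd z)))) / ?V"
  have Ilim: "I \<longlonglongrightarrow> I0"
  proof -
    have "(\<lambda>r. LINT z|lebesgue_on ?D. cts_step x y (cmod ((\<lambda>(x, \<theta>). \<kappa>r r x \<theta>) z))) \<longlonglongrightarrow> (LINT z|lebesgue_on ?D. cts_step x y (cmod ((\<lambda>(x, \<theta>). \<kappa> x \<theta>) z)))"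
    proof (rule integral_cts_step_tendsto_in_measure[OF measure_symbol_domain(2) xy _ m\<kappa>])
      show "(\<lambda>(x, \<theta>). \<kappa>r r x \<theta>) \<in> borel_measurable (lebesgue_on ?D)" for r
        using continuous_imp_measurable_on_sets_lebesgue[OF locally_toeplitz_continuous[OF lt[of r]]] measure_symbol_domain(2)
        by (auto simp: case_prod_unfold fmeasurableD)
      show "tendsto_in_measure ?D (\<lambda>r (x, \<theta>). \<kappa>r r x \<theta>) (\<lambda>(x, \<theta>). \<kappa> x \<theta>)"
        using im by (simp add: \<kappa>r_def)
    qed
    then show ?thesis unfolding I_def I0_def by (intro tendsto_divide tendsto_const) (auto simp: case_prod_unfold)
  qed
  define \<Phi> where "\<Phi> X k = (\<Sum>s\<in>#singular_values (X k). cts_step x y s) / real (level_size (n k))" for X k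
  have "\<Phi> A \<longlonglongrightarrow> I0"
  proof (rule LIMSEQ_I)
    fix e :: real assume e: "0 < e"
    have L: "(\<lambda>r. c r + \<omega> r / (y - x)) \<longlonglongrightarrow> 0 + 0 / (y - x)"
      using xy by (intro tendsto_intros c \<omega>) auto
    have "\<forall>\<^sub>F r in sequentially. c r + \<omega> r / (y - x) < e / 3"
      using order_tendstoD(2)[OF L, of "e / 3"] e by simp
    moreover have "\<forall>\<^sub>F r in sequentially. norm (I r - I0) < e / 3"
      using LIMSEQ_D[OF Ilim, of "e / 3"] e by (auto simp: eventually_sequentially)
    ultimately have "\<forall>\<^sub>F r in sequentially. c r + \<omega> r / (y - x) < e / 3 \<and> norm (I r - I0) < e / 3"
      by (rule eventually_conj)
    then obtain r where r: "c r + \<omega> r / (y - x) < e / 3" "norm (I r - I0) < e / 3"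
      unfolding eventually_sequentially by blast
    define B where "B k = sampling_toeplitz_sum (n k) (M r) (b r) (f r)" for k
    have "\<Phi> B \<longlonglongrightarrow> I r"
      using locally_toeplitz_cts_step[OF lim lt[of r] xy] by (simp add: \<Phi>_def[abs_def] I_def B_def)
    then have "\<forall>\<^sub>F k in sequentially. norm (\<Phi> B k - I r) < e / 3"
      using LIMSEQ_D[of "\<Phi> B" "I r" "e / 3"] e by (auto simp: eventually_sequentially)
    then have "\<forall>\<^sub>F k in sequentially. norm (\<Phi> A k - I0) < e"
      using ev[of r] eventually_all_levels[OF lim, of 1]
    proof eventually_elim
      case (elim k)
      then obtain R E where RE: "R \<in> carrier_mat (level_size (n k)) (level_size (n k))"
        "E \<in> carrier_mat (level_size (n k)) (level_size (n k))"
        "A k = B k + R + E" "real (mat_rank R) \<le> c r * real (level_size (n k))" "spectral_norm E \<le> \<omega> r"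
        by (auto simp: B_def)
      have pos: "0 < real (level_size (n k))" using elim(3) by (auto simp: level_size_def Suc_le_eq intro!: prod_pos)
      have Bc: "B k \<in> carrier_mat (level_size (n k)) (level_size (n k))" by (simp add: B_def)
      have "\<bar>(\<Sum>s\<in>#singular_values (A k). cts_step x y s) - (\<Sum>s\<in>#singular_values (B k). cts_step x y s)\<bar>
          \<le> real (mat_rank R) + real (level_size (n k)) * (\<omega> r / (y - x))"
        by (rule sum_cts_step_perturbation[OF carr Bc RE(1,2,3) xy RE(5)])
      also have "\<dots> \<le> real (level_size (n k)) * (c r + \<omega> r / (y - x))"
        using RE(4) by (simp add: algebra_simps)
      finally have "\<bar>\<Phi> A k - \<Phi> B k\<bar> \<le> c r + \<omega> r / (y - x)"
        using pos by (simp add: \<Phi>_def diff_divide_distrib[symmetric] abs_divide divide_le_eq mult.commute)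
      then show ?case using elim(1) r unfolding real_norm_def by linarith
    qed
    then show "\<exists>no. \<forall>k\<ge>no. norm (\<Phi> A k - I0) < e" by (simp add: eventually_sequentially)
  qed
  then show ?thesis by (simp add: \<Phi>_def[abs_def] I0_def)
qed

section \<open>Uniqueness of the symbol\<close>

lemma fourier_coeff_uminus: "fourier_coeff (\<lambda>\<theta>. - f \<theta>) k = - fourier_coeff f k"
  by (simp add: fourier_coeff_def)

lemma tendsto_in_measure_diff:
  assumes D: "D \<in> lmeasurable"
    and m: "\<And>r. \<phi> r \<in> borel_measurable (lebesgue_on D)" "\<kappa> \<in> borel_measurable (lebesgue_on D)"
      "\<And>r. \<phi>' r \<in> borel_measurable (lebesgue_on D)" "\<kappa>' \<in> borel_measurable (lebesgue_on D)"
    and lim: "tendsto_in_measure D \<phi> \<kappa>" "tendsto_in_measure D \<phi>' \<kappa>'"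
  shows "tendsto_in_measure D (\<lambda>r p. \<phi> r p - \<phi>' r p) (\<lambda>p. \<kappa> p - \<kappa>' p)"
  unfolding tendsto_in_measure_def
proof (intro allI impI)
  fix \<epsilon> :: real assume \<epsilon>: "0 < \<epsilon>"
  have meas: "{p \<in> D. \<delta> < cmod (f p - g p)} \<in> lmeasurable"
    if "f \<in> borel_measurable (lebesgue_on D)" "g \<in> borel_measurable (lebesgue_on D)" for f g \<delta>
  proof -
    have "{p \<in> space (lebesgue_on D). \<delta> < cmod (f p - g p)} \<in> sets (lebesgue_on D)"
      using that by measurable
    then have "{p \<in> D. \<delta> < cmod (f p - g p)} \<in> sets lebesgue"
      using D by (auto simp: sets_restrict_space_iff)
    then show ?thesis by (intro fmeasurableI2[OF D]) auto
  qed
  have "(\<lambda>r. measure lebesgue {p \<in> D. cmod (\<phi> r p - \<kappa> p) > \<epsilon> / 2} + measure lebesgue {p \<in> D. cmod (\<phi>' r p - \<kappa>' p) > \<epsilon> / 2}) \<longlonglongrightarrow> 0 + 0"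
    using lim[unfolded tendsto_in_measure_def] half_gt_zero[OF \<epsilon>] by (intro tendsto_add) blast+
  then have 0: "(\<lambda>r. measure lebesgue {p \<in> D. cmod (\<phi> r p - \<kappa> p) > \<epsilon> / 2} + measure lebesgue {p \<in> D. cmod (\<phi>' r p - \<kappa>' p) > \<epsilon> / 2}) \<longlonglongrightarrow> 0"
    by simp
  show "(\<lambda>r. measure lebesgue {p \<in> D. cmod (\<phi> r p - \<phi>' r p - (\<kappa> p - \<kappa>' p)) > \<epsilon>}) \<longlonglongrightarrow> 0"
  proof (rule Lim_null_comparison[OF always_eventually 0], rule allI)
    fix r
    let ?A = "{p \<in> D. cmod (\<phi> r p - \<kappa> p) > \<epsilon> / 2}" and ?B = "{p \<in> D. cmod (\<phi>' r p - \<kappa>' p) > \<epsilon> / 2}"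
    have AB: "?A \<in> lmeasurable" "?B \<in> lmeasurable" by (intro meas m)+
    have sub: "{p \<in> D. cmod (\<phi> r p - \<phi>' r p - (\<kappa> p - \<kappa>' p)) > \<epsilon>} \<subseteq> ?A \<union> ?B"
    proof
      fix p assume p: "p \<in> {p \<in> D. cmod (\<phi> r p - \<phi>' r p - (\<kappa> p - \<kappa>' p)) > \<epsilon>}"
      have "cmod (\<phi> r p - \<phi>' r p - (\<kappa> p - \<kappa>' p)) \<le> cmod (\<phi> r p - \<kappa> p) + cmod (\<phi>' r p - \<kappa>' p)"
        using norm_triangle_ineq4[of "\<phi> r p - \<kappa> p" "\<phi>' r p - \<kappa>' p"] by (simp add: algebra_simps)
      then show "p \<in> ?A \<union> ?B" using p by auto
    qed
    have "measure lebesgue {p \<in> D. cmod (\<phi> r p - \<phi>' r p - (\<kappa> p - \<kappa>' p)) > \<epsilon>} \<le> measure lebesgue (?A \<union> ?B)"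
    proof (rule measure_mono_fmeasurable[OF sub _ fmeasurable.Un[OF AB]])
      have "(\<lambda>p. \<phi> r p - \<phi>' r p) \<in> borel_measurable (lebesgue_on D)" "(\<lambda>p. \<kappa> p - \<kappa>' p) \<in> borel_measurable (lebesgue_on D)"
        using m by auto
      from meas[OF this] show "{p \<in> D. cmod (\<phi> r p - \<phi>' r p - (\<kappa> p - \<kappa>' p)) > \<epsilon>} \<in> sets lebesgue"
        by (simp add: fmeasurableD)
    qed
    also have "\<dots> \<le> measure lebesgue ?A + measure lebesgue ?B"
      using AB by (intro measure_Un_le) (auto simp: fmeasurableD)
    finally show "norm (measure lebesgue {p \<in> D. cmod (\<phi> r p - \<phi>' r p - (\<kappa> p - \<kappa>' p)) > \<epsilon>}) \<le> measure lebesgue ?A + measure lebesgue ?B"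
      by simp
  qed
qed

lemma trig_poly_uminus: "trig_poly f \<Longrightarrow> trig_poly (\<lambda>\<theta>. - f \<theta>)"
proof -
  assume "trig_poly f"
  then obtain K c where "finite K" "f = (\<lambda>\<theta>. \<Sum>k\<in>K. c k * exp (\<i> * complex_of_real (int_dot k \<theta>)))"
    unfolding trig_poly_def by blast
  then show "trig_poly (\<lambda>\<theta>. - f \<theta>)"
    unfolding trig_poly_def by (intro exI[of _ K] exI[of _ "\<lambda>k. - c k"]) (simp add: sum_negf)
qed

lemma trig_poly_continuous: "trig_poly f \<Longrightarrow> continuous_on S f"
  unfolding trig_poly_def
  by (auto intro!: continuous_intros continuous_on_compose2[OF continuous_int_dot[of UNIV]])

text \<open>It joins two families of terms into one, as in the difference of two approximating
  sums.\<close>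

lemma sum_lessThan_add_split:
  fixes M :: nat
  shows "(\<Sum>l<M + M'. if l < M then g l else h (l - M)) = (\<Sum>l<M. g l) + (\<Sum>l<M'. h l :: 'a::comm_monoid_add)"
  by (induction M') (auto simp: add.assoc)

text \<open>The two decompositions of the same matrix are subtracted, 0 = (B - B') + (R - R') + (E -
  E'), and the bounds for ranks and norms add up.\<close>

lemma glt_sequence_diff_zero:
  fixes n :: "nat \<Rightarrow> nat ^ 'd::{finite,linorder}"
  assumes glt: "glt_sequence n A \<kappa>" and glt': "glt_sequence n A \<kappa>'"
  shows "glt_sequence n (\<lambda>k. 0\<^sub>m (level_size (n k)) (level_size (n k))) (\<lambda>x \<theta>. \<kappa> x \<theta> - \<kappa>' x \<theta>)"
proof -
  let ?D = "unit_cube \<times> pi_cube :: ((real ^ 'd::{finite,linorder}) \<times> (real ^ 'd::{finite,linorder})) set"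
  let ?N = "\<lambda>k. level_size (n k)"
  have lim: "\<And>s. filterlim (\<lambda>k. n k $ s) at_top sequentially"
    and m\<kappa>: "(\<lambda>(x, \<theta>). \<kappa> x \<theta>) \<in> borel_measurable (lebesgue_on ?D)" "(\<lambda>(x, \<theta>). \<kappa>' x \<theta>) \<in> borel_measurable (lebesgue_on ?D)"
    using glt glt' by (auto simp: glt_sequence_def)
  obtain M b f where bf: "\<And>r l. l < M r \<Longrightarrow> continuous_on unit_cube (b r l) \<and> trig_poly (f r l)"
    and im: "tendsto_in_measure ?D (\<lambda>r (x, \<theta>). \<Sum>l<M r. b r l x * f r l \<theta>) (\<lambda>(x, \<theta>). \<kappa> x \<theta>)"
    and acs: "approx_class ?N (\<lambda>r k. sampling_toeplitz_sum (n k) (M r) (b r) (f r)) A"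
    using glt unfolding glt_sequence_def by blast
  obtain M' b' f' where bf': "\<And>r l. l < M' r \<Longrightarrow> continuous_on unit_cube (b' r l) \<and> trig_poly (f' r l)"
    and im': "tendsto_in_measure ?D (\<lambda>r (x, \<theta>). \<Sum>l<M' r. b' r l x * f' r l \<theta>) (\<lambda>(x, \<theta>). \<kappa>' x \<theta>)"
    and acs': "approx_class ?N (\<lambda>r k. sampling_toeplitz_sum (n k) (M' r) (b' r) (f' r)) A"
    using glt' unfolding glt_sequence_def by blast
  obtain c \<omega> where c: "c \<longlonglongrightarrow> 0" and \<omega>: "\<omega> \<longlonglongrightarrow> 0"
    and ev: "\<And>r. \<forall>\<^sub>F k in sequentially. \<exists>R E. R \<in> carrier_mat (?N k) (?N k) \<and> E \<in> carrier_mat (?N k) (?N k) \<and>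
        A k = sampling_toeplitz_sum (n k) (M r) (b r) (f r) + R + E \<and>
        real (mat_rank R) \<le> c r * real (?N k) \<and> spectral_norm E \<le> \<omega> r"
    using acs unfolding approx_class_def by blast
  obtain c' \<omega>' where c': "c' \<longlonglongrightarrow> 0" and \<omega>': "\<omega>' \<longlonglongrightarrow> 0"
    and ev': "\<And>r. \<forall>\<^sub>F k in sequentially. \<exists>R E. R \<in> carrier_mat (?N k) (?N k) \<and> E \<in> carrier_mat (?N k) (?N k) \<and>
        A k = sampling_toeplitz_sum (n k) (M' r) (b' r) (f' r) + R + E \<and>
        real (mat_rank R) \<le> c' r * real (?N k) \<and> spectral_norm E \<le> \<omega>' r"
    using acs' unfolding approx_class_def by blast
  \<comment> \<open>The two families of terms are concatenated; the minus sign goes to the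
    trigonometric polynomials of the second one.\<close>
  define b'' where "b'' r l = (if l < M r then b r l else b' r (l - M r))" for r l
  define f'' where "f'' r l = (if l < M r then f r l else (\<lambda>\<theta>. - f' r (l - M r) \<theta>))" for r l
  have prod: "b'' r l x * f'' r l \<theta> = (if l < M r then b r l x * f r l \<theta> else - (b' r (l - M r) x * f' r (l - M r) \<theta>))" for r l x \<theta>
    by (simp add: b''_def f''_def)
  have symb: "(\<Sum>l<M r + M' r. b'' r l x * f'' r l \<theta>) = (\<Sum>l<M r. b r l x * f r l \<theta>) - (\<Sum>l<M' r. b' r l x * f' r l \<theta>)" for r x \<theta>
    unfolding prod using sum_lessThan_add_split[where M = "M r" and M' = "M' r" and g = "\<lambda>l. b r l x * f r l \<theta>" and h = "\<lambda>l. - (b' r l x * f' r l \<theta>)"]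
    by (simp add: sum_negf)
  have mat: "sampling_toeplitz_sum (n k) (M r + M' r) (b'' r) (f'' r)
      = sampling_toeplitz_sum (n k) (M r) (b r) (f r) - sampling_toeplitz_sum (n k) (M' r) (b' r) (f' r)" for r k
  proof (rule eq_matI)
    fix i j assume "i < dim_row (sampling_toeplitz_sum (n k) (M r) (b r) (f r) - sampling_toeplitz_sum (n k) (M' r) (b' r) (f' r))"
      "j < dim_col (sampling_toeplitz_sum (n k) (M r) (b r) (f r) - sampling_toeplitz_sum (n k) (M' r) (b' r) (f' r))"
    then have ij: "i < ?N k" "j < ?N k" by (auto simp: sampling_toeplitz_sum_def)
    let ?x = "grid_point (n k) (int_index (n k) i)" and ?m = "int_index (n k) i - int_index (n k) j"
    have "b'' r l ?x * fourier_coeff (f'' r l) ?m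
        = (if l < M r then b r l ?x * fourier_coeff (f r l) ?m else - (b' r (l - M r) ?x * fourier_coeff (f' r (l - M r)) ?m))" for l
      by (simp add: b''_def f''_def fourier_coeff_uminus)
    then have "(\<Sum>l<M r + M' r. b'' r l ?x * fourier_coeff (f'' r l) ?m)
        = (\<Sum>l<M r. b r l ?x * fourier_coeff (f r l) ?m) - (\<Sum>l<M' r. b' r l ?x * fourier_coeff (f' r l) ?m)"
      using sum_lessThan_add_split[where M = "M r" and M' = "M' r" and g = "\<lambda>l. b r l ?x * fourier_coeff (f r l) ?m"
          and h = "\<lambda>l. - (b' r l ?x * fourier_coeff (f' r l) ?m)"]
      by (simp add: sum_negf)
    moreover have "(X - Z) $$ (i, j) = X $$ (i, j) - Z $$ (i, j)" if "Z \<in> carrier_mat (?N k) (?N k)" for X Z :: "complex mat"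
      using that ij by auto
    note this[OF sampling_toeplitz_sum_carrier]
    ultimately show "sampling_toeplitz_sum (n k) (M r + M' r) (b'' r) (f'' r) $$ (i, j)
      = (sampling_toeplitz_sum (n k) (M r) (b r) (f r) - sampling_toeplitz_sum (n k) (M' r) (b' r) (f' r)) $$ (i, j)"
      using ij by (simp add: sampling_toeplitz_sum_index)
  qed (auto simp: sampling_toeplitz_sum_def)
  have cont: "\<And>r l. l < M r + M' r \<Longrightarrow> continuous_on unit_cube (b'' r l) \<and> trig_poly (f'' r l)"
    using bf bf' by (auto simp: b''_def f''_def intro!: trig_poly_uminus)
  have meas: "(\<lambda>(x, \<theta>). \<Sum>l<M r. b r l x * f r l \<theta>) \<in> borel_measurable (lebesgue_on ?D)"
    if "\<And>r l. l < M r \<Longrightarrow> continuous_on unit_cube (b r l) \<and> trig_poly (f r l)" for M b r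
      and f :: "nat \<Rightarrow> nat \<Rightarrow> real ^ 'd::{finite,linorder} \<Rightarrow> complex"
  proof -
    have "continuous_on ?D (\<lambda>p. \<Sum>l<M r. b r l (fst p) * f r l (snd p))"
    proof (intro continuous_on_sum continuous_on_mult)
      fix l assume "l \<in> {..<M r}"
      then have bc: "continuous_on unit_cube (b r l)" and fc: "trig_poly (f r l)" using that by auto
      show "continuous_on ?D (\<lambda>p. b r l (fst p))"
        by (rule continuous_on_compose2[OF bc continuous_on_fst[OF continuous_on_id]]) auto
      show "continuous_on ?D (\<lambda>p. f r l (snd p))"
        by (rule continuous_on_compose2[OF trig_poly_continuous[OF fc, of UNIV] continuous_on_snd[OF continuous_on_id]]) auto
    qed
    then show ?thesis
      using continuous_imp_measurable_on_sets_lebesgue measure_symbol_domain(2) by (auto simp: case_prod_unfold fmeasurableD)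
  qed
  have "approx_class ?N (\<lambda>r k. sampling_toeplitz_sum (n k) (M r + M' r) (b'' r) (f'' r)) (\<lambda>k. 0\<^sub>m (?N k) (?N k))"
    unfolding approx_class_def
  proof (intro exI conjI allI)
    show "(\<lambda>r. c r + c' r) \<longlonglongrightarrow> 0" "(\<lambda>r. \<omega> r + \<omega>' r) \<longlonglongrightarrow> 0"
      using tendsto_add[OF c c'] tendsto_add[OF \<omega> \<omega>'] by auto
    fix r
    show "\<forall>\<^sub>F k in sequentially. \<exists>R E. R \<in> carrier_mat (?N k) (?N k) \<and> E \<in> carrier_mat (?N k) (?N k) \<and>
        0\<^sub>m (?N k) (?N k) = sampling_toeplitz_sum (n k) (M r + M' r) (b'' r) (f'' r) + R + E \<and>
        real (mat_rank R) \<le> (c r + c' r) * real (?N k) \<and> spectral_norm E \<le> \<omega> r + \<omega>' r"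
      using ev[of r] ev'[of r]
    proof eventually_elim
      case (elim k)
      let ?B = "sampling_toeplitz_sum (n k) (M r) (b r) (f r)" and ?B' = "sampling_toeplitz_sum (n k) (M' r) (b' r) (f' r)"
      obtain R E where RE: "R \<in> carrier_mat (?N k) (?N k)" "E \<in> carrier_mat (?N k) (?N k)"
        "A k = ?B + R + E" "real (mat_rank R) \<le> c r * real (?N k)" "spectral_norm E \<le> \<omega> r" using elim(1) by auto
      obtain R' E' where RE': "R' \<in> carrier_mat (?N k) (?N k)" "E' \<in> carrier_mat (?N k) (?N k)"
        "A k = ?B' + R' + E'" "real (mat_rank R') \<le> c' r * real (?N k)" "spectral_norm E' \<le> \<omega>' r" using elim(2) by auto
      have neg: "- R' \<in> carrier_mat (?N k) (?N k)" "- E' \<in> carrier_mat (?N k) (?N k)" using RE' by auto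
      have B: "?B \<in> carrier_mat (?N k) (?N k)" "?B' \<in> carrier_mat (?N k) (?N k)" by auto
      have "0\<^sub>m (?N k) (?N k) = (?B - ?B') + (R + - R') + (E + - E')"
      proof (rule eq_matI)
        fix i j assume "i < dim_row ((?B - ?B') + (R + - R') + (E + - E'))" "j < dim_col ((?B - ?B') + (R + - R') + (E + - E'))"
        then have ij: "i < ?N k" "j < ?N k" using RE'(2) by auto
        have add3: "(X + Y + Z) $$ (i, j) = X $$ (i, j) + Y $$ (i, j) + Z $$ (i, j)"
          if "Y \<in> carrier_mat (?N k) (?N k)" "Z \<in> carrier_mat (?N k) (?N k)" for X Y Z :: "complex mat"
          using that ij by auto
        have "(?B + R + E) $$ (i, j) = (?B' + R' + E') $$ (i, j)" by (simp only: RE(3)[symmetric] RE'(3)[symmetric])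
        then have "?B $$ (i, j) + R $$ (i, j) + E $$ (i, j) = ?B' $$ (i, j) + R' $$ (i, j) + E' $$ (i, j)"
          unfolding add3[OF RE(1,2)] add3[OF RE'(1,2)] .
        then show "0\<^sub>m (?N k) (?N k) $$ (i, j) = ((?B - ?B') + (R + - R') + (E + - E')) $$ (i, j)"
          using RE(1,2) RE'(1,2) carrier_matD[OF B(2)] ij by (auto simp: algebra_simps)
      qed (use RE' in auto)
      moreover have "real (mat_rank (R + - R')) \<le> (c r + c' r) * real (?N k)"
      proof -
        have "mat_rank (R + - R') \<le> mat_rank R + mat_rank R'"
          using mat_rank_add[OF RE(1) neg(1)] mat_rank_uminus[OF RE'(1)] by simp
        then have "real (mat_rank (R + - R')) \<le> real (mat_rank R) + real (mat_rank R')"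
          by linarith
        then show ?thesis using RE(4) RE'(4) by (simp add: distrib_right)
      qed
      moreover have "spectral_norm (E + - E') \<le> \<omega> r + \<omega>' r"
        using spectral_norm_add[OF RE(2) neg(2)] spectral_norm_uminus[OF RE'(2)] RE(5) RE'(5) by linarith
      ultimately show ?case
        unfolding mat using RE(1,2) neg by (intro exI[of _ "R + - R'"] exI[of _ "E + - E'"]) auto
    qed
  qed
  moreover have "tendsto_in_measure ?D (\<lambda>r (x, \<theta>). \<Sum>l<M r + M' r. b'' r l x * f'' r l \<theta>) (\<lambda>(x, \<theta>). \<kappa> x \<theta> - \<kappa>' x \<theta>)"
  proof -
    have m1: "(\<lambda>(x, \<theta>). \<Sum>l<M r. b r l x * f r l \<theta>) \<in> borel_measurable (lebesgue_on ?D)"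
      "(\<lambda>(x, \<theta>). \<Sum>l<M' r. b' r l x * f' r l \<theta>) \<in> borel_measurable (lebesgue_on ?D)" for r
      by (rule meas, use bf bf' in blast)+
    show ?thesis
      using tendsto_in_measure_diff[OF measure_symbol_domain(2) m1(1) m\<kappa>(1) m1(2) m\<kappa>(2) im im']
      unfolding symb by (simp add: case_prod_unfold)
  qed
  moreover have "(\<lambda>(x, \<theta>). \<kappa> x \<theta> - \<kappa>' x \<theta>) \<in> borel_measurable (lebesgue_on ?D)"
    using borel_measurable_diff[OF m\<kappa>] by (simp add: case_prod_unfold)
  ultimately show ?thesis
    unfolding glt_sequence_def using lim cont
    by (intro conjI allI exI[of _ "\<lambda>r. M r + M' r"] exI[of _ b''] exI[of _ f'']) auto
qed

text \<open>The function \<open>cts_step 0 1\<close> reaches its maximum 1 at nonpositive arguments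
  only. The singular values of zero matrices all vanish, so the mean of this step over the modulus
  of the difference of the symbols is 1, which forces that difference to vanish almost
  everywhere.\<close>

theorem glt_symbol_unique:
  fixes n :: "nat \<Rightarrow> nat ^ 'd::{finite,linorder}"
  assumes glt: "glt_sequence n A \<kappa>" and glt': "glt_sequence n A \<kappa>'"
  shows "AE z in lebesgue_on (unit_cube \<times> pi_cube). \<kappa> (fst z) (snd z) = \<kappa>' (fst z) (snd z)"
proof -
  let ?D = "unit_cube \<times> pi_cube :: ((real ^ 'd::{finite,linorder}) \<times> (real ^ 'd::{finite,linorder})) set"
  let ?Z = "\<lambda>k. 0\<^sub>m (level_size (n k)) (level_size (n k)) :: complex mat"
  define \<delta> where "\<delta> z = \<kappa> (fst z) (snd z) - \<kappa>' (fst z) (snd z)" for z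
  have glt0: "glt_sequence n ?Z (\<lambda>x \<theta>. \<kappa> x \<theta> - \<kappa>' x \<theta>)" by (rule glt_sequence_diff_zero[OF glt glt'])
  have lim: "\<And>s. filterlim (\<lambda>k. n k $ s) at_top sequentially"
    and m: "\<delta> \<in> borel_measurable (lebesgue_on ?D)"
    using glt0 by (auto simp: glt_sequence_def case_prod_unfold \<delta>_def[abs_def])
  have "(\<Sum>s\<in>#singular_values (?Z k). cts_step 0 1 s) = real (level_size (n k))" for k
  proof -
    let ?N = "level_size (n k)"
    obtain s u where s: "singular_basis ?N (?Z k) s u" using singular_basis_exists[of "?Z k" ?N] by auto
    have "spectral_norm (?Z k) \<le> 0" by (rule spectral_norm_le_row_col[of _ ?N]) auto
    then have "s j = 0" if "j < ?N" for j
      using singular_basis_le_spectral_norm[OF _ s that] s that by (force simp: singular_basis_def)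
    then show ?thesis unfolding sum_singular_values[OF s] by (simp add: cts_step_def)
  qed
  then have "(\<lambda>k. real (level_size (n k)) / real (level_size (n k)))
      \<longlonglongrightarrow> (LINT z|lebesgue_on ?D. cts_step 0 1 (cmod (\<delta> z))) / (2 * pi) ^ CARD('d)"
    using glt_cts_step[OF glt0, of 0 1] by (simp add: \<delta>_def)
  moreover have "\<forall>\<^sub>F k in sequentially. real (level_size (n k)) / real (level_size (n k)) = 1"
    using eventually_all_levels[OF lim, of 1]
  proof eventually_elim
    case (elim k)
    have "0 < level_size (n k)" using elim by (auto simp: level_size_def Suc_le_eq intro!: prod_pos)
    then show ?case by simp
  qed
  ultimately have "(\<lambda>k. 1) \<longlonglongrightarrow> (LINT z|lebesgue_on ?D. cts_step 0 1 (cmod (\<delta> z))) / (2 * pi) ^ CARD('d)"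
    by (rule Lim_transform_eventually)
  then have "1 = (LINT z|lebesgue_on ?D. cts_step 0 1 (cmod (\<delta> z))) / (2 * pi) ^ CARD('d)"
    by (simp only: LIMSEQ_const_iff)
  then have I: "(LINT z|lebesgue_on ?D. cts_step 0 1 (cmod (\<delta> z))) = (2 * pi) ^ CARD('d)"
    by (metis divide_eq_1_iff)
  interpret finite_measure "lebesgue_on ?D" by (rule finite_measure_symbol_domain)
  have int: "integrable (lebesgue_on ?D) (\<lambda>z. cts_step 0 1 (cmod (\<delta> z)))"
  proof (rule integrable_const_bound[of _ 1])
    show "(\<lambda>z. cts_step 0 1 (cmod (\<delta> z))) \<in> borel_measurable (lebesgue_on ?D)"
      by (rule measurable_compose[OF _ borel_measurable_continuous_onI[OF continuous_on_cts_step]]) (use m in auto)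
  qed (use cts_step_bounds[of 0 1] in auto)
  have "(LINT z|lebesgue_on ?D. 1 - cts_step 0 1 (cmod (\<delta> z))) = 0"
    using int I measure_symbol_domain[where 'd = 'd] by (simp add: measure_restrict_space)
  then have "AE z in lebesgue_on ?D. 1 - cts_step 0 1 (cmod (\<delta> z)) = 0"
    using int cts_step_bounds[of 0 1] by (subst (asm) integral_nonneg_eq_0_iff_AE) auto
  then show ?thesis
    by eventually_elim (auto simp: cts_step_def \<delta>_def split: if_splits)
qed

text \<open>Convergence against all \<open>cts_step x y\<close> implies weak convergence of the
  distributions of the singular values to the distribution of the modulus of the symbol. Weak
  convergence in turn admits every bounded continuous test function, in particular those of compact
  support.\<close>

theorem glt_imp_sv_distribution:
  fixes n :: "nat \<Rightarrow> nat ^ 'd::{finite,linorder}"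
  assumes glt: "glt_sequence n A \<kappa>" and pos: "\<And>k s. 0 < n k $ s"
  shows "sv_distribution A (unit_cube \<times> pi_cube) (\<lambda>(x, \<theta>). \<kappa> x \<theta>)"
proof -
  let ?D = "unit_cube \<times> pi_cube :: ((real ^ 'd::{finite,linorder}) \<times> (real ^ 'd::{finite,linorder})) set"
  define V where "V = (2 * pi) ^ CARD('d)"
  have V: "0 < V" by (simp add: V_def)
  define N where "N k = level_size (n k)" for k
  have N: "0 < N k" for k using pos by (auto simp: N_def level_size_def intro!: prod_pos)
  define g where "g z = cmod (\<kappa> (fst z) (snd z))" for z
  have lim: "\<And>s. filterlim (\<lambda>k. n k $ s) at_top sequentially"
    and carr: "\<And>k. A k \<in> carrier_mat (N k) (N k)"
    and m: "(\<lambda>(x, \<theta>). \<kappa> x \<theta>) \<in> borel_measurable (lebesgue_on ?D)"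
    using glt by (auto simp: glt_sequence_def N_def)
  have gm: "g \<in> borel_measurable (lebesgue_on ?D)"
    using measurable_compose[OF m borel_measurable_norm] by (simp add: g_def[abs_def] case_prod_unfold)
  have mD: "measure lebesgue ?D = V" "?D \<in> lmeasurable"
    using measure_symbol_domain[where 'd = 'd] by (auto simp: V_def)
  have "\<forall>k. \<exists>su. singular_basis (N k) (A k) (fst su) (snd su)"
    using singular_basis_exists[OF carr] by (metis fst_conv snd_conv)
  from choice[OF this] obtain su where su: "\<And>k. singular_basis (N k) (A k) (fst (su k)) (snd (su k))" by blast
  define s where "s k = fst (su k)" for k
  have s: "singular_basis (N k) (A k) (s k) (snd (su k))" for k using su by (simp add: s_def)
  \<comment> \<open>The empirical distribution of the singular values; \<open>M\<close> is the
    distribution of the modulus of the symbol under normalized Lebesgue measure. Positivity of the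
    levels makes each \<open>\<mu> k\<close> a probability measure.\<close>
  define \<mu> where "\<mu> k = distr (uniform_count_measure {..<N k}) borel (s k)" for k
  define M where "M = distr (density (lebesgue_on ?D) (\<lambda>_. ennreal (1 / V))) borel g"
  have int\<mu>: "integral\<^sup>L (\<mu> k) f = (1 / real (N k)) *\<^sub>R (\<Sum>j<N k. f (s k j))"
    if "f \<in> borel_measurable borel" for f :: "real \<Rightarrow> 'b::{banach,second_countable_topology}" and k
  proof -
    have "integral\<^sup>L (\<mu> k) f = integral\<^sup>L (uniform_count_measure {..<N k}) (\<lambda>j. f (s k j))"
      unfolding \<mu>_def by (rule integral_distr) (use that in auto)
    also have "\<dots> = (\<Sum>j<N k. (1 / real (N k)) *\<^sub>R f (s k j))"
      unfolding uniform_count_measure_def by (subst lebesgue_integral_point_measure_finite) auto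
    finally show ?thesis by (simp add: scaleR_sum_right)
  qed
  have intM: "integral\<^sup>L M f = (1 / V) *\<^sub>R (LINT z|lebesgue_on ?D. f (g z))"
    if f: "f \<in> borel_measurable borel" for f :: "real \<Rightarrow> 'b::{banach,second_countable_topology}"
  proof -
    have fg: "(\<lambda>z. f (g z)) \<in> borel_measurable (lebesgue_on ?D)" by (rule measurable_compose[OF gm f])
    have "integral\<^sup>L M f = integral\<^sup>L (density (lebesgue_on ?D) (\<lambda>_. ennreal (1 / V))) (\<lambda>z. f (g z))"
      unfolding M_def by (rule integral_distr) (use f gm in auto)
    also have "\<dots> = (LINT z|lebesgue_on ?D. (1 / V) *\<^sub>R f (g z))"
      by (rule integral_density) (use fg V in auto)
    finally show ?thesis by simp
  qed
  have r\<mu>: "real_distribution (\<mu> k)" for k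
  proof -
    interpret prob_space "uniform_count_measure {..<N k}"
      by (rule prob_space_uniform_count_measure) (use N[of k] in auto)
    show ?thesis unfolding \<mu>_def by (rule real_distribution_distr) auto
  qed
  have rM: "real_distribution M"
  proof -
    interpret prob_space "density (lebesgue_on ?D) (\<lambda>_. ennreal (1 / V))"
    proof (rule prob_spaceI)
      have "emeasure (density (lebesgue_on ?D) (\<lambda>_. ennreal (1 / V))) (space (lebesgue_on ?D)) = ennreal (1 / V) * emeasure (lebesgue_on ?D) (space (lebesgue_on ?D))"
        by (subst emeasure_density) (auto simp: nn_integral_cmult_indicator)
      also have "emeasure (lebesgue_on ?D) (space (lebesgue_on ?D)) = ennreal V"
        using mD by (simp add: emeasure_restrict_space emeasure_eq_measure2 fmeasurableD)
      also have "ennreal (1 / V) * ennreal V = 1"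
        using V by (simp add: ennreal_mult[symmetric])
      finally show "emeasure (density (lebesgue_on ?D) (\<lambda>_. ennreal (1 / V))) (space (density (lebesgue_on ?D) (\<lambda>_. ennreal (1 / V)))) = 1"
        by simp
    qed
    show ?thesis unfolding M_def by (rule real_distribution_distr) (use gm in auto)
  qed
  have wc: "weak_conv_m \<mu> M"
  proof (rule integral_cts_step_conv_imp_weak_conv[OF r\<mu> rM])
    fix x y :: real assume xy: "x < y"
    have cm: "cts_step x y \<in> borel_measurable borel"
      by (rule borel_measurable_continuous_onI[OF continuous_on_cts_step[OF xy]])
    show "(\<lambda>k. integral\<^sup>L (\<mu> k) (cts_step x y)) \<longlonglongrightarrow> integral\<^sup>L M (cts_step x y)"
      unfolding int\<mu>[OF cm] intM[OF cm]
      using glt_cts_step[OF glt xy] by (simp add: sum_singular_values[OF s] N_def[symmetric] V_def g_def)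
  qed
  have F: "(\<lambda>k. (\<Sum>s\<in>#singular_values (A k). F s) / of_nat (dim_row (A k)))
      \<longlonglongrightarrow> (LINT z|lebesgue_on ?D. F (cmod ((\<lambda>(x, \<theta>). \<kappa> x \<theta>) z))) / of_real (measure lebesgue ?D)"
    if F: "continuous_on UNIV F" "compact (closure {s. F s \<noteq> 0})" for F :: "real \<Rightarrow> complex"
  proof -
    have Fm: "F \<in> borel_measurable borel" by (rule borel_measurable_continuous_onI[OF F(1)])
    have "compact (F ` closure {s. F s \<noteq> 0})"
      by (rule compact_continuous_image[OF continuous_on_subset[OF F(1)] F(2)]) simp
    then have "bounded (F ` closure {s. F s \<noteq> 0})" by (rule compact_imp_bounded)
    then obtain B where "\<forall>y\<in>F ` closure {s. F s \<noteq> 0}. norm y \<le> B" unfolding bounded_iff ..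
    then have B: "\<And>t. t \<in> closure {s. F s \<noteq> 0} \<Longrightarrow> cmod (F t) \<le> B" by simp
    have Fb: "norm (F t) \<le> \<bar>B\<bar>" for t
    proof (cases "F t = 0")
      case False
      then have "t \<in> closure {s. F s \<noteq> 0}" using closure_subset[of "{s. F s \<noteq> 0}"] by blast
      from B[OF this] show ?thesis by linarith
    qed simp
    have "(\<lambda>k. integral\<^sup>L (\<mu> k) F) \<longlonglongrightarrow> integral\<^sup>L M F"
      by (rule weak_conv_imp_integral_bdd_continuous_conv[OF r\<mu> rM wc _ Fb])
        (use F(1) in \<open>auto simp: continuous_on_eq_continuous_at\<close>)
    then have "(\<lambda>k. (1 / real (N k)) *\<^sub>R (\<Sum>j<N k. F (s k j))) \<longlonglongrightarrow> (1 / V) *\<^sub>R (LINT z|lebesgue_on ?D. F (g z))"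
      unfolding int\<mu>[OF Fm] intM[OF Fm] .
    moreover have "(\<Sum>s\<in>#singular_values (A k). F s) / of_nat (dim_row (A k)) = (1 / real (N k)) *\<^sub>R (\<Sum>j<N k. F (s k j))" for k
      using carr[of k] unfolding sum_singular_values[OF s] by (simp add: scaleR_conv_of_real)
    moreover have "(LINT z|lebesgue_on ?D. F (cmod ((\<lambda>(x, \<theta>). \<kappa> x \<theta>) z))) / of_real (measure lebesgue ?D) = (1 / V) *\<^sub>R (LINT z|lebesgue_on ?D. F (g z))"
      unfolding mD(1) by (simp add: scaleR_conv_of_real g_def case_prod_unfold)
    ultimately show ?thesis by simp
  qed
  have "filterlim N at_top sequentially"
  proof (rule filterlim_at_top_mono)
    fix s0 :: 'd
    \<comment> \<open>\<open>undefined\<close> serves as some level of the index type; the total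
      size is at least the size of one level because the others are positive.\<close>
    show "filterlim (\<lambda>k. n k $ undefined) at_top sequentially" by (rule lim)
    show "\<forall>\<^sub>F k in sequentially. n k $ undefined \<le> N k"
    proof (rule always_eventually, rule allI)
      fix k
      define P where "P = (\<Prod>s\<in>UNIV - {undefined}. n k $ s)"
      have "N k = n k $ undefined * P"
        unfolding N_def level_size_def P_def by (rule prod.remove) auto
      moreover have "0 < P" unfolding P_def using pos by (intro prod_pos) auto
      ultimately show "n k $ undefined \<le> N k" by simp
    qed
  qed
  moreover have "(\<lambda>k. dim_row (A k)) = N" using carrier_matD(1)[OF carr] by blast
  ultimately have dim: "filterlim (\<lambda>k. dim_row (A k)) at_top sequentially" by simp
  have sq: "square_mat (A k)" for k using carrier_matD[OF carr, of k] by simp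
  show ?thesis
    unfolding sv_distribution_def
    by (intro conjI allI impI sq dim mD(2) m, simp add: mD(1) V, erule conjE, rule F)
qed

text \<open>Symbols agree almost everywhere, so the open set of disagreement in the interior of the
  domain is negligible and therefore empty. Closure adds the end points of the period and
  periodicity the rest of the line.\<close>

lemma periodic_glt_symbol_unique:
  assumes f: "periodic_glt_symbol X f" and g: "periodic_glt_symbol X g"
  shows "f = g"
proof -
  let ?D = "unit_cube \<times> pi_cube :: ((real ^ 1) \<times> (real ^ 1)) set"
  have fc: "continuous_on UNIV f" "\<And>\<theta>. f (\<theta> + 2 * pi) = f \<theta>"
    and gc: "continuous_on UNIV g" "\<And>\<theta>. g (\<theta> + 2 * pi) = g \<theta>"
    using f g by (auto simp: periodic_glt_symbol_def)
  have "AE z in lebesgue_on ?D. f (snd z $ 0) = g (snd z $ 0)"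
  proof -
    have "glt_sequence (\<lambda>n. \<chi> s::1. n) X (\<lambda>x \<theta>. f (\<theta> $ 0))" "glt_sequence (\<lambda>n. \<chi> s::1. n) X (\<lambda>x \<theta>. g (\<theta> $ 0))"
      using f g by (simp_all add: periodic_glt_symbol_def)
    from glt_symbol_unique[OF this] show ?thesis .
  qed
  then have "AE z in lebesgue. z \<in> ?D \<longrightarrow> f (snd z $ 0) = g (snd z $ 0)"
    using measure_symbol_domain(2)[where 'd = 1] by (subst (asm) AE_restrict_space_iff) (auto simp: fmeasurableD)
  then have neg: "negligible {z \<in> ?D. f (snd z $ 0) \<noteq> g (snd z $ 0)}"
    unfolding negligible_iff_null_sets eventually_ae_filter
    by (auto intro: null_sets_completion_subset)
  define W where "W = {z :: (real ^ 1) \<times> (real ^ 1). z \<in> box (0, \<chi> _. - pi) (1, \<chi> _. pi) \<and> f (snd z $ 0) \<noteq> g (snd z $ 0)}"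
  have "open W"
  proof -
    have "open {z :: (real ^ 1) \<times> (real ^ 1). f (snd z $ 0) \<noteq> g (snd z $ 0)}"
    proof (rule open_Collect_neq)
      show "continuous_on UNIV (\<lambda>z :: (real ^ 1) \<times> (real ^ 1). f (snd z $ 0))"
        by (rule continuous_on_compose2[OF fc(1)]) (auto intro!: continuous_intros)
      show "continuous_on UNIV (\<lambda>z :: (real ^ 1) \<times> (real ^ 1). g (snd z $ 0))"
        by (rule continuous_on_compose2[OF gc(1)]) (auto intro!: continuous_intros)
    qed
    then have "open (box (0, \<chi> _. - pi) (1, \<chi> _. pi) \<inter> {z :: (real ^ 1) \<times> (real ^ 1). f (snd z $ 0) \<noteq> g (snd z $ 0)})"
      by (intro open_Int open_box)
    moreover have "W = box (0, \<chi> _. - pi) (1, \<chi> _. pi) \<inter> {z. f (snd z $ 0) \<noteq> g (snd z $ 0)}"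
      unfolding W_def by blast
    ultimately show ?thesis by (simp only:)
  qed
  moreover have "negligible W"
  proof (rule negligible_subset[OF neg])
    have "box (0, \<chi> _. - pi) (1, \<chi> _. pi) \<subseteq> ?D"
      unfolding cbox_Pair_eq[symmetric] by (rule box_subset_cbox)
    then show "W \<subseteq> {z \<in> ?D. f (snd z $ 0) \<noteq> g (snd z $ 0)}" by (auto simp: W_def)
  qed
  ultimately have We: "W = {}" using open_not_negligible by blast
  have eq1: "f t = g t" if "- pi < t" "t < pi" for t
  proof (rule ccontr)
    assume "f t \<noteq> g t"
    define z :: "(real ^ 1) \<times> (real ^ 1)" where "z = (\<chi> _. 1 / 2, \<chi> _. t)"
    have "z \<in> box (0, \<chi> _. - pi) (1, \<chi> _. pi)"
      using that by (auto simp: z_def mem_box Basis_prod_def Basis_vec_def inner_axis inner_Pair)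
    then have "z \<in> W" using \<open>f t \<noteq> g t\<close> by (simp add: W_def z_def)
    with We show False by simp
  qed
  have eq2: "f t = g t" if "- pi \<le> t" "t \<le> pi" for t
  proof -
    have "closed {t. f t = g t}" by (intro closed_Collect_eq fc gc)
    moreover have "{- pi<..<pi} \<subseteq> {t. f t = g t}" using eq1 by auto
    ultimately have "closure {- pi<..<pi} \<subseteq> {t. f t = g t}" by (rule closure_minimal[rotated])
    moreover have "closure {- pi<..<pi} = {- pi..pi}" using pi_gt_zero by (intro closure_greaterThanLessThan) linarith
    ultimately show ?thesis using that by auto
  qed
  have per: "h (t + 2 * pi * of_int k) = h t" if "\<And>\<theta>. h (\<theta> + 2 * pi) = h \<theta>" for h :: "real \<Rightarrow> complex" and t k
  proof -
    have nat: "h (t + 2 * pi * real j) = h t" for j t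
    proof (induction j)
      case (Suc j)
      have "h (t + 2 * pi * real (Suc j)) = h ((t + 2 * pi * real j) + 2 * pi)" by (simp add: algebra_simps)
      then show ?case using that Suc by simp
    qed simp
    show ?thesis
    proof (cases "0 \<le> k")
      case True
      then show ?thesis using nat[of t "nat k"] by simp
    next
      case False
      then show ?thesis using nat[of "t + 2 * pi * of_int k" "nat (- k)"] by simp
    qed
  qed
  show ?thesis
  proof
    fix t
    \<comment> \<open>The number of periods by which \<open>t\<close> is moved into the interval
      from \<open>- pi\<close> to \<open>pi\<close>.\<close>
    define k where "k = \<lfloor>(t + pi) / (2 * pi)\<rfloor>"
    have "of_int k \<le> (t + pi) / (2 * pi)" "(t + pi) / (2 * pi) < of_int k + 1" by (auto simp: k_def)
    then have "of_int k * (2 * pi) \<le> t + pi" "t + pi < (of_int k + 1) * (2 * pi)"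
      using pi_gt_zero by (auto simp: pos_le_divide_eq pos_divide_less_eq)
    then have "f (t + 2 * pi * of_int (- k)) = g (t + 2 * pi * of_int (- k))"
      by (intro eq2) (auto simp: algebra_simps)
    then show "f t = g t" by (simp only: per[of f, OF fc(2)] per[of g, OF gc(2)])
  qed
qed

section \<open>Functions that are continuous almost everywhere\<close>

text \<open>The discontinuities are covered by an open \<open>U\<close> of small measure, and
  Tietze's theorem extends \<open>a\<close> from the compact complement \<open>K\<close> to a
  continuous \<open>b\<close>. The estimate must hold outside a compact set, which \<open>U\<close>
  is not. But at points of \<open>K\<close> the function \<open>a\<close> is continuous relative to
  the whole interval, so the estimate persists in a ball around each of them, and \<open>C\<close>
  is what these balls leave out.\<close>

lemma ae_continuous_approximation:
  fixes a :: "real \<Rightarrow> real"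
  assumes a: "AE x in lebesgue_on {0..1}. continuous (at x within {0..1}) a" and e: "0 < e"
  obtains b C U where "continuous_on {0..1} b" "compact C" "C \<subseteq> U" "open U" "emeasure lborel U \<le> ennreal e"
    "\<And>x. x \<in> {0..1} \<Longrightarrow> x \<notin> C \<Longrightarrow> \<bar>a x - b x\<bar> \<le> e"
proof -
  define D where "D = {x \<in> {0..1}. \<not> continuous (at x within {0..1}) a}"
  have "AE x in lebesgue. x \<in> {0..1} \<longrightarrow> continuous (at x within {0..1}) a"
    using a by (subst (asm) AE_restrict_space_iff) auto
  then have D: "D \<in> null_sets lebesgue"
    unfolding eventually_ae_filter D_def by (auto intro: null_sets_completion_subset)
  obtain U where U: "open U" "D \<subseteq> U" "U - D \<in> lmeasurable" "emeasure lebesgue (U - D) < ennreal e"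
    using sets_lebesgue_outer_open[of D e] D e by blast
  have "emeasure lebesgue U = emeasure lebesgue (U - D)"
    using emeasure_Diff_null_set[OF D, of U] U(1) by simp
  then have eU: "emeasure lborel U \<le> ennreal e"
    using U(1,4) by simp
  define K where "K = {0..1} - U"
  have K: "compact K" unfolding K_def using U(1) by (intro compact_diff) auto
  have contK: "continuous (at x within {0..1}) a" if "x \<in> K" for x
    using that U(2) by (auto simp: K_def D_def)
  have "continuous_on K a"
    using contK continuous_within_subset[of _ "{0..1}" a K] by (auto simp: continuous_on_eq_continuous_within K_def)
  moreover have "closedin (top_of_set {0..1}) K"
    using K compact_imp_closed by (auto simp: closedin_closed K_def)
  ultimately obtain b where b: "continuous_on {0..1} b" "\<And>x. x \<in> K \<Longrightarrow> b x = a x"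
    using Tietze_unbounded by blast
  have "\<exists>d>0. \<forall>y\<in>{0..1}. dist y x < d \<longrightarrow> \<bar>a y - b y\<bar> < e" if x: "x \<in> K" for x
  proof -
    have "continuous (at x within {0..1}) (\<lambda>y. a y - b y)"
      using contK[OF x] b(1) x by (intro continuous_intros) (auto simp: continuous_on_eq_continuous_within K_def)
    then obtain d where "d > 0" "\<And>y. y \<in> {0..1} \<Longrightarrow> dist y x < d \<Longrightarrow> dist (a y - b y) (a x - b x) < e"
      using e unfolding continuous_within_eps_delta by blast
    then show ?thesis using b(2)[OF x] by (auto simp: dist_real_def intro!: exI[of _ d])
  qed
  then obtain d where d: "\<And>x. x \<in> K \<Longrightarrow> d x > 0" "\<And>x y. x \<in> K \<Longrightarrow> y \<in> {0..1} \<Longrightarrow> dist y x < d x \<Longrightarrow> \<bar>a y - b y\<bar> < e"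
    by metis
  define W where "W = (\<Union>x\<in>K. ball x (d x))"
  define C where "C = {0..1} - W"
  have "open W" by (auto simp: W_def)
  then have "compact C" unfolding C_def by (intro compact_diff) auto
  moreover have "C \<subseteq> U"
  proof
    fix x assume x: "x \<in> C"
    show "x \<in> U"
    proof (rule ccontr)
      assume "x \<notin> U"
      then have "x \<in> K" using x by (auto simp: C_def K_def)
      then have "x \<in> W" unfolding W_def by (intro UN_I[of x]) (auto simp: d(1))
      then show False using x by (simp add: C_def)
    qed
  qed
  moreover have "\<bar>a x - b x\<bar> \<le> e" if "x \<in> {0..1}" "x \<notin> C" for x
  proof -
    have "x \<in> W" using that by (simp add: C_def)
    then obtain y where "y \<in> K" "dist x y < d y" by (auto simp: W_def dist_commute)
    then show ?thesis using d(2)[of y x] that by auto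
  qed
  ultimately show thesis using that b(1) U(1) eU by blast
qed

text \<open>Once the mesh is finer than the distance by which \<open>C\<close> can be thickened
  inside \<open>U\<close>, the cell to the left of each grid point in \<open>C\<close> lies in
  \<open>U\<close>. The cells are half-open, hence disjoint, and of length \<open>1 / m\<close>
  each.\<close>

lemma grid_count_compact:
  assumes C: "compact C" "C \<subseteq> U" "open U" and e: "emeasure lborel U \<le> ennreal e" "0 \<le> e"
  shows "\<forall>\<^sub>F m in sequentially. real (card {i. i < m \<and> real (i + 1) / real m \<in> C}) \<le> e * real m"
proof -
  obtain \<delta> where \<delta>: "\<delta> > 0" "(\<Union>x\<in>C. cball x \<delta>) \<subseteq> U"
    using compact_subset_open_imp_cball_epsilon_subset[OF C(1,3,2)] by blast
  obtain m0 where m0: "1 / real (Suc m0) < \<delta>"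
    using \<delta>(1) nat_approx_posE by blast
  have "real (card {i. i < m \<and> real (i + 1) / real m \<in> C}) \<le> e * real m" if m: "Suc m0 \<le> m" for m
  proof -
    let ?I = "{i. i < m \<and> real (i + 1) / real m \<in> C}"
    define J where "J i = {real i / real m<..real (i + 1) / real m}" for i :: nat
    have mp: "0 < real m" using m by simp
    have md: "1 / real m < \<delta>"
    proof -
      have "1 / real m \<le> 1 / real (Suc m0)" using m by (intro divide_left_mono) auto
      then show ?thesis using m0 by simp
    qed
    have sub: "J i \<subseteq> U" if "i \<in> ?I" for i
    proof
      fix x assume x: "x \<in> J i"
      have "real (i + 1) / real m - real i / real m = 1 / real m" by (simp add: diff_divide_distrib[symmetric])
      then have "dist (real (i + 1) / real m) x \<le> \<delta>"
        using x md by (auto simp: J_def dist_real_def)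
      then have "x \<in> cball (real (i + 1) / real m) \<delta>" by simp
      moreover have "real (i + 1) / real m \<in> C" using that by simp
      ultimately show "x \<in> U" using \<delta>(2) by blast
    qed
    have dis: "disjoint_family_on J ?I"
      unfolding disjoint_family_on_def
    proof (intro ballI impI)
      fix i j :: nat assume "i \<noteq> j"
      have "real (i + 1) / real m \<le> real j / real m" if "i < j" for i j :: nat
        using that mp by (intro divide_right_mono) auto
      then show "J i \<inter> J j = {}"
        using \<open>i \<noteq> j\<close> by (cases i j rule: linorder_cases) (fastforce simp: J_def)+
    qed
    have J: "emeasure lborel (J i) = ennreal (1 / real m)" for i
      unfolding J_def using mp by (subst emeasure_lborel_Ioc) (auto simp: diff_divide_distrib[symmetric] divide_right_mono)
    have "ennreal (real (card ?I) * (1 / real m)) = (\<Sum>i\<in>?I. emeasure lborel (J i))"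
      unfolding J by (simp add: ennreal_mult ennreal_of_nat_eq_real_of_nat del: times_divide_eq_right)
    also have "\<dots> = emeasure lborel (\<Union>i\<in>?I. J i)"
      by (rule sum_emeasure[OF _ dis]) (auto simp: J_def)
    also have "\<dots> \<le> emeasure lborel U"
      using sub C(3) by (intro emeasure_mono) auto
    also have "\<dots> \<le> ennreal e" by (rule e)
    finally have "ennreal (real (card ?I) * (1 / real m)) \<le> ennreal e" .
    then have "real (card ?I) * (1 / real m) \<le> e" using e(2) by (simp add: ennreal_le_iff)
    then show ?thesis using mp by (simp add: field_simps)
  qed
  then show ?thesis unfolding eventually_sequentially by blast
qed

text \<open>Enclosing \<open>D\<close> in the cube of radius \<open>r\<close> turns the strip over
  \<open>S\<close> into a product set, whose indicator factors over \<open>Basis\<close>.\<close>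

lemma emeasure_coordinate_strip:
  fixes b :: "'a::euclidean_space"
  assumes b: "b \<in> Basis" and S: "S \<in> sets borel"
    and D: "\<And>p b'. p \<in> D \<Longrightarrow> b' \<in> Basis \<Longrightarrow> \<bar>p \<bullet> b'\<bar> \<le> r" and r: "0 \<le> r"
  shows "emeasure lborel {p :: 'a. p \<bullet> b \<in> S \<and> (\<forall>b'\<in>Basis - {b}. \<bar>p \<bullet> b'\<bar> \<le> r)} = ennreal ((2 * r) ^ (DIM('a) - 1)) * emeasure lborel S"
    and "{p \<in> D. p \<bullet> b \<in> S} \<subseteq> {p :: 'a. p \<bullet> b \<in> S \<and> (\<forall>b'\<in>Basis - {b}. \<bar>p \<bullet> b'\<bar> \<le> r)}"
    and "{p :: 'a. p \<bullet> b \<in> S \<and> (\<forall>b'\<in>Basis - {b}. \<bar>p \<bullet> b'\<bar> \<le> r)} \<in> sets borel"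
proof -
  let ?T = "{p :: 'a. p \<bullet> b \<in> S \<and> (\<forall>b'\<in>Basis - {b}. \<bar>p \<bullet> b'\<bar> \<le> r)}"
  have "?T = ((\<lambda>p. p \<bullet> b) -` S) \<inter> (\<Inter>b'\<in>Basis. if b' = b then UNIV else {p. \<bar>p \<bullet> b'\<bar> \<le> r})"
    by (auto split: if_splits)
  also have "\<dots> \<in> sets borel"
  proof (intro sets.Int sets.finite_INT)
    show "(\<lambda>p. p \<bullet> b) -` S \<in> sets borel"
      using measurable_sets[of "\<lambda>p. p \<bullet> b" borel borel S] S by (simp add: borel_measurable_inner)
    show "(if b' = b then UNIV else {p. \<bar>p \<bullet> b'\<bar> \<le> r}) \<in> sets borel" for b'
      by (auto intro!: borel_closed closed_Collect_le continuous_intros)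
  qed auto
  finally show T: "?T \<in> sets borel" .
  show "{p \<in> D. p \<bullet> b \<in> S} \<subseteq> ?T" using D by auto
  define f where "f b' = (if b' = b then indicator S else indicator {- r..r} :: real \<Rightarrow> ennreal)" for b'
  have "indicator ?T p = (\<Prod>b'\<in>Basis. f b' (p \<bullet> b'))" for p
  proof -
    have "(\<Prod>b'\<in>Basis. f b' (p \<bullet> b')) = f b (p \<bullet> b) * (\<Prod>b'\<in>Basis - {b}. f b' (p \<bullet> b'))"
      by (rule prod.remove) (use b in auto)
    also have "(\<Prod>b'\<in>Basis - {b}. f b' (p \<bullet> b')) = (\<Prod>b'\<in>Basis - {b}. indicator {- r..r} (p \<bullet> b'))"
      by (intro prod.cong) (auto simp: f_def)
    also have "\<dots> = (if \<forall>b'\<in>Basis - {b}. \<bar>p \<bullet> b'\<bar> \<le> r then 1 else 0 :: ennreal)"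
    proof (cases "\<forall>b'\<in>Basis - {b}. \<bar>p \<bullet> b'\<bar> \<le> r")
      case True
      then show ?thesis by (intro trans[OF prod.neutral]) (auto simp: indicator_def abs_le_iff minus_le_iff)
    next
      case False
      then obtain b' where "b' \<in> Basis - {b}" "\<not> \<bar>p \<bullet> b'\<bar> \<le> r" by blast
      then have "(\<Prod>b'\<in>Basis - {b}. indicator {- r..r} (p \<bullet> b')) = (0 :: ennreal)"
        by (intro prod_zero bexI[of _ b']) (auto simp: indicator_def abs_le_iff minus_le_iff)
      then show ?thesis using False by auto
    qed
    finally show ?thesis by (auto simp: f_def indicator_def)
  qed
  then have "emeasure lborel ?T = (\<integral>\<^sup>+p. (\<Prod>b'\<in>Basis. f b' (p \<bullet> b')) \<partial>lborel)"
    using T by (simp flip: nn_integral_indicator)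
  also have "\<dots> = (\<Prod>b'\<in>Basis. \<integral>\<^sup>+x. f b' x \<partial>lborel)"
    by (rule nn_integral_lborel_prod) (use S in \<open>auto simp: f_def\<close>)
  also have "\<dots> = (\<integral>\<^sup>+x. f b x \<partial>lborel) * (\<Prod>b'\<in>Basis - {b}. \<integral>\<^sup>+x. f b' x \<partial>lborel)"
    by (rule prod.remove) (use b in auto)
  also have "(\<integral>\<^sup>+x. f b x \<partial>lborel) = emeasure lborel S"
    using S by (simp add: f_def)
  also have "(\<Prod>b'\<in>Basis - {b}. \<integral>\<^sup>+x. f b' x \<partial>lborel) = (\<Prod>b'\<in>Basis - {b}. ennreal (2 * r))"
    by (intro prod.cong) (use r in \<open>auto simp: f_def\<close>)
  also have "\<dots> = ennreal ((2 * r) ^ (DIM('a) - 1))"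
    using b r by (simp add: card_Diff_singleton ennreal_power)
  finally show "emeasure lborel ?T = ennreal ((2 * r) ^ (DIM('a) - 1)) * emeasure lborel S"
    by (simp add: mult.commute)
qed

section \<open>The coefficients of the fractional derivative\<close>

text \<open>The tangent at 1 of a concave power, obtained from Young's inequality with second
  argument 1.\<close>

lemma powr_le_tangent:
  fixes p x :: real
  assumes "0 < p" "p < 1" "0 \<le> x"
  shows "x powr p \<le> p * x + (1 - p)"
proof (cases "x = 0")
  case False
  then show ?thesis using Youngs_inequality_0[where \<alpha> = p and \<beta> = "1 - p" and a = x and b = 1] assms by simp
qed (use assms in simp)

text \<open>Concavity of the power. With \<open>x powr p\<close> factored out, the tangent at 1 is
  applied at \<open>(x + 1) / x\<close> and \<open>(x - 1) / x\<close>, where its two increments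
  cancel.\<close>

lemma frac_coeff_nonpos:
  assumes s: "0 < s" "s < 1" and l: "0 < l"
  shows "frac_coeff s l \<le> 0"
proof -
  define p where "p = 1 - s"
  have p: "0 < p" "p < 1" using s by (auto simp: p_def)
  define x where "x = real l"
  have x: "1 \<le> x" using l by (simp add: x_def)
  have "(x + 1) powr p = x powr p * ((x + 1) / x) powr p"
    using x by (simp add: powr_mult[symmetric])
  also have "\<dots> \<le> x powr p * (p * ((x + 1) / x) + (1 - p))"
    using x by (intro mult_left_mono powr_le_tangent p) auto
  finally have 1: "(x + 1) powr p \<le> x powr p * (p * ((x + 1) / x) + (1 - p))" .
  have "(x - 1) powr p = x powr p * ((x - 1) / x) powr p"
    using x by (simp add: powr_mult[symmetric])
  also have "\<dots> \<le> x powr p * (p * ((x - 1) / x) + (1 - p))"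
    using x by (intro mult_left_mono powr_le_tangent p) auto
  finally have "(x + 1) powr p + (x - 1) powr p \<le> x powr p * (p * ((x + 1) / x) + (1 - p)) + x powr p * (p * ((x - 1) / x) + (1 - p))"
    using 1 by linarith
  also have "\<dots> = 2 * x powr p"
    using x by (simp add: field_simps)
  finally show ?thesis using l by (simp add: frac_coeff_def p_def x_def)
qed

lemma sum_frac_coeff:
  assumes "s < 1"
  shows "(\<Sum>l<Suc L. frac_coeff s l) = (real L + 1) powr (1 - s) - real L powr (1 - s)"
proof (induction L)
  case 0
  then show ?case using assms by (simp add: frac_coeff_def)
next
  case (Suc L)
  then show ?case by (simp add: frac_coeff_def algebra_simps)
qed

text \<open>Apart from the coefficient 1 at 0, all coefficients are nonpositive, while the partial
  sums telescope to an increment of an increasing power and stay nonnegative. The absolute values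
  therefore sum to at most 2.\<close>

lemma summable_frac_coeff:
  assumes s: "0 < s" "s < 1"
  shows "summable (\<lambda>l. \<bar>frac_coeff s l\<bar>)"
proof (rule summableI_nonneg_bounded)
  fix L
  have "(\<Sum>l<L. \<bar>frac_coeff s l\<bar>) \<le> (\<Sum>l<Suc L. \<bar>frac_coeff s l\<bar>)" by simp
  also have "\<dots> = \<bar>frac_coeff s 0\<bar> + (\<Sum>l=1..<Suc L. \<bar>frac_coeff s l\<bar>)"
    by (simp add: lessThan_atLeast0 sum.atLeast_Suc_lessThan)
  also have "(\<Sum>l=1..<Suc L. \<bar>frac_coeff s l\<bar>) = - (\<Sum>l=1..<Suc L. frac_coeff s l)"
    unfolding sum_negf[symmetric] using frac_coeff_nonpos[OF s] by (intro sum.cong) auto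
  also have "(\<Sum>l=1..<Suc L. frac_coeff s l) = (\<Sum>l<Suc L. frac_coeff s l) - frac_coeff s 0"
    by (simp add: lessThan_atLeast0 sum.atLeast_Suc_lessThan)
  also have "(\<Sum>l<Suc L. frac_coeff s l) \<ge> 0"
    unfolding sum_frac_coeff[OF s(2)] using s by (simp add: powr_mono2)
  then have "\<bar>frac_coeff s 0\<bar> + - ((\<Sum>l<Suc L. frac_coeff s l) - frac_coeff s 0) \<le> 2"
    by (simp add: frac_coeff_def[of s 0])
  finally show "(\<Sum>l<L. \<bar>frac_coeff s l\<bar>) \<le> 2" .
qed simp

section \<open>Absolutely summable Fourier series\<close>

text \<open>Only nonnegative frequencies occur, because the matrices are lower triangular.\<close>

definition fourier_series :: "(nat \<Rightarrow> real) \<Rightarrow> real \<Rightarrow> complex" where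
  "fourier_series c t = (\<Sum>l. complex_of_real (c l) * exp (\<i> * of_real (real l * t)))"

definition fourier_partial_sum :: "nat \<Rightarrow> (nat \<Rightarrow> real) \<Rightarrow> real \<Rightarrow> complex" where
  "fourier_partial_sum L c t = (\<Sum>l<L. complex_of_real (c l) * exp (\<i> * of_real (real l * t)))"

definition abs_tail :: "(nat \<Rightarrow> real) \<Rightarrow> nat \<Rightarrow> real" where
  "abs_tail c L = (\<Sum>l. \<bar>c l\<bar>) - (\<Sum>l<L. \<bar>c l\<bar>)"

lemma abs_tail_tendsto_0: "summable (\<lambda>l. \<bar>c l\<bar>) \<Longrightarrow> abs_tail c \<longlonglongrightarrow> 0"
proof -
  assume "summable (\<lambda>l. \<bar>c l\<bar>)"
  then have "(\<lambda>L. (\<Sum>l. \<bar>c l\<bar>) - (\<Sum>l<L. \<bar>c l\<bar>)) \<longlonglongrightarrow> (\<Sum>l. \<bar>c l\<bar>) - (\<Sum>l. \<bar>c l\<bar>)"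
    by (intro tendsto_diff tendsto_const summable_LIMSEQ)
  then show ?thesis by (simp add: abs_tail_def[abs_def])
qed

lemma sum_abs_le_tail:
  assumes "summable (\<lambda>l. \<bar>c l\<bar>)"
  shows "(\<Sum>l\<in>{L..<n}. \<bar>c l\<bar>) \<le> abs_tail c L"
proof -
  have "(\<Sum>l\<in>{L..<n}. \<bar>c l\<bar>) + (\<Sum>l<L. \<bar>c l\<bar>) = (\<Sum>l\<in>{L..<n} \<union> {..<L}. \<bar>c l\<bar>)"
    by (rule sum.union_disjoint[symmetric]) auto
  also have "\<dots> \<le> (\<Sum>l. \<bar>c l\<bar>)" by (rule sum_le_suminf[OF assms]) auto
  finally show ?thesis by (simp add: abs_tail_def)
qed

lemma norm_fourier_term: "norm (complex_of_real (c l) * exp (\<i> * of_real (real l * t))) = \<bar>c l\<bar>"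
  by (simp add: norm_mult)

lemma fourier_series_error:
  assumes c: "summable (\<lambda>l. \<bar>c l\<bar>)"
  shows "cmod (fourier_partial_sum L c t - fourier_series c t) \<le> abs_tail c L"
proof -
  have s: "summable (\<lambda>l. norm (complex_of_real (c l) * exp (\<i> * of_real (real l * t))))"
    unfolding norm_fourier_term by (rule c)
  have "fourier_series c t = (\<Sum>l. complex_of_real (c (l + L)) * exp (\<i> * of_real (real (l + L) * t))) + fourier_partial_sum L c t"
    unfolding fourier_series_def fourier_partial_sum_def
    by (rule suminf_split_initial_segment[OF summable_norm_cancel[OF s]])
  then have "cmod (fourier_partial_sum L c t - fourier_series c t) = cmod (\<Sum>l. complex_of_real (c (l + L)) * exp (\<i> * of_real (real (l + L) * t)))"
    by (simp only: diff_add_eq_diff_diff_swap diff_self diff_0 norm_minus_cancel)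
  also have "\<dots> \<le> (\<Sum>l. norm (complex_of_real (c (l + L)) * exp (\<i> * of_real (real (l + L) * t))))"
    by (rule summable_norm) (use summable_ignore_initial_segment[OF s, of L] in simp)
  also have "\<dots> = (\<Sum>l. \<bar>c (l + L)\<bar>)" unfolding norm_fourier_term ..
  also have "\<dots> = abs_tail c L" unfolding abs_tail_def using suminf_split_initial_segment[OF c, of L] by simp
  finally show ?thesis .
qed

lemma fourier_series_bound:
  assumes c: "summable (\<lambda>l. \<bar>c l\<bar>)"
  shows "cmod (fourier_series c t) \<le> (\<Sum>l. \<bar>c l\<bar>)"
  using fourier_series_error[OF c, of 0 t] by (simp add: fourier_partial_sum_def abs_tail_def)

lemma continuous_fourier_partial_sum: "continuous_on S (fourier_partial_sum L c)"
  unfolding fourier_partial_sum_def[abs_def] by (intro continuous_intros)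

lemma continuous_fourier_series:
  assumes "summable (\<lambda>l. \<bar>c l\<bar>)"
  shows "continuous_on S (fourier_series c)"
proof (rule uniform_limit_theorem)
  show "uniform_limit S (\<lambda>L. fourier_partial_sum L c) (fourier_series c) sequentially"
    unfolding fourier_series_def[abs_def] fourier_partial_sum_def[abs_def]
    by (rule Weierstrass_m_test[OF _ assms]) (simp add: norm_fourier_term del: of_real_mult)
qed (simp_all add: continuous_fourier_partial_sum)

lemma fourier_series_periodic: "fourier_series c (t + 2 * pi) = fourier_series c t"
proof -
  have "exp (\<i> * of_real (real l * (t + 2 * pi))) = exp (\<i> * of_real (real l * t))" for l
  proof -
    show ?thesis
      using exp_plus_2pin[of "\<i> * of_real (real l * t)" "int l"] by (simp add: algebra_simps)
  qed
  then show ?thesis by (simp add: fourier_series_def)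
qed

section \<open>Partial sums in one variable and lower triangular Toeplitz matrices\<close>

lemma int_dot_axis: "int_dot (axis s k) \<theta> = of_int k * \<theta> $ s"
proof -
  have "int_dot (axis s k) \<theta> = (\<Sum>s'\<in>UNIV. if s' = s then of_int k * \<theta> $ s else 0)"
    unfolding int_dot_def axis_def by (intro sum.cong) auto
  then show ?thesis by simp
qed

lemma inj_axis_int: "inj (\<lambda>l. axis s (int l) :: int ^ 'd::finite)"
  by (rule injI) (metis axis_nth of_nat_eq_iff)

lemma fourier_partial_sum_axis:
  "fourier_partial_sum L c (\<theta> $ s)
    = (\<Sum>k\<in>(\<lambda>l. axis s (int l)) ` {..<L}. complex_of_real (c (nat (k $ s))) * exp (\<i> * of_real (int_dot k \<theta>)))"
  unfolding fourier_partial_sum_def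
  by (subst sum.reindex) (auto intro: inj_on_subset[OF inj_axis_int] simp: int_dot_axis axis_nth)

lemma trig_poly_fourier_partial_sum: "trig_poly (\<lambda>\<theta> :: real ^ 'd::finite. fourier_partial_sum L c (\<theta> $ s))"
  unfolding trig_poly_def fourier_partial_sum_axis
  by (rule exI[of _ "(\<lambda>l. axis s (int l)) ` {..<L}"], rule exI[of _ "\<lambda>k. complex_of_real (c (nat (k $ s)))"]) auto

lemma fourier_coeff_partial_sum:
  "fourier_coeff (\<lambda>\<theta> :: real ^ 'd::finite. fourier_partial_sum L c (\<theta> $ s)) m
    = (if m \<in> (\<lambda>l. axis s (int l)) ` {..<L} then complex_of_real (c (nat (m $ s))) else 0)"
  unfolding fourier_partial_sum_axis by (rule fourier_coeff_trig_poly) simp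

lemma sum_truncation_error_le:
  assumes c: "summable (\<lambda>l. \<bar>c l\<bar>)" and u: "\<And>l. \<bar>u l\<bar> \<le> \<bar>c l\<bar>"
  shows "(\<Sum>l<n. \<bar>u l - (if l < L then c l else 0)\<bar>) \<le> (\<Sum>l<L. \<bar>u l - c l\<bar>) + abs_tail c L"
proof -
  have "(\<Sum>l<n. \<bar>u l - (if l < L then c l else 0)\<bar>) \<le> (\<Sum>l\<in>{..<L} \<union> {L..<n}. \<bar>u l - (if l < L then c l else 0)\<bar>)"
    by (rule sum_mono2) auto
  also have "\<dots> = (\<Sum>l<L. \<bar>u l - (if l < L then c l else 0)\<bar>) + (\<Sum>l\<in>{L..<n}. \<bar>u l - (if l < L then c l else 0)\<bar>)"
    by (rule sum.union_disjoint) auto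
  also have "(\<Sum>l\<in>{L..<n}. \<bar>u l - (if l < L then c l else 0)\<bar>) \<le> (\<Sum>l\<in>{L..<n}. \<bar>c l\<bar>)"
    using u by (intro sum_mono) auto
  also have "\<dots> \<le> abs_tail c L" by (rule sum_abs_le_tail[OF c])
  finally show ?thesis by simp
qed

text \<open>Schur's test for an error on the lower diagonals of a single level: the bounds
  \<open>p l\<close> of these diagonals add up. The two terms of \<open>A_mat\<close> act along
  different levels and are treated by one application each.\<close>

lemma spectral_norm_le_axis:
  assumes E: "E \<in> carrier_mat (level_size n) (level_size n)" and p: "\<And>l. 0 \<le> p l"
    and ne: "\<And>a b. a < level_size n \<Longrightarrow> b < level_size n \<Longrightarrow> E $$ (a, b) \<noteq> 0 \<Longrightarrow>
      \<exists>l<n $ s. int_index n a - int_index n b = axis s (int l) \<and> cmod (E $$ (a, b)) \<le> p l"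
  shows "spectral_norm E \<le> (\<Sum>l<n $ s. p l)"
proof -
  let ?K = "(\<lambda>l. axis s (int l)) ` {..<n $ s}"
  have *: "m \<in> ?K \<and> cmod (diag_entry n E m i) \<le> p (nat (m $ s))" if d: "diag_entry n E m i \<noteq> 0" for m i
  proof -
    from d have i: "i \<in> index_box n" "i - m \<in> index_box n" by (auto simp: diag_entry_def split: if_splits)
    then have "diag_entry n E m i = E $$ (index_pos n i, index_pos n (i - m))" by (simp add: diag_entry_def)
    moreover have "int_index n (index_pos n i) - int_index n (index_pos n (i - m)) = m" using i by simp
    ultimately obtain l where "l < n $ s" "m = axis s (int l)" "cmod (diag_entry n E m i) \<le> p l"
      using ne[of "index_pos n i" "index_pos n (i - m)"] i d by auto
    then show ?thesis by (auto simp: axis_nth)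
  qed
  have "spectral_norm E \<le> (\<Sum>m\<in>?K. p (nat (m $ s)))"
  proof (rule spectral_norm_le_diag[OF E])
    show "diag_entry n E m i = 0" if "m \<notin> ?K" for m i using * that by blast
    show "cmod (diag_entry n E m i) \<le> p (nat (m $ s))" for m i
      using *[of m i] p by (cases "diag_entry n E m i = 0") auto
  qed simp
  also have "\<dots> = (\<Sum>l<n $ s. p l)"
    by (subst sum.reindex) (auto intro: inj_on_subset[OF inj_axis_int] simp: axis_nth)
  finally show ?thesis .
qed

lemma int_index_1:
  assumes "a < k"
  shows "int_index (\<chi> s::1. k) a = axis 0 (int a)"
proof -
  have e: "{s<..} = {}" for s :: 1
  proof -
    have "\<not> s < x" for x by (subst num1_eqI[of x s]) simp
    then show ?thesis by auto
  qed
  have "multi_index (\<chi> s::1. k) a $ s = a" for s using assms by (simp add: multi_index_def e)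
  then show ?thesis
    by (simp add: Finite_Cartesian_Product.vec_eq_iff int_index_def axis_def num1_eqI[of _ 0] del: num1_eq1)
qed

lemma level_size_1: "level_size (\<chi> s::1. k) = k"
  by (simp add: level_size_def)

lemma axis_1_diff: "(axis 0 (int a) - axis 0 (int b) :: int ^ 1) = axis 0 (int a - int b)"
  by (simp add: Finite_Cartesian_Product.vec_eq_iff axis_def)

lemma mat_rank_zero: "mat_rank (0\<^sub>m n n) = 0"
  using vec_space.rank_0I by simp

text \<open>The coefficients \<open>u n\<close> may depend on the size, to cover the exponential
  damping in \<open>U_mat\<close>. For fixed \<open>r\<close> the first \<open>r\<close> of them
  converge and the others are dominated by the tail of \<open>c\<close>, so that cutting at
  \<open>r\<close> is accurate in norm, with rank part 0.\<close>

theorem periodic_glt_symbol_lower_toeplitz: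
  assumes c: "summable (\<lambda>l. \<bar>c l\<bar>)" and u: "\<And>n l. \<bar>u n l\<bar> \<le> \<bar>c l\<bar>"
    and lim: "\<And>l. (\<lambda>n. u n l) \<longlonglongrightarrow> c l"
  shows "periodic_glt_symbol (\<lambda>n. lower_toeplitz n (u n)) (fourier_series c)"
proof -
  let ?n = "\<lambda>k. (\<chi> s::1. k) :: nat ^ 1"
  let ?D = "unit_cube \<times> pi_cube :: ((real ^ 1) \<times> (real ^ 1)) set"
  define f where "f r = (\<lambda>l::nat. \<lambda>\<theta> :: real ^ 1. fourier_partial_sum r c (\<theta> $ 0))" for r
  have contD: "continuous_on ?D (\<lambda>p. fourier_series c (snd p $ 0))"
    by (rule continuous_on_compose2[OF continuous_fourier_series[OF c, of UNIV]]) (auto intro!: continuous_intros)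
  have meas: "(\<lambda>(x, \<theta>). fourier_series c (\<theta> $ 0)) \<in> borel_measurable (lebesgue_on ?D)"
    using continuous_imp_measurable_on_sets_lebesgue[OF contD] measure_symbol_domain(2)[where 'd = 1]
    by (simp add: case_prod_unfold fmeasurableD)
  have inm: "tendsto_in_measure ?D (\<lambda>r (x, \<theta>). \<Sum>l<(1::nat). 1 * f r l \<theta>) (\<lambda>(x, \<theta>). fourier_series c (\<theta> $ 0))"
    unfolding tendsto_in_measure_def
  proof (intro allI impI)
    fix \<epsilon> :: real assume \<epsilon>: "0 < \<epsilon>"
    have "\<forall>\<^sub>F r in sequentially. abs_tail c r < \<epsilon>"
      using order_tendstoD(2)[OF abs_tail_tendsto_0[OF c] \<epsilon>] .
    then have "\<forall>\<^sub>F r in sequentially. measure lebesgue {p \<in> ?D. \<epsilon> < cmod ((case p of (x, \<theta>) \<Rightarrow> \<Sum>l<(1::nat). 1 * f r l \<theta>) - (case p of (x, \<theta>) \<Rightarrow> fourier_series c (\<theta> $ 0)))} = 0"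
    proof eventually_elim
      case (elim r)
      have "{p \<in> ?D. \<epsilon> < cmod ((case p of (x, \<theta>) \<Rightarrow> \<Sum>l<(1::nat). 1 * f r l \<theta>) - (case p of (x, \<theta>) \<Rightarrow> fourier_series c (\<theta> $ 0)))} = {}"
        using order_trans[OF fourier_series_error[OF c, of r] less_imp_le[OF elim]] by (auto simp: f_def not_less)
      then show ?case by (simp only: measure_empty)
    qed
    then show "(\<lambda>r. measure lebesgue {p \<in> ?D. \<epsilon> < cmod ((case p of (x, \<theta>) \<Rightarrow> \<Sum>l<(1::nat). 1 * f r l \<theta>) - (case p of (x, \<theta>) \<Rightarrow> fourier_series c (\<theta> $ 0)))}) \<longlonglongrightarrow> 0"
      by (rule tendsto_eventually)
  qed
  have acs: "approx_class (\<lambda>k. level_size (?n k)) (\<lambda>r k. sampling_toeplitz_sum (?n k) 1 (\<lambda>_ _. 1) (f r)) (\<lambda>n. lower_toeplitz n (u n))"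
    unfolding approx_class_def level_size_1
  proof (intro exI conjI allI)
    show "(\<lambda>r::nat. 0 :: real) \<longlonglongrightarrow> 0" by simp
    show "(\<lambda>r. 1 / real (Suc r) + abs_tail c r) \<longlonglongrightarrow> 0"
      using tendsto_add[OF LIMSEQ_Suc[OF lim_1_over_n] abs_tail_tendsto_0[OF c]] by simp
    fix r
    have "(\<lambda>n. \<Sum>l<r. \<bar>u n l - c l\<bar>) \<longlonglongrightarrow> (\<Sum>l<r. \<bar>c l - c l\<bar>)"
      by (intro tendsto_sum tendsto_rabs tendsto_diff lim tendsto_const)
    then have "\<forall>\<^sub>F k in sequentially. (\<Sum>l<r. \<bar>u k l - c l\<bar>) < 1 / real (Suc r)"
      by (intro order_tendstoD(2)[of _ 0]) auto
    then show "\<forall>\<^sub>F k in sequentially. \<exists>R E. R \<in> carrier_mat k k \<and> E \<in> carrier_mat k k \<and>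
        lower_toeplitz k (u k) = sampling_toeplitz_sum (?n k) 1 (\<lambda>_ _. 1) (f r) + R + E \<and>
        real (mat_rank R) \<le> 0 * real k \<and> spectral_norm E \<le> 1 / real (Suc r) + abs_tail c r"
    proof eventually_elim
      case (elim k)
      define B where "B = sampling_toeplitz_sum (?n k) 1 (\<lambda>_ _. 1) (f r)"
      have B: "B \<in> carrier_mat k k" using sampling_toeplitz_sum_carrier[of "?n k"] by (simp add: B_def level_size_1)
      have X: "lower_toeplitz k (u k) \<in> carrier_mat k k" by (simp add: lower_toeplitz_def)
      define E where "E = lower_toeplitz k (u k) - B"
      have E: "E \<in> carrier_mat k k" using B by (simp add: E_def minus_carrier_mat)
      have Eab: "E $$ (a, b) = (if b \<le> a then complex_of_real (u k (a - b) - (if a - b < r then c (a - b) else 0)) else 0)"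
        if ab: "a < k" "b < k" for a b
      proof -
        have "B $$ (a, b) = fourier_coeff (\<lambda>\<theta> :: real ^ 1. fourier_partial_sum r c (\<theta> $ 0)) (axis 0 (int a - int b))"
          unfolding B_def using ab by (subst sampling_toeplitz_sum_index) (auto simp: level_size_1 int_index_1 axis_1_diff f_def)
        also have "\<dots> = (if b \<le> a then (if a - b < r then complex_of_real (c (a - b)) else 0) else 0)"
        proof -
          have "axis 0 (int a - int b) \<in> (\<lambda>l. axis (0 :: 1) (int l)) ` {..<r} \<longleftrightarrow> b \<le> a \<and> a - b < r"
            by (auto simp: axis_eq_axis image_iff intro!: bexI[of _ "a - b"])
          then show ?thesis unfolding fourier_coeff_partial_sum by (auto simp: axis_nth nat_diff_distrib')
        qed
        finally show ?thesis using ab B by (auto simp: E_def lower_toeplitz_def)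
      qed
      have "spectral_norm E \<le> (\<Sum>l<?n k $ 0. \<bar>u k l - (if l < r then c l else 0)\<bar>)"
      proof (rule spectral_norm_le_axis)
        show "E \<in> carrier_mat (level_size (?n k)) (level_size (?n k))" using E by (simp add: level_size_1)
        fix a b assume ab: "a < level_size (?n k)" "b < level_size (?n k)" and ne: "E $$ (a, b) \<noteq> 0"
        then have ab': "a < k" "b < k" by (simp_all add: level_size_1)
        then have le: "b \<le> a" using ne Eab by (auto split: if_splits)
        show "\<exists>l<?n k $ 0. int_index (?n k) a - int_index (?n k) b = axis 0 (int l) \<and> cmod (E $$ (a, b)) \<le> \<bar>u k l - (if l < r then c l else 0)\<bar>"
        proof (intro exI[of _ "a - b"] conjI)
          show "a - b < ?n k $ 0" using ab' by simp
          show "int_index (?n k) a - int_index (?n k) b = axis 0 (int (a - b))"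
            using ab' le by (simp add: int_index_1 axis_1_diff of_nat_diff)
          show "cmod (E $$ (a, b)) \<le> \<bar>u k (a - b) - (if a - b < r then c (a - b) else 0)\<bar>"
            using Eab[OF ab'] le by (simp only: if_True norm_of_real)
        qed
      qed simp
      also have "\<dots> \<le> (\<Sum>l<r. \<bar>u k l - c l\<bar>) + abs_tail c r"
        by (rule sum_truncation_error_le[OF c u])
      also have "\<dots> \<le> 1 / real (Suc r) + abs_tail c r" using elim by simp
      finally have sn: "spectral_norm E \<le> 1 / real (Suc r) + abs_tail c r" .
      have "lower_toeplitz k (u k) = B + 0\<^sub>m k k + E"
        using B X by (intro eq_matI) (auto simp: E_def)
      then show ?case
        unfolding B_def[symmetric] using E sn mat_rank_zero[of k]
        by (intro exI[of _ "0\<^sub>m k k"] exI[of _ E]) auto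
    qed
  qed
  have "glt_sequence ?n (\<lambda>n. lower_toeplitz n (u n)) (\<lambda>x \<theta>. fourier_series c (\<theta> $ 0))"
    unfolding glt_sequence_def
  proof (intro conjI allI)
    show "filterlim (\<lambda>k. ?n k $ s) at_top sequentially" for s by (simp add: filterlim_ident)
    show "lower_toeplitz k (u k) \<in> carrier_mat (level_size (?n k)) (level_size (?n k))" for k
      by (simp add: level_size_1 lower_toeplitz_def)
    show "\<exists>M b f. (\<forall>r. \<forall>l<M r. continuous_on unit_cube (b r l) \<and> trig_poly (f r l)) \<and>
        tendsto_in_measure ?D (\<lambda>r (x, \<theta>). \<Sum>l<M r. b r l x * f r l \<theta>) (\<lambda>(x, \<theta>). fourier_series c (\<theta> $ 0)) \<and>
        approx_class (\<lambda>k. level_size (?n k)) (\<lambda>r k. sampling_toeplitz_sum (?n k) (M r) (b r) (f r)) (\<lambda>n. lower_toeplitz n (u n))"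
      by (rule exI[of _ "\<lambda>_. 1"], rule exI[of _ "\<lambda>_ _ _. 1"], rule exI[of _ f])
        (use inm acs in \<open>simp add: f_def trig_poly_fourier_partial_sum\<close>)
  qed (rule meas)
  then show ?thesis
    unfolding periodic_glt_symbol_def using continuous_fourier_series[OF c] fourier_series_periodic by blast
qed

section \<open>The symbols of the discretization matrices\<close>

lemma periodic_glt_symbol_B_mat:
  assumes "0 < \<eta>" "\<eta> < 1"
  shows "periodic_glt_symbol (B_mat \<eta>) (fourier_series (frac_coeff \<eta>))"
  using periodic_glt_symbol_lower_toeplitz[OF summable_frac_coeff[OF assms], of "\<lambda>_. frac_coeff \<eta>"]
  by (simp add: B_mat_def[abs_def])

definition U_coeff :: "real \<Rightarrow> real \<Rightarrow> real \<Rightarrow> nat \<Rightarrow> nat \<Rightarrow> real" where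
  "U_coeff \<xi> \<rho> T n l = frac_coeff \<xi> l * exp (- \<rho> * real l * (T / real n))"

lemma U_coeff_bound:
  assumes "0 \<le> \<rho>" "0 \<le> T"
  shows "\<bar>U_coeff \<xi> \<rho> T n l\<bar> \<le> \<bar>frac_coeff \<xi> l\<bar>"
proof -
  have "exp (- \<rho> * real l * (T / real n)) \<le> 1"
    using assms by (simp add: divide_nonneg_nonneg mult_nonneg_nonneg)
  then show ?thesis
    using mult_left_mono[of "exp (- \<rho> * real l * (T / real n))" 1 "\<bar>frac_coeff \<xi> l\<bar>"] by (simp add: U_coeff_def abs_mult)
qed

lemma U_coeff_tendsto: "(\<lambda>n. U_coeff \<xi> \<rho> T n l) \<longlonglongrightarrow> frac_coeff \<xi> l"
proof -
  have "(\<lambda>n. frac_coeff \<xi> l * exp (- \<rho> * real l * (T / real n))) \<longlonglongrightarrow> frac_coeff \<xi> l * exp (- \<rho> * real l * 0)"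
    by (intro tendsto_intros lim_const_over_n)
  then show ?thesis by (simp add: U_coeff_def)
qed

lemma U_mat_eq: "U_mat \<xi> \<rho> T n = lower_toeplitz n (U_coeff \<xi> \<rho> T n)"
  by (simp add: U_mat_def U_coeff_def[abs_def])

lemma periodic_glt_symbol_U_mat:
  assumes "0 < \<xi>" "\<xi> < 1" "0 \<le> \<rho>" "0 \<le> T"
  shows "periodic_glt_symbol (U_mat \<xi> \<rho> T) (fourier_series (frac_coeff \<xi>))"
  using periodic_glt_symbol_lower_toeplitz[OF summable_frac_coeff[OF assms(1,2)], of "U_coeff \<xi> \<rho> T"]
    U_coeff_bound[OF assms(3,4)] U_coeff_tendsto
  by (simp add: U_mat_eq[abs_def])

lemma two_eq_zero: "(2::2) = 0"
  by simp

lemma less_type_2: "(0::2) < 1"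
  by (simp add: less_bit0_def bit0.Rep_0 bit0.Rep_1)

section \<open>The two-level matrices\<close>

abbreviation (input) level_pair :: "nat \<Rightarrow> nat \<Rightarrow> nat ^ 2" where
  "level_pair p q \<equiv> (\<chi> s. if s = 0 then p else q)"

lemma UNIV_type_2: "(UNIV :: 2 set) = {0, 1}"
  by (auto simp: UNIV_2)

lemma forall_type_2: "(\<forall>s :: 2. P s) \<longleftrightarrow> P 0 \<and> P 1"
  by (metis forall_2 two_eq_zero)

lemma level_size_pair: "level_size (level_pair p q) = p * q"
  by (simp add: level_size_def UNIV_type_2)

lemma int_index_pair:
  assumes "a < p * q"
  shows "int_index (level_pair p q) a = (\<chi> s. if s = 0 then int (a div q) else int (a mod q))"
proof -
  have s: "{0 :: 2<..} = {1}" "{1 :: 2<..} = {}"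
    using less_type_2 UNIV_type_2 by (auto simp: set_eq_iff) (metis UNIV_I insert_iff empty_iff less_irrefl less_asym)+
  have "multi_index (level_pair p q) a $ 0 = a div q" "multi_index (level_pair p q) a $ 1 = a mod q"
    using assms by (simp_all add: multi_index_def s less_mult_imp_div_less)
  then show ?thesis by (simp add: Finite_Cartesian_Product.vec_eq_iff int_index_def forall_type_2)
qed

lemma int_index_pair_diff:
  assumes "a < p * q" "b < p * q"
  shows "int_index (level_pair p q) a - int_index (level_pair p q) b = axis 0 (int l)
      \<longleftrightarrow> a mod q = b mod q \<and> b div q \<le> a div q \<and> l = a div q - b div q"
    and "int_index (level_pair p q) a - int_index (level_pair p q) b = axis 1 (int l)
      \<longleftrightarrow> a div q = b div q \<and> b mod q \<le> a mod q \<and> l = a mod q - b mod q"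
  using assms by (auto simp: int_index_pair Finite_Cartesian_Product.vec_eq_iff forall_type_2 axis_def)

lemma fourier_coeff_pair:
  assumes "a < p * q" "b < p * q"
  shows "fourier_coeff (\<lambda>\<theta>. fourier_partial_sum L c (\<theta> $ 0)) (int_index (level_pair p q) a - int_index (level_pair p q) b)
      = of_real (if a mod q = b mod q \<and> b div q \<le> a div q then if a div q - b div q < L then c (a div q - b div q) else 0 else 0)"
    and "fourier_coeff (\<lambda>\<theta>. fourier_partial_sum L c (\<theta> $ 1)) (int_index (level_pair p q) a - int_index (level_pair p q) b)
      = of_real (if a div q = b div q \<and> b mod q \<le> a mod q then if a mod q - b mod q < L then c (a mod q - b mod q) else 0 else 0)"
  unfolding fourier_coeff_partial_sum image_iff int_index_pair_diff[OF assms]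
  using assms by (auto simp: int_index_pair nat_diff_distrib')

lemma A_mat_carrier: "A_mat \<xi> \<eta> \<rho> T lam a q n m \<in> carrier_mat (Suc n * m) (Suc n * m)"
proof -
  have G: "dim_row (G_mat \<eta> a m) = m" "dim_col (G_mat \<eta> a m) = m"
    by (simp_all add: G_mat_def B_mat_def lower_toeplitz_def mat_diag_def)
  have "A_mat \<xi> \<eta> \<rho> T lam a q n m \<in> carrier_mat (n * m + m) (n * m + m)"
    unfolding A_mat_def
    by (rule four_block_carrier_mat) (auto simp: kronecker_def G intro!: carrier_matI)
  then show ?thesis by (simp add: add.commute)
qed

text \<open>The formula concerns the leading block. The other block row and block column, which
  contain \<open>q\<close> and \<open>lam / beta\<close>, are later charged to the rank.\<close>

lemma A_mat_index:
  assumes "i < n * m" "j < n * m"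
  shows "A_mat \<xi> \<eta> \<rho> T lam a q n m $$ (i, j) = complex_of_real
    ((if i mod m = j mod m \<and> j div m \<le> i div m then U_coeff \<xi> \<rho> T n (i div m - j div m) else 0) +
     (if i div m = j div m \<and> j mod m \<le> i mod m
      then (alpha \<xi> T n / beta \<eta> m) * a (real (i mod m + 1) / real m) * frac_coeff \<eta> (i mod m - j mod m) else 0))"
proof -
  have d: "i div m < n" "j div m < n" "i mod m < m" "j mod m < m"
    using assms by (auto simp: less_mult_imp_div_less intro!: mod_less_divisor gr0I)
  have G: "G_mat \<eta> a m = Matrix.mat m m (\<lambda>(i, j). of_real (a (real (i + 1) / real m)) * B_mat \<eta> m $$ (i, j))"
    unfolding G_mat_def by (rule mat_diag_mult_left) (simp add: B_mat_def lower_toeplitz_def)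
  show ?thesis
    using assms d
    by (simp add: A_mat_def kronecker_def U_mat_eq lower_toeplitz_def G B_mat_def)
qed

lemma card_grid_rows:
  assumes "S \<subseteq> {..<q}"
  shows "card {i. i < p * q \<and> i mod q \<in> S} \<le> p * card S"
proof -
  have "{i. i < p * q \<and> i mod q \<in> S} \<subseteq> (\<lambda>(k, s). k * q + s) ` ({..<p} \<times> S)"
  proof
    fix i assume "i \<in> {i. i < p * q \<and> i mod q \<in> S}"
    then show "i \<in> (\<lambda>(k, s). k * q + s) ` ({..<p} \<times> S)"
      by (intro image_eqI[of _ _ "(i div q, i mod q)"]) (auto simp: less_mult_imp_div_less)
  qed
  then have "card {i. i < p * q \<and> i mod q \<in> S} \<le> card ({..<p} \<times> S)"
    using finite_subset[OF assms] by (intro surj_card_le) auto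
  then show ?thesis by (simp add: card_cartesian_product)
qed

text \<open>The approximation at one accuracy: \<open>b\<close> replaces \<open>a\<close>,
  \<open>\<nu>\<close> replaces the quotient, and both series are cut at \<open>L\<close>. The rows
  whose grid coordinate lies in \<open>C\<close>, the last \<open>m k\<close> rows and the last
  \<open>m k\<close> columns go into \<open>R\<close>. The remaining error is
  \<open>E0 + E1\<close>, split by the level along which it acts, so that each part can be bounded
  by \<open>spectral_norm_le_axis\<close>.\<close>

lemma A_mat_decomposition:
  fixes a b :: "real \<Rightarrow> real" and n m :: "nat \<Rightarrow> nat"
  assumes par: "0 \<le> \<rho>" "0 \<le> T"
    and sg: "summable (\<lambda>l. \<bar>frac_coeff \<xi> l\<bar>)" and sd: "summable (\<lambda>l. \<bar>frac_coeff \<eta> l\<bar>)"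
    and \<epsilon>: "0 < \<epsilon>" "\<epsilon> \<le> 1"
    and C: "compact C" "C \<subseteq> W" "open W" "emeasure lborel W \<le> ennreal \<epsilon>"
    and ab: "\<And>x. x \<in> {0..1} \<Longrightarrow> x \<notin> C \<Longrightarrow> \<bar>a x - b x\<bar> \<le> \<epsilon>"
    and b: "\<And>x. x \<in> {0..1} \<Longrightarrow> \<bar>b x\<bar> \<le> M" and M: "0 \<le> M"
    and tg: "abs_tail (frac_coeff \<xi>) L \<le> \<epsilon>" and td: "(M + 1) * abs_tail (frac_coeff \<eta>) L \<le> \<epsilon>"
    and n: "filterlim n at_top sequentially" and m: "filterlim m at_top sequentially" "\<And>k. 0 < m k"
    and lim: "(\<lambda>k. alpha \<xi> T (n k) / beta \<eta> (m k)) \<longlonglongrightarrow> \<nu>"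
  defines "F \<equiv> \<lambda>l \<theta> :: real ^ 2. if l = 0 then fourier_partial_sum L (frac_coeff \<xi>) (\<theta> $ 0)
      else fourier_partial_sum L (frac_coeff \<eta>) (\<theta> $ 1)"
    and "N \<equiv> \<lambda>k. Suc (n k) * m k"
    and "\<beta> \<equiv> \<lambda>l x :: real ^ 2. if l = 0 then 1 else complex_of_real (\<nu> * b (x $ 1))"
  shows "\<forall>\<^sub>F k in sequentially. \<exists>R E. R \<in> carrier_mat (N k) (N k) \<and> E \<in> carrier_mat (N k) (N k) \<and>
      A_mat \<xi> \<eta> \<rho> T lam a q (n k) (m k)
        = sampling_toeplitz_sum (level_pair (Suc (n k)) (m k)) 2 \<beta> F + R + E \<and>
      real (mat_rank R) \<le> 2 * \<epsilon> * real (N k) \<and>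
      spectral_norm E \<le> \<epsilon> * (3 + \<bar>\<nu>\<bar> + (\<bar>\<nu>\<bar> + 2) * (\<Sum>l. \<bar>frac_coeff \<eta> l\<bar>))"
proof -
  define \<gamma> where "\<gamma> = frac_coeff \<xi>"
  define \<delta> where "\<delta> = frac_coeff \<eta>"
  define G where "G = (\<Sum>l. \<bar>\<delta> l\<bar>)"
  define \<tau> where "\<tau> = (\<lambda>k. alpha \<xi> T (n k) / beta \<eta> (m k))"
  \<comment> \<open>The divisor \<open>M + 1\<close> keeps the error of the quotient, multiplied by
    \<open>b\<close>, below \<open>\<epsilon>\<close>; since \<open>\<epsilon> \<le> 1\<close>, it
    also bounds the quotient by \<open>\<bar>\<nu>\<bar> + 1\<close>.\<close>
  have ev1: "\<forall>\<^sub>F k in sequentially. \<bar>\<tau> k - \<nu>\<bar> < \<epsilon> / (M + 1)"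
    using tendstoD[OF lim, of "\<epsilon> / (M + 1)"] \<epsilon> M by (simp add: dist_real_def \<tau>_def)
  have "(\<lambda>k. \<Sum>l<L. \<bar>U_coeff \<xi> \<rho> T (n k) l - \<gamma> l\<bar>) \<longlonglongrightarrow> (\<Sum>l<L. \<bar>\<gamma> l - \<gamma> l\<bar>)"
    unfolding \<gamma>_def
    by (intro tendsto_sum tendsto_rabs tendsto_diff tendsto_const filterlim_compose[OF U_coeff_tendsto n])
  then have ev2: "\<forall>\<^sub>F k in sequentially. (\<Sum>l<L. \<bar>U_coeff \<xi> \<rho> T (n k) l - \<gamma> l\<bar>) < \<epsilon>"
    using \<epsilon>(1) by (intro order_tendstoD(2)[of _ 0]) auto
  \<comment> \<open>The last \<open>m k\<close> rows and columns contribute at most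
    \<open>2 * m k\<close> to the rank, which is at most \<open>\<epsilon> * N k\<close> for such
    \<open>n k\<close>.\<close>
  have ev3: "\<forall>\<^sub>F k in sequentially. nat \<lceil>2 / \<epsilon>\<rceil> \<le> n k"
    using n unfolding filterlim_at_top by blast
  have ev4: "\<forall>\<^sub>F k in sequentially. real (card {i. i < m k \<and> real (i + 1) / real (m k) \<in> C}) \<le> \<epsilon> * real (m k)"
    using eventually_compose_filterlim[OF grid_count_compact[OF C(1-3) C(4) less_imp_le[OF \<epsilon>(1)]] m(1)] .
  from ev1 ev2 ev3 ev4 show ?thesis
  proof eventually_elim
    case (elim k)
    define p where "p = m k"
    define s where "s = n k"
    define K where "K = Suc s * p"
    have p: "0 < p" using m(2) by (simp add: p_def)
    let ?N = "level_pair (Suc s) p"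
    define A where "A = A_mat \<xi> \<eta> \<rho> T lam a q s p"
    define B where "B = sampling_toeplitz_sum ?N 2 \<beta> F"
    have ls: "level_size ?N = K" by (simp only: level_size_pair K_def)
    have A: "A \<in> carrier_mat K K" unfolding A_def K_def by (rule A_mat_carrier)
    have B: "B \<in> carrier_mat K K" using sampling_toeplitz_sum_carrier[of ?N] by (simp only: B_def ls)
    define x where "x i = real (i mod p + 1) / real p" for i
    have x: "x i \<in> {0..1}" for i
      using p mod_less_divisor[OF p, of i] by (simp add: x_def divide_le_eq_1)
    define P where "P = {s * p..<K} \<union> {i. i < K \<and> i mod p \<in> {i. i < p \<and> real (i + 1) / real p \<in> C}}"
    define Q where "Q = {s * p..<K}"
    have bulk: "i < s * p" "x i \<notin> C" if "i < K" "i \<notin> P" for i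
      using that mod_less_divisor[OF p, of i] by (auto simp: P_def x_def)
    \<comment> \<open>Errors of the coefficients on the \<open>l\<close>-th lower diagonal,
      \<open>u\<close> along the first level and \<open>v\<close> along the second. Only
      \<open>v\<close> depends on the row, through the sampled \<open>a\<close>.\<close>
    define u where "u l = U_coeff \<xi> \<rho> T s l - (if l < L then \<gamma> l else 0)" for l
    define v where "v i l = (\<tau> k * a (x i) - (if l < L then \<nu> * b (x i) else 0)) * \<delta> l" for i l
    define e0 where "e0 i j = (if i mod p = j mod p \<and> j div p \<le> i div p then u (i div p - j div p) else 0)" for i j
    define e1 where "e1 i j = (if i div p = j div p \<and> j mod p \<le> i mod p then v i (i mod p - j mod p) else 0)" for i j
    have AB: "A $$ (i, j) - B $$ (i, j) = complex_of_real (e0 i j + e1 i j)"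
      if ij: "i < K" "j < K" "i < s * p" "j < s * p" for i j
    proof -
      have gp: "grid_point ?N (int_index ?N i) $ 1 = x i"
        using ij by (simp add: grid_point_def int_index_pair K_def x_def)
      have "B $$ (i, j) = (\<Sum>l<2. \<beta> l (grid_point ?N (int_index ?N i)) * fourier_coeff (F l) (int_index ?N i - int_index ?N j))"
        unfolding B_def by (rule sampling_toeplitz_sum_index) (use ij ls in simp_all)
      also have "\<dots> = complex_of_real
         ((if i mod p = j mod p \<and> j div p \<le> i div p then if i div p - j div p < L then \<gamma> (i div p - j div p) else 0 else 0)
         + \<nu> * b (x i) * (if i div p = j div p \<and> j mod p \<le> i mod p then if i mod p - j mod p < L then \<delta> (i mod p - j mod p) else 0 else 0))"
        using fourier_coeff_pair[of i "Suc s" p j L] ij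
        by (simp add: numeral_2_eq_2 \<beta>_def F_def gp K_def \<gamma>_def \<delta>_def if_distrib[of complex_of_real] cong: if_cong)
      finally show ?thesis
        unfolding A_def A_mat_index[OF ij(3,4)] of_real_diff[symmetric]
        by (simp only: of_real_eq_iff) (simp add: e0_def e1_def u_def v_def x_def p_def s_def \<tau>_def \<delta>_def algebra_simps)
    qed
    define E0 where "E0 = Matrix.mat K K (\<lambda>(i, j). if i \<in> P \<or> j \<in> Q then 0 else complex_of_real (e0 i j))"
    define E1 where "E1 = Matrix.mat K K (\<lambda>(i, j). if i \<in> P \<or> j \<in> Q then 0 else complex_of_real (e1 i j))"
    define R where "R = Matrix.mat K K (\<lambda>(i, j). if i \<in> P \<or> j \<in> Q then A $$ (i, j) - B $$ (i, j) else 0)"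
    have "A = B + R + (E0 + E1)"
    proof (rule eq_matI)
      fix i j assume "i < dim_row (B + R + (E0 + E1))" "j < dim_col (B + R + (E0 + E1))"
      then have ij: "i < K" "j < K" by (simp_all add: E1_def)
      then show "A $$ (i, j) = (B + R + (E0 + E1)) $$ (i, j)"
      proof (cases "i \<in> P \<or> j \<in> Q")
        case False
        then have "A $$ (i, j) - B $$ (i, j) = complex_of_real (e0 i j + e1 i j)"
          using ij bulk by (intro AB) (auto simp: Q_def)
        with ij B False show ?thesis by (simp add: E0_def E1_def R_def algebra_simps)
      qed (use B in \<open>auto simp: E0_def E1_def R_def\<close>)
    qed (use A in \<open>simp_all add: E1_def\<close>)
    moreover have "real (mat_rank R) \<le> 2 * \<epsilon> * real K"
    proof -
      have "mat_rank R \<le> card P + card Q"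
        by (rule mat_rank_row_col_support[of _ _ _ K K]) (auto simp: P_def Q_def R_def)
      moreover have Q: "card Q = p" by (simp add: Q_def K_def)
      moreover have "card P \<le> p + Suc s * card {i. i < p \<and> real (i + 1) / real p \<in> C}"
        unfolding P_def K_def
        by (rule order_trans[OF card_Un_le add_mono[OF _ card_grid_rows]]) auto
      ultimately have "mat_rank R \<le> 2 * p + Suc s * card {i. i < p \<and> real (i + 1) / real p \<in> C}"
        by linarith
      then have "real (mat_rank R) \<le> 2 * real p + (real s + 1) * real (card {i. i < p \<and> real (i + 1) / real p \<in> C})"
        unfolding of_nat_le_iff[where 'a = real, symmetric] of_nat_add of_nat_mult of_nat_Suc of_nat_numeral
        by (simp only: add.commute)
      also have "\<dots> \<le> (\<epsilon> * (real s + 1)) * real p + (real s + 1) * (\<epsilon> * real p)"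
      proof (intro add_mono mult_right_mono mult_left_mono)
        have "2 / \<epsilon> \<le> real s" using elim(3) by (simp add: s_def nat_le_iff ceiling_le_iff)
        then show "2 \<le> \<epsilon> * (real s + 1)" using \<epsilon>(1) by (simp add: field_simps)
        show "real (card {i. i < p \<and> real (i + 1) / real p \<in> C}) \<le> \<epsilon> * real p" using elim(4) by (simp only: p_def)
      qed simp_all
      finally show ?thesis by (simp add: K_def algebra_simps)
    qed
    \<comment> \<open>\<open>E0\<close> contributes \<open>2 * \<epsilon>\<close>, from the
      convergence of the first \<open>L\<close> coefficients and from the tail. \<open>E1\<close>
      contributes \<open>(\<bar>\<nu>\<bar> + 2) * \<epsilon> * G\<close> from its first
      \<open>L\<close> coefficients and \<open>(\<bar>\<nu>\<bar> + 1) * \<epsilon>\<close> from the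
      tail, where the assumption on \<open>L\<close> cancels the factor
      \<open>M + 1\<close>.\<close>
    moreover have "spectral_norm (E0 + E1) \<le> \<epsilon> * (3 + \<bar>\<nu>\<bar> + (\<bar>\<nu>\<bar> + 2) * G)"
    proof -
      have n0: "spectral_norm E0 \<le> (\<Sum>l<?N $ 0. \<bar>u l\<bar>)"
      proof (rule spectral_norm_le_axis)
        fix i j assume ij: "i < level_size ?N" "j < level_size ?N" and ne: "E0 $$ (i, j) \<noteq> 0"
        then have l: "i mod p = j mod p \<and> j div p \<le> i div p" and E: "E0 $$ (i, j) = complex_of_real (u (i div p - j div p))"
          by (auto simp: E0_def e0_def ls split: if_splits)
        have ij': "i < Suc s * p" "j < Suc s * p" using ij by (simp_all only: ls K_def)
        have ax: "int_index ?N i - int_index ?N j = axis 0 (int (i div p - j div p))"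
          using l int_index_pair_diff(1)[OF ij'] by blast
        have "i div p - j div p < Suc s" using ij'(1) by (intro less_imp_diff_less less_mult_imp_div_less)
        then show "\<exists>l<?N $ 0. int_index ?N i - int_index ?N j = axis 0 (int l) \<and> cmod (E0 $$ (i, j)) \<le> \<bar>u l\<bar>"
          by (intro exI[of _ "i div p - j div p"] conjI ax) (simp_all add: E)
      qed (simp_all add: E0_def ls)
      also have "\<dots> \<le> (\<Sum>l<L. \<bar>U_coeff \<xi> \<rho> T s l - \<gamma> l\<bar>) + abs_tail \<gamma> L"
        unfolding u_def using sg U_coeff_bound[OF par] by (intro sum_truncation_error_le) (simp_all add: \<gamma>_def)
      also have "\<dots> \<le> 2 * \<epsilon>" using elim(2) tg by (simp add: s_def \<gamma>_def)
      finally have n0: "spectral_norm E0 \<le> 2 * \<epsilon>" .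
      \<comment> \<open>A bound for \<open>v\<close> in all rows outside \<open>P\<close>. Below
        \<open>L\<close> it measures the replacement of the quotient times \<open>a\<close> by
        \<open>\<nu>\<close> times \<open>b\<close>; from \<open>L\<close> on nothing is subtracted,
        and \<open>a\<close> itself is bounded by \<open>M + \<epsilon> \<le> M + 1\<close>
        there.\<close>
      define w where "w l = (if l < L then (\<bar>\<nu>\<bar> + 2) * \<epsilon> else (\<bar>\<nu>\<bar> + 1) * (M + 1)) * \<bar>\<delta> l\<bar>" for l
      have \<tau>M: "\<bar>\<tau> k - \<nu>\<bar> * (M + 1) \<le> \<epsilon>" using elim(1) M by (simp add: field_simps)
      have "\<epsilon> / (M + 1) \<le> 1" using \<epsilon> M by (simp add: divide_le_eq)
      then have \<tau>1: "\<bar>\<tau> k\<bar> \<le> \<bar>\<nu>\<bar> + 1" using elim(1) by linarith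
      have vw: "\<bar>v i l\<bar> \<le> w l" if i: "i < K" "i \<notin> P" for i l
      proof -
        have ab': "\<bar>a (x i) - b (x i)\<bar> \<le> \<epsilon>" "\<bar>b (x i)\<bar> \<le> M" using ab b x bulk[OF i] by auto
        have "\<bar>\<tau> k * a (x i) - \<nu> * b (x i)\<bar> = \<bar>\<tau> k * (a (x i) - b (x i)) + (\<tau> k - \<nu>) * b (x i)\<bar>"
          by (simp add: algebra_simps)
        also have "\<dots> \<le> \<bar>\<tau> k\<bar> * \<bar>a (x i) - b (x i)\<bar> + \<bar>\<tau> k - \<nu>\<bar> * \<bar>b (x i)\<bar>"
          by (simp add: abs_mult[symmetric] abs_triangle_ineq)
        also have "\<dots> \<le> (\<bar>\<nu>\<bar> + 1) * \<epsilon> + \<bar>\<tau> k - \<nu>\<bar> * (M + 1)"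
          using ab' \<tau>1 \<epsilon>(1) by (intro add_mono mult_mono mult_left_mono) auto
        also have "\<dots> \<le> (\<bar>\<nu>\<bar> + 2) * \<epsilon>" using \<tau>M by (simp add: algebra_simps)
        finally have "\<bar>\<tau> k * a (x i) - \<nu> * b (x i)\<bar> \<le> (\<bar>\<nu>\<bar> + 2) * \<epsilon>" .
        moreover have "\<bar>\<tau> k * a (x i)\<bar> \<le> (\<bar>\<nu>\<bar> + 1) * (M + 1)"
          unfolding abs_mult using ab' \<epsilon>(2) \<tau>1 by (intro mult_mono) auto
        ultimately show ?thesis by (auto simp: v_def w_def abs_mult intro: mult_right_mono)
      qed
      have w0: "0 \<le> w l" for l using \<epsilon>(1) M by (simp add: w_def)
      have n1: "spectral_norm E1 \<le> (\<Sum>l<?N $ 1. w l)"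
      proof (rule spectral_norm_le_axis)
        fix i j assume ij: "i < level_size ?N" "j < level_size ?N" and ne: "E1 $$ (i, j) \<noteq> 0"
        then have l: "i div p = j div p \<and> j mod p \<le> i mod p" and E: "E1 $$ (i, j) = complex_of_real (v i (i mod p - j mod p))"
          and i: "i \<notin> P"
          by (auto simp: E1_def e1_def ls split: if_splits)
        have ij': "i < Suc s * p" "j < Suc s * p" using ij by (simp_all only: ls K_def)
        have ax: "int_index ?N i - int_index ?N j = axis 1 (int (i mod p - j mod p))"
          using l int_index_pair_diff(2)[OF ij'] by blast
        have "i < K" using ij(1) by (simp only: ls)
        moreover have "i mod p - j mod p < p" using p by (simp add: less_imp_diff_less)
        ultimately show "\<exists>l<?N $ 1. int_index ?N i - int_index ?N j = axis 1 (int l) \<and> cmod (E1 $$ (i, j)) \<le> w l"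
          using vw[OF _ i, of "i mod p - j mod p"]
          by (intro exI[of _ "i mod p - j mod p"] conjI ax) (simp_all add: E)
      qed (simp_all add: E1_def ls w0)
      also have "(\<Sum>l<?N $ 1. w l) \<le> (\<Sum>l\<in>{..<L} \<union> {L..<p}. w l)"
        by (rule sum_mono2) (auto simp: w0)
      also have "\<dots> = (\<Sum>l<L. w l) + (\<Sum>l\<in>{L..<p}. w l)"
        by (rule sum.union_disjoint) auto
      also have "\<dots> = (\<bar>\<nu>\<bar> + 2) * \<epsilon> * (\<Sum>l<L. \<bar>\<delta> l\<bar>) + (\<bar>\<nu>\<bar> + 1) * (M + 1) * (\<Sum>l\<in>{L..<p}. \<bar>\<delta> l\<bar>)"
        by (simp add: w_def sum_distrib_left)
      also have "\<dots> \<le> (\<bar>\<nu>\<bar> + 2) * \<epsilon> * G + (\<bar>\<nu>\<bar> + 1) * (M + 1) * abs_tail \<delta> L"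
        using \<epsilon>(1) M sd unfolding G_def
        by (intro add_mono mult_left_mono sum_le_suminf sum_abs_le_tail) (auto simp: \<delta>_def)
      also have "\<dots> \<le> (\<bar>\<nu>\<bar> + 2) * \<epsilon> * G + (\<bar>\<nu>\<bar> + 1) * \<epsilon>"
        unfolding mult.assoc[of "\<bar>\<nu>\<bar> + 1"] using td by (intro add_left_mono mult_left_mono) (auto simp: \<delta>_def)
      finally have "spectral_norm E1 \<le> (\<bar>\<nu>\<bar> + 2) * \<epsilon> * G + (\<bar>\<nu>\<bar> + 1) * \<epsilon>" .
      moreover have "spectral_norm (E0 + E1) \<le> spectral_norm E0 + spectral_norm E1"
        by (rule spectral_norm_add[of _ K]) (simp_all add: E0_def E1_def)
      ultimately show ?thesis using n0 by (simp add: algebra_simps)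
    qed
    moreover have "R \<in> carrier_mat K K" "E0 + E1 \<in> carrier_mat K K" by (simp_all add: R_def E0_def E1_def)
    ultimately show ?case
      unfolding A_def B_def G_def \<delta>_def K_def s_def p_def N_def by blast
  qed
qed

section \<open>Strips over small sets and the measurability of the symbol\<close>

lemma coordinate_strip_measure:
  fixes D :: "((real ^ 2) \<times> (real ^ 2)) set"
  defines "D \<equiv> unit_cube \<times> pi_cube"
  assumes S: "S \<in> sets borel" "emeasure lborel S \<le> ennreal e" and e: "0 \<le> e" and X: "X \<subseteq> {p \<in> D. fst p $ s \<in> S}"
  shows "\<exists>Y \<in> sets borel. X \<subseteq> Y \<and> emeasure lborel Y \<le> ennreal (512 * e)"
proof -
  let ?b = "(axis s 1, 0) :: (real ^ 2) \<times> (real ^ 2)"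
  \<comment> \<open>Since \<open>pi < 4\<close>, all four coordinates on the domain are at most 4 in
    modulus; the three coordinates other than the chosen one give the factor
    \<open>8 ^ 3 = 512\<close>.\<close>
  let ?Y = "{p. p \<bullet> ?b \<in> S \<and> (\<forall>b'\<in>Basis - {?b}. \<bar>p \<bullet> b'\<bar> \<le> 4)}"
  have b: "?b \<in> Basis" by (auto simp: Basis_prod_def Basis_vec_def)
  have pb: "p \<bullet> ?b = fst p $ s" for p :: "(real ^ 2) \<times> (real ^ 2)"
    by (cases p) (simp add: inner_axis)
  have bd: "\<bar>p \<bullet> b'\<bar> \<le> 4" if "p \<in> D" "b' \<in> Basis" for p b'
  proof -
    have x: "\<bar>fst p $ t\<bar> \<le> 4" "\<bar>snd p $ t\<bar> \<le> 4" for t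
    proof -
      have "0 \<le> fst p $ t \<and> fst p $ t \<le> 1" "- pi \<le> snd p $ t \<and> snd p $ t \<le> pi"
        using that(1) by (auto simp: D_def mem_box_cart)
      then show "\<bar>fst p $ t\<bar> \<le> 4" "\<bar>snd p $ t\<bar> \<le> 4" using pi_less_4 by linarith+
    qed
    show ?thesis using that(2) x by (cases p) (auto simp: Basis_prod_def Basis_vec_def inner_axis)
  qed
  note strip = emeasure_coordinate_strip[OF b S(1), of D 4, OF bd]
  have "emeasure lborel ?Y = ennreal 512 * emeasure lborel S"
    using strip(1) by simp
  also have "\<dots> \<le> ennreal 512 * ennreal e" by (intro mult_left_mono S(2)) simp
  also have "\<dots> = ennreal (512 * e)" using e by (simp add: ennreal_mult)
  finally have "emeasure lborel ?Y \<le> ennreal (512 * e)" .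
  moreover have "X \<subseteq> ?Y" using X strip(2) unfolding pb by auto
  moreover have "?Y \<in> sets borel" by (rule strip(3)) simp_all
  ultimately show ?thesis by blast
qed

text \<open>The discontinuities of \<open>a\<close> lie in a Borel null set \<open>S\<close>, and
  the strip \<open>Z\<close> over \<open>S\<close> is null. On the rest of the domain the symbol is
  continuous, because \<open>a\<close> restricted to the complement of \<open>S\<close> is;
  completeness of Lebesgue measure then gives measurability on all of \<open>D\<close>.\<close>

lemma ae_continuous_symbol_measurable:
  fixes a :: "real \<Rightarrow> real" and D :: "((real ^ 2) \<times> (real ^ 2)) set"
  defines "D \<equiv> unit_cube \<times> pi_cube"
  assumes a: "AE x in lebesgue_on {0..1}. continuous (at x within {0..1}) a"
    and h: "continuous_on UNIV h" and g: "continuous_on UNIV g"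
  shows "(\<lambda>(x, \<theta>). h (\<theta> $ 0) + complex_of_real (\<nu> * a (x $ 1)) * g (\<theta> $ 1)) \<in> borel_measurable (lebesgue_on D)"
proof -
  let ?\<kappa> = "\<lambda>p :: (real ^ 2) \<times> (real ^ 2). h (snd p $ 0) + complex_of_real (\<nu> * a (fst p $ 1)) * g (snd p $ 1)"
  have D: "D \<in> sets lebesgue" using measure_symbol_domain(2)[where 'd = 2] by (simp add: D_def fmeasurableD)
  have "AE x in lebesgue. x \<in> {0..1} \<longrightarrow> continuous (at x within {0..1}) a"
    using a by (subst (asm) AE_restrict_space_iff) auto
  then have "{x \<in> {0..1}. \<not> continuous (at x within {0..1}) a} \<in> null_sets lebesgue"
    unfolding eventually_ae_filter by (auto intro: null_sets_completion_subset)
  then obtain S where S: "S \<in> null_sets lborel" "{x \<in> {0..1}. \<not> continuous (at x within {0..1}) a} \<subseteq> S"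
    unfolding null_sets_completion_iff2 by blast
  define Z where "Z = {p \<in> D. fst p $ 1 \<in> S}"
  have "\<exists>Y \<in> sets borel. Z \<subseteq> Y \<and> emeasure lborel Y \<le> ennreal (512 * 0)"
    by (rule coordinate_strip_measure[of S 0 Z 1]) (use S(1) in \<open>auto simp: Z_def D_def null_sets_def\<close>)
  then have Z: "Z \<in> null_sets lebesgue"
    unfolding null_sets_completion_iff2 by (auto simp: null_sets_def)
  have "continuous_on ({0..1} - S) a"
    unfolding continuous_on_eq_continuous_within
    using S(2) by (blast intro: continuous_within_subset)
  moreover have "(\<lambda>p. fst p $ 1) ` (D - Z) \<subseteq> {0..1} - S"
    by (auto simp: Z_def D_def mem_box_cart)
  ultimately have "continuous_on (D - Z) (\<lambda>p. a (fst p $ 1))"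
    by (intro continuous_on_compose2[of "{0..1} - S" a "D - Z" "\<lambda>p. fst p $ 1"] continuous_intros)
  then have "continuous_on (D - Z) ?\<kappa>"
    by (intro continuous_intros continuous_on_compose2[OF h] continuous_on_compose2[OF g]) auto
  then have "?\<kappa> \<in> borel_measurable (lebesgue_on (D - Z))"
    using D Z by (intro continuous_imp_measurable_on_sets_lebesgue) auto
  then have "(\<lambda>p. if p \<in> D - Z then ?\<kappa> p else 0) \<in> borel_measurable lebesgue"
    using D Z by (subst borel_measurable_if) auto
  moreover have "AE p in lebesgue. (if p \<in> D - Z then ?\<kappa> p else 0) = (if p \<in> D then ?\<kappa> p else 0)"
    using AE_not_in[OF Z] by eventually_elim auto
  ultimately have "(\<lambda>p. if p \<in> D then ?\<kappa> p else 0) \<in> borel_measurable lebesgue"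
    by (rule borel_measurable_AE)
  then show ?thesis
    using D by (subst (asm) borel_measurable_if) (simp_all add: case_prod_unfold)
qed

text \<open>As soon as \<open>K * \<epsilon> r < e\<close>, an error above \<open>e\<close> can
  occur only in the strip over \<open>W r\<close>, whose measure is at most a constant times
  \<open>\<epsilon> r\<close>.\<close>

lemma tendsto_in_measure_strip:
  fixes \<kappa> :: "(real ^ 2) \<times> (real ^ 2) \<Rightarrow> complex" and \<epsilon> :: "nat \<Rightarrow> real"
  assumes \<epsilon>: "\<epsilon> \<longlonglongrightarrow> 0" "\<And>r. 0 \<le> \<epsilon> r"
    and W: "\<And>r. open (W r)" "\<And>r. emeasure lborel (W r) \<le> ennreal (\<epsilon> r)"
    and le: "\<And>r p. p \<in> unit_cube \<times> pi_cube \<Longrightarrow> fst p $ s \<notin> W r \<Longrightarrow> cmod (\<phi> r p - \<kappa> p) \<le> K * \<epsilon> r"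
  shows "tendsto_in_measure (unit_cube \<times> pi_cube) \<phi> \<kappa>"
  unfolding tendsto_in_measure_def
proof (intro allI impI)
  fix e :: real assume e: "0 < e"
  let ?X = "\<lambda>r. {p \<in> unit_cube \<times> pi_cube. e < cmod (\<phi> r p - \<kappa> p)}"
  have "(\<lambda>r. K * \<epsilon> r) \<longlonglongrightarrow> K * 0" by (intro tendsto_intros \<epsilon>(1))
  then have "\<forall>\<^sub>F r in sequentially. K * \<epsilon> r < e" using e by (intro order_tendstoD(2)[of _ "K * 0"]) auto
  then have "\<forall>\<^sub>F r in sequentially. norm (measure lebesgue (?X r)) \<le> 512 * \<epsilon> r"
  proof eventually_elim
    case (elim r)
    have "?X r \<subseteq> {p \<in> unit_cube \<times> pi_cube. fst p $ s \<in> W r}"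
    proof
      fix p assume "p \<in> ?X r"
      then have p: "p \<in> unit_cube \<times> pi_cube" "e < cmod (\<phi> r p - \<kappa> p)" by blast+
      then have "fst p $ s \<in> W r" using le[OF p(1), of r] elim by linarith
      with p(1) show "p \<in> {p \<in> unit_cube \<times> pi_cube. fst p $ s \<in> W r}" by blast
    qed
    from coordinate_strip_measure[OF borel_open[OF W(1)] W(2) \<epsilon>(2) this]
    obtain Y where Y: "Y \<in> sets borel" "?X r \<subseteq> Y" "emeasure lborel Y \<le> ennreal (512 * \<epsilon> r)"
      by (rule bexE) simp
    have "emeasure lebesgue (?X r) \<le> emeasure lebesgue Y"
      using Y(1) by (intro emeasure_mono Y(2)) auto
    also have "\<dots> = emeasure lborel Y" using Y(1) by (simp add: emeasure_completion)
    finally have "emeasure lebesgue (?X r) \<le> ennreal (512 * \<epsilon> r)" using Y(3) by simp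
    then show ?case using \<epsilon>(2)[of r] by (simp add: measure_def enn2real_leI)
  qed
  then show "(\<lambda>r. measure lebesgue (?X r)) \<longlonglongrightarrow> 0"
    by (rule Lim_null_comparison) (use tendsto_mult_right_zero[OF \<epsilon>(1), of 512] in simp)
qed

theorem glt_sequence_A_mat:
  fixes a q :: "real \<Rightarrow> real" and n m :: "nat \<Rightarrow> nat"
  assumes \<xi>: "0 < \<xi>" "\<xi> < 1" and \<eta>: "0 < \<eta>" "\<eta> < 1" and par: "0 \<le> \<rho>" "0 \<le> T"
    and a: "AE x in lebesgue_on {0..1}. continuous (at x within {0..1}) a"
    and n: "filterlim n at_top sequentially" and m: "filterlim m at_top sequentially" "\<And>k. 0 < m k"
    and lim: "(\<lambda>k. alpha \<xi> T (n k) / beta \<eta> (m k)) \<longlonglongrightarrow> \<nu>"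
  shows "glt_sequence (\<lambda>k. level_pair (n k + 1) (m k)) (\<lambda>k. A_mat \<xi> \<eta> \<rho> T lam a q (n k) (m k))
    (\<lambda>x \<theta>. fourier_series (frac_coeff \<xi>) (\<theta> $ 0) + complex_of_real (\<nu> * a (x $ 1)) * fourier_series (frac_coeff \<eta>) (\<theta> $ 1))"
proof -
  define \<gamma> where "\<gamma> = frac_coeff \<xi>"
  define \<delta> where "\<delta> = frac_coeff \<eta>"
  have sg: "summable (\<lambda>l. \<bar>\<gamma> l\<bar>)" and sd: "summable (\<lambda>l. \<bar>\<delta> l\<bar>)"
    unfolding \<gamma>_def \<delta>_def by (rule summable_frac_coeff[OF \<xi>] summable_frac_coeff[OF \<eta>])+
  define G where "G = (\<Sum>l. \<bar>\<delta> l\<bar>)"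
  define \<epsilon> where "\<epsilon> r = 1 / real (Suc r)" for r
  have \<epsilon>: "0 < \<epsilon> r" "\<epsilon> r \<le> 1" for r by (simp_all add: \<epsilon>_def)
  have \<epsilon>0: "\<epsilon> \<longlonglongrightarrow> 0" unfolding \<epsilon>_def[abs_def] by (rule LIMSEQ_Suc[OF lim_1_over_n])
  \<comment> \<open>All choices for the accuracy \<open>\<epsilon> r\<close> at once. The cutoff
    \<open>L\<close> is chosen last, because the admissible tail depends on the bound
    \<open>M\<close> of \<open>b\<close>, which may grow with \<open>r\<close>.\<close>
  define Q where "Q r b C W M L \<longleftrightarrow> continuous_on {0..1} b \<and> compact C \<and> C \<subseteq> W \<and> open W \<and>
      emeasure lborel W \<le> ennreal (\<epsilon> r) \<and> (\<forall>x\<in>{0..1}. x \<notin> C \<longrightarrow> \<bar>a x - b x\<bar> \<le> \<epsilon> r) \<and>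
      (\<forall>x\<in>{0..1}. \<bar>b x\<bar> \<le> M) \<and> 0 \<le> M \<and> abs_tail \<gamma> L \<le> \<epsilon> r \<and> (M + 1) * abs_tail \<delta> L \<le> \<epsilon> r"
    for r and b :: "real \<Rightarrow> real" and C W M L
  have "\<exists>b C W M L. Q r b C W M L" for r
  proof -
    obtain b C W where b: "continuous_on {0..1} b" "compact C" "C \<subseteq> W" "open W" "emeasure lborel W \<le> ennreal (\<epsilon> r)"
      "\<And>x. x \<in> {0..1} \<Longrightarrow> x \<notin> C \<Longrightarrow> \<bar>a x - b x\<bar> \<le> \<epsilon> r"
      using ae_continuous_approximation[OF a \<epsilon>(1)] by blast
    have "bounded (b ` {0..1})" using b(1) by (intro compact_imp_bounded compact_continuous_image) auto
    then obtain M where M: "\<And>x. x \<in> {0..1} \<Longrightarrow> \<bar>b x\<bar> \<le> M" unfolding bounded_real by blast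
    have M0: "0 \<le> M" using M[of 0] by simp
    have "(\<lambda>L. (M + 1) * abs_tail \<delta> L) \<longlonglongrightarrow> (M + 1) * 0"
      by (intro tendsto_intros abs_tail_tendsto_0 sd)
    then have "\<forall>\<^sub>F L in sequentially. (M + 1) * abs_tail \<delta> L < \<epsilon> r"
      using \<epsilon>(1)[of r] by (intro order_tendstoD(2)[of _ "(M + 1) * 0"]) auto
    moreover have "\<forall>\<^sub>F L in sequentially. abs_tail \<gamma> L < \<epsilon> r"
      using order_tendstoD(2)[OF abs_tail_tendsto_0[OF sg] \<epsilon>(1)] .
    ultimately have "\<forall>\<^sub>F L in sequentially. (M + 1) * abs_tail \<delta> L < \<epsilon> r \<and> abs_tail \<gamma> L < \<epsilon> r"
      by (rule eventually_conj)
    then obtain L where "(M + 1) * abs_tail \<delta> L < \<epsilon> r" "abs_tail \<gamma> L < \<epsilon> r"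
      unfolding eventually_sequentially by blast
    with b M M0 have "Q r b C W M L" unfolding Q_def by auto
    then show ?thesis by blast
  qed
  then have "\<forall>r. \<exists>b C W M L. Q r b C W M L" by blast
  from choice[OF this] obtain b where "\<forall>r. \<exists>C W M L. Q r (b r) C W M L" by blast
  from choice[OF this] obtain C where "\<forall>r. \<exists>W M L. Q r (b r) (C r) W M L" by blast
  from choice[OF this] obtain W where "\<forall>r. \<exists>M L. Q r (b r) (C r) (W r) M L" by blast
  from choice[OF this] obtain M where "\<forall>r. \<exists>L. Q r (b r) (C r) (W r) (M r) L" by blast
  from choice[OF this] obtain L where Q: "\<And>r. Q r (b r) (C r) (W r) (M r) (L r)" by blast
  define F where "F r = (\<lambda>l::nat. \<lambda>\<theta> :: real ^ 2. if l = 0 then fourier_partial_sum (L r) \<gamma> (\<theta> $ 0)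
      else fourier_partial_sum (L r) \<delta> (\<theta> $ 1))" for r
  define \<beta> where "\<beta> r = (\<lambda>l::nat. \<lambda>x :: real ^ 2. if l = 0 then 1 else complex_of_real (\<nu> * b r (x $ 1)))" for r
  have cont: "continuous_on unit_cube (\<beta> r l)" for r l
  proof (cases "l = 0")
    case False
    have "continuous_on unit_cube (\<lambda>x :: real ^ 2. b r (x $ 1))"
      by (rule continuous_on_compose2[of "{0..1}" "b r"])
        (use Q[of r] in \<open>auto simp: Q_def mem_unit_cube intro!: continuous_intros\<close>)
    then show ?thesis using False unfolding \<beta>_def by (auto intro!: continuous_intros)
  qed (simp add: \<beta>_def)
  have trig: "trig_poly (F r l)" for r l
    by (cases "l = 0") (simp_all add: F_def trig_poly_fourier_partial_sum)
  have inm: "tendsto_in_measure (unit_cube \<times> pi_cube) (\<lambda>r (x, \<theta>). \<Sum>l<2. \<beta> r l x * F r l \<theta>)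
      (\<lambda>(x, \<theta>). fourier_series \<gamma> (\<theta> $ 0) + complex_of_real (\<nu> * a (x $ 1)) * fourier_series \<delta> (\<theta> $ 1))"
  proof (rule tendsto_in_measure_strip[where s = 1 and W = W and K = "1 + \<bar>\<nu>\<bar> * (1 + G)", OF \<epsilon>0])
    show "0 \<le> \<epsilon> r" "open (W r)" "emeasure lborel (W r) \<le> ennreal (\<epsilon> r)" for r
      using \<epsilon>(1)[of r] Q[of r] by (auto simp: Q_def)
    fix r and p :: "(real ^ 2) \<times> (real ^ 2)" assume p: "p \<in> unit_cube \<times> pi_cube" "fst p $ 1 \<notin> W r"
    obtain x \<theta> where p_eq: "p = (x, \<theta>)" by (cases p)
    have x: "x $ 1 \<in> {0..1}" "x $ 1 \<notin> C r" using p Q[of r] by (auto simp: p_eq mem_unit_cube Q_def)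
    let ?f = "fourier_series \<gamma> (\<theta> $ 0)" and ?f' = "fourier_partial_sum (L r) \<gamma> (\<theta> $ 0)"
    let ?g = "fourier_series \<delta> (\<theta> $ 1)" and ?g' = "fourier_partial_sum (L r) \<delta> (\<theta> $ 1)"
    have ab: "\<bar>b r (x $ 1) - a (x $ 1)\<bar> \<le> \<epsilon> r" "\<bar>b r (x $ 1)\<bar> \<le> M r + 1" and M: "0 \<le> M r"
      using x Q[of r] by (auto simp: Q_def abs_minus_commute intro: add_increasing2)
    have f: "cmod (?f' - ?f) \<le> \<epsilon> r"
      using order_trans[OF fourier_series_error[OF sg]] Q[of r] by (auto simp: Q_def)
    have g: "\<bar>b r (x $ 1)\<bar> * cmod (?g' - ?g) \<le> \<epsilon> r"
    proof -
      have "\<bar>b r (x $ 1)\<bar> * cmod (?g' - ?g) \<le> (M r + 1) * abs_tail \<delta> (L r)"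
        using ab M by (intro mult_mono fourier_series_error sd) auto
      then show ?thesis using Q[of r] by (auto simp: Q_def)
    qed
    have G: "cmod ?g \<le> G" unfolding G_def by (rule fourier_series_bound[OF sd])
    \<comment> \<open>Three errors: the cut of the first series, the cut of the second one weighted
      by \<open>b\<close>, and the replacement of \<open>a\<close> by \<open>b\<close> in front of a
      series bounded by \<open>G\<close>. They account for the constant
      \<open>1 + \<bar>\<nu>\<bar> * (1 + G)\<close>.\<close>
    have "(\<Sum>l<2. \<beta> r l x * F r l \<theta>) - (?f + complex_of_real (\<nu> * a (x $ 1)) * ?g)
        = (?f' - ?f) + complex_of_real \<nu> * (complex_of_real (b r (x $ 1)) * (?g' - ?g) + complex_of_real (b r (x $ 1) - a (x $ 1)) * ?g)"
      by (simp add: numeral_2_eq_2 \<beta>_def F_def algebra_simps)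
    also have "cmod \<dots> \<le> cmod (?f' - ?f) + \<bar>\<nu>\<bar> * (\<bar>b r (x $ 1)\<bar> * cmod (?g' - ?g) + \<bar>b r (x $ 1) - a (x $ 1)\<bar> * cmod ?g)"
      by (intro norm_triangle_le add_left_mono)
        (auto simp: norm_mult simp del: of_real_diff of_real_mult intro!: mult_left_mono norm_triangle_le)
    also have "\<dots> \<le> \<epsilon> r + \<bar>\<nu>\<bar> * (\<epsilon> r + \<epsilon> r * G)"
      using f g G ab(1) \<epsilon>(1)[of r] by (intro add_mono mult_left_mono mult_mono) auto
    finally show "cmod ((case p of (x, \<theta>) \<Rightarrow> \<Sum>l<2. \<beta> r l x * F r l \<theta>) -
        (case p of (x, \<theta>) \<Rightarrow> fourier_series \<gamma> (\<theta> $ 0) + complex_of_real (\<nu> * a (x $ 1)) * fourier_series \<delta> (\<theta> $ 1)))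
        \<le> (1 + \<bar>\<nu>\<bar> * (1 + G)) * \<epsilon> r"
      by (simp add: p_eq algebra_simps)
  qed
  have acs: "approx_class (\<lambda>k. level_size (level_pair (Suc (n k)) (m k)))
      (\<lambda>r k. sampling_toeplitz_sum (level_pair (Suc (n k)) (m k)) 2 (\<beta> r) (F r))
      (\<lambda>k. A_mat \<xi> \<eta> \<rho> T lam a q (n k) (m k))"
    unfolding approx_class_def level_size_pair
  proof (intro exI conjI allI)
    show "(\<lambda>r. 2 * \<epsilon> r) \<longlonglongrightarrow> 0" using tendsto_mult_right_zero[OF \<epsilon>0] .
    show "(\<lambda>r. \<epsilon> r * (3 + \<bar>\<nu>\<bar> + (\<bar>\<nu>\<bar> + 2) * G)) \<longlonglongrightarrow> 0" using tendsto_mult_left_zero[OF \<epsilon>0] .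
    fix r
    show "\<forall>\<^sub>F k in sequentially. \<exists>R E. R \<in> carrier_mat (Suc (n k) * m k) (Suc (n k) * m k) \<and>
        E \<in> carrier_mat (Suc (n k) * m k) (Suc (n k) * m k) \<and>
        A_mat \<xi> \<eta> \<rho> T lam a q (n k) (m k)
          = sampling_toeplitz_sum (level_pair (Suc (n k)) (m k)) 2 (\<beta> r) (F r) + R + E \<and>
        real (mat_rank R) \<le> 2 * \<epsilon> r * real (Suc (n k) * m k) \<and>
        spectral_norm E \<le> \<epsilon> r * (3 + \<bar>\<nu>\<bar> + (\<bar>\<nu>\<bar> + 2) * G)"
      unfolding \<beta>_def F_def G_def \<gamma>_def \<delta>_def
      by (rule A_mat_decomposition[where C = "C r" and W = "W r" and M = "M r"])
        (use Q[of r] \<epsilon>[of r] par sg sd n m lim in \<open>auto simp: Q_def \<gamma>_def \<delta>_def\<close>)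
  qed
  show ?thesis
    unfolding glt_sequence_def
  proof (intro conjI allI)
    show "filterlim (\<lambda>k. level_pair (n k + 1) (m k) $ s) at_top sequentially" for s
      using m(1) filterlim_compose[OF filterlim_Suc n] by (cases "s = 0") simp_all
    show "A_mat \<xi> \<eta> \<rho> T lam a q (n k) (m k)
        \<in> carrier_mat (level_size (level_pair (n k + 1) (m k))) (level_size (level_pair (n k + 1) (m k)))" for k
      unfolding level_size_pair Suc_eq_plus1[symmetric] by (rule A_mat_carrier)
    show "(\<lambda>(x :: real ^ 2, \<theta> :: real ^ 2). fourier_series (frac_coeff \<xi>) (\<theta> $ 0) + complex_of_real (\<nu> * a (x $ 1)) * fourier_series (frac_coeff \<eta>) (\<theta> $ 1))
        \<in> borel_measurable (lebesgue_on (unit_cube \<times> pi_cube))"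
      using ae_continuous_symbol_measurable[OF a continuous_fourier_series[OF sg] continuous_fourier_series[OF sd]]
      unfolding \<gamma>_def \<delta>_def .
    show "\<exists>M b f. (\<forall>r. \<forall>l<M r. continuous_on unit_cube (b r l) \<and> trig_poly (f r l)) \<and>
        tendsto_in_measure (unit_cube \<times> pi_cube) (\<lambda>r (x, \<theta>). \<Sum>l<M r. b r l x * f r l \<theta>)
          (\<lambda>(x, \<theta>). fourier_series (frac_coeff \<xi>) (\<theta> $ 0) + complex_of_real (\<nu> * a (x $ 1)) * fourier_series (frac_coeff \<eta>) (\<theta> $ 1)) \<and>
        approx_class (\<lambda>k. level_size (level_pair (n k + 1) (m k)))
          (\<lambda>r k. sampling_toeplitz_sum (level_pair (n k + 1) (m k)) (M r) (b r) (f r)) (\<lambda>k. A_mat \<xi> \<eta> \<rho> T lam a q (n k) (m k))"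
      by (rule exI[of _ "\<lambda>_. 2"], rule exI[of _ \<beta>], rule exI[of _ F])
        (use cont trig inm acs in \<open>simp only: Suc_eq_plus1 \<gamma>_def \<delta>_def simp_thms\<close>)
  qed
qed

theorem theorem4p4:
  fixes \<xi> \<eta> \<rho> T lam \<nu> :: real and a q :: "real \<Rightarrow> real" and n m :: "nat \<Rightarrow> nat"
  assumes "0 < \<xi>" "\<xi> < 1" and "0 < \<eta>" "\<eta> < 1" and "0 < \<rho>" and "0 < T" and "0 < lam"
    and "AE x in lebesgue_on {0..1}. continuous (at x within {0..1}) a"
    and "\<forall>x\<in>{0..1}. a x \<noteq> 0"
    and "\<forall>k. 0 < n k" and "\<forall>k. 0 < m k"
    and "filterlim n at_top sequentially" and "filterlim m at_top sequentially"
    and "(\<lambda>k. alpha \<xi> T (n k) / beta \<eta> (m k)) \<longlonglongrightarrow> \<nu>" and "\<nu> \<noteq> 0"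
  shows "(\<exists>!g. periodic_glt_symbol (B_mat \<eta>) g) \<and>
    (\<exists>!h. periodic_glt_symbol (U_mat \<xi> \<rho> T) h) \<and>
    (\<forall>g h. periodic_glt_symbol (B_mat \<eta>) g \<and> periodic_glt_symbol (U_mat \<xi> \<rho> T) h \<longrightarrow>
      (let A = (\<lambda>k. A_mat \<xi> \<eta> \<rho> T lam a q (n k) (m k));
           \<kappa> = (\<lambda>(x :: real^2) (\<theta> :: real^2).
                  h (\<theta> $ 0) + complex_of_real (\<nu> * a (x $ 1)) * g (\<theta> $ 1))
       in glt_sequence (\<lambda>k. \<chi> s. if s = 0 then n k + 1 else m k) A \<kappa> \<and>
          sv_distribution A (unit_cube \<times> pi_cube) (\<lambda>(x, \<theta>). \<kappa> x \<theta>)))"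
proof -
  note B = periodic_glt_symbol_B_mat[OF assms(3,4)]
  note U = periodic_glt_symbol_U_mat[OF assms(1,2) less_imp_le[OF assms(5)] less_imp_le[OF assms(6)]]
  have glt: "glt_sequence (\<lambda>k. level_pair (n k + 1) (m k)) (\<lambda>k. A_mat \<xi> \<eta> \<rho> T lam a q (n k) (m k))
      (\<lambda>x \<theta>. fourier_series (frac_coeff \<xi>) (\<theta> $ 0) + complex_of_real (\<nu> * a (x $ 1)) * fourier_series (frac_coeff \<eta>) (\<theta> $ 1))"
    by (rule glt_sequence_A_mat) (use assms in auto)
  have "0 < level_pair (n k + 1) (m k) $ s" for k s
    using assms(11) by simp
  note sv = glt_imp_sv_distribution[OF glt this]
  show ?thesis
    unfolding Let_def
  proof (intro conjI allI impI)
    show "\<exists>!g. periodic_glt_symbol (B_mat \<eta>) g" using B periodic_glt_symbol_unique by blast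
    show "\<exists>!h. periodic_glt_symbol (U_mat \<xi> \<rho> T) h" using U periodic_glt_symbol_unique by blast
    fix g h assume "periodic_glt_symbol (B_mat \<eta>) g \<and> periodic_glt_symbol (U_mat \<xi> \<rho> T) h"
    \<comment> \<open>Uniqueness reduces arbitrary symbols \<open>g\<close> and \<open>h\<close> to
      the Fourier series for which the claim has been established.\<close>
    then have "g = fourier_series (frac_coeff \<eta>)" "h = fourier_series (frac_coeff \<xi>)"
      using B U periodic_glt_symbol_unique by blast+
    then show "glt_sequence (\<lambda>k. \<chi> s. if s = 0 then n k + 1 else m k) (\<lambda>k. A_mat \<xi> \<eta> \<rho> T lam a q (n k) (m k))
        (\<lambda>(x :: real^2) (\<theta> :: real^2). h (\<theta> $ 0) + complex_of_real (\<nu> * a (x $ 1)) * g (\<theta> $ 1))"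
      "sv_distribution (\<lambda>k. A_mat \<xi> \<eta> \<rho> T lam a q (n k) (m k)) (unit_cube \<times> pi_cube)
        (\<lambda>(x :: real^2, \<theta> :: real^2). h (\<theta> $ 0) + complex_of_real (\<nu> * a (x $ 1)) * g (\<theta> $ 1))"
      using glt sv by simp_all
  qed
qed

end
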